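(* For any nonnegative integer $s$, the set $$\left\{ \zeta_2\left(j,\tfrac{1}{4}\right) \;\middle|\; j \in \mathbb{Z} \cap [s+3,2s+3] \right\}$$ contains at least one irrational number (i.e. an element of $\mathbb{Q}_2$ not lying in $\mathbb{Q}$).
   Context: Volkenborn integral: for $f:\mathbb{Z}_2\to\mathbb{Q}_2$, $\int_{\mathbb{Z}_2} f(t)\,\mathrm{d}t := \lim_{N\to\infty}\frac{1}{2^N}\sum_{k=0}^{2^N-1} f(k)$ whenever the limit exists $2$-adically. Teichmüller character for $p=2$: for $x\in\mathbb{Z}_2^\times$, $\omega(x)\in\{1,-1\}$ is the unique sign with $x\equiv\omega(x)\pmod{4\mathbb{Z}_2}$; for $x\in\mathbb{Q}_2^\times$, $\omega(x):=2^{v_2(x)}\omega(x/2^{v_2(x)})$ and $\langle x\rangle:=x/\omega(x)$. $2$-adic Hurwitz zeta function: for $x\in\mathbb{Q}_2$ with $|x|_2\geqslant 4$ and an integer $j\geqslant 2$, $\zeta_2(j,x):=\frac{1}{j-1}\int_{\mathbb{Z}_2}\langle t+x\rangle^{1-j}\,\mathrm{d}t\in\mathbb{Q}_2$. *)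

theory Defs
  imports Complex_Main "HOL-Computational_Algebra.Primes"
begin

section \<open>The 2-adic absolute value on the rationals\<close>

definition val2_rat :: "rat \<Rightarrow> int" where
  "val2_rat q = int (multiplicity 2 (fst (quotient_of q))) - int (multiplicity 2 (snd (quotient_of q)))"

definition abs2_rat :: "rat \<Rightarrow> real" where
  "abs2_rat q = (if q = 0 then 0 else 2 powi (- val2_rat q))"

lemma val2_rat_Fract:
  assumes "a \<noteq> 0" "b \<noteq> 0"
  shows "val2_rat (Fract a b) = int (multiplicity 2 a) - int (multiplicity 2 b)"
proof -
  obtain p d where pd: "quotient_of (Fract a b) = (p, d)" by fastforce
  have d: "d > 0" using pd quotient_of_denom_pos by blast
  have eq: "Fract a b = Fract p d"
    using pd by (metis Fract_of_int_quotient quotient_of_div)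
  hence ad: "a * d = p * b" using assms d by (simp add: eq_rat)
  hence p: "p \<noteq> 0" using assms d by auto
  have "multiplicity 2 (a * d) = multiplicity 2 a + multiplicity 2 d"
    using assms d by (intro prime_elem_multiplicity_mult_distrib) auto
  moreover have "multiplicity 2 (p * b) = multiplicity 2 p + multiplicity 2 b"
    using assms p by (intro prime_elem_multiplicity_mult_distrib) auto
  ultimately show ?thesis using ad pd by (simp add: val2_rat_def)
qed

lemma abs2_rat_0 [simp]: "abs2_rat 0 = 0"
  and abs2_rat_nonneg [simp]: "abs2_rat q \<ge> 0"
  and abs2_rat_eq_0_iff [simp]: "abs2_rat q = 0 \<longleftrightarrow> q = 0"
  by (auto simp: abs2_rat_def)

lemma abs2_rat_1 [simp]: "abs2_rat 1 = 1"
  by (simp add: abs2_rat_def val2_rat_def)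

lemma rat_nonzero_Fract:
  assumes "(q::rat) \<noteq> 0"
  obtains a b where "q = Fract a b" "a \<noteq> 0" "b \<noteq> 0"
  using assms by (cases q) (metis less_irrefl rat_number_collapse(1))

lemma val2_rat_mult:
  assumes "x \<noteq> 0" "y \<noteq> 0"
  shows "val2_rat (x * y) = val2_rat x + val2_rat y"
proof -
  obtain a b c d where x: "x = Fract a b" "a \<noteq> 0" "b \<noteq> 0" and y: "y = Fract c d" "c \<noteq> 0" "d \<noteq> 0"
    using assms by (metis rat_nonzero_Fract)
  have "multiplicity 2 (a * c) = multiplicity 2 a + multiplicity 2 c"
       "multiplicity 2 (b * d) = multiplicity 2 b + multiplicity 2 d"
    using x y by (auto intro!: prime_elem_multiplicity_mult_distrib)
  thus ?thesis using x y by (simp add: val2_rat_Fract)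
qed

lemma abs2_rat_mult: "abs2_rat (x * y) = abs2_rat x * abs2_rat y"
proof (cases "x = 0 \<or> y = 0")
  case False
  hence "- val2_rat (x * y) = - val2_rat x + - val2_rat y" by (simp add: val2_rat_mult)
  hence "(2::real) powi (- val2_rat (x * y)) = 2 powi (- val2_rat x) * 2 powi (- val2_rat y)"
    by (simp only:) (rule power_int_add, simp)
  thus ?thesis using False unfolding abs2_rat_def by simp
qed auto

lemma abs2_rat_minus [simp]: "abs2_rat (- x) = abs2_rat x"
proof -
  have "abs2_rat (-1) * abs2_rat (-1) = 1" by (simp flip: abs2_rat_mult)
  hence "abs2_rat (-1) = 1"
    by (metis abs2_rat_nonneg abs_of_nonneg abs_square_eq_1 power2_eq_square)
  thus ?thesis using abs2_rat_mult[of "-1" x] by simp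
qed

lemma abs2_rat_inverse: "abs2_rat (inverse x) = inverse (abs2_rat x)"
proof (cases "x = 0")
  case False
  hence "abs2_rat x * abs2_rat (inverse x) = 1" by (simp flip: abs2_rat_mult)
  thus ?thesis by (metis inverse_unique)
qed auto

lemma abs2_rat_ultra: "abs2_rat (x + y) \<le> max (abs2_rat x) (abs2_rat y)"
proof (cases "x = 0 \<or> y = 0 \<or> x + y = 0")
  case True
  thus ?thesis by (auto simp: le_max_iff_disj)
next
  case False
  hence nz: "x \<noteq> 0" "y \<noteq> 0" "x + y \<noteq> 0" by auto
  obtain a b c d where x: "x = Fract a b" "a \<noteq> 0" "b \<noteq> 0" and y: "y = Fract c d" "c \<noteq> 0" "d \<noteq> 0"
    using nz by (metis rat_nonzero_Fract)
  define u v w where "u = a * d" and "v = c * b" and "w = b * d"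
  have w: "w \<noteq> 0" "u \<noteq> 0" "v \<noteq> 0" using x y by (auto simp: u_def v_def w_def)
  have X: "x = Fract u w" and Y: "y = Fract v w"
    using x y by (auto simp: u_def v_def w_def eq_rat)
  have S: "x + y = Fract (u + v) w" using w by (simp add: X Y eq_rat algebra_simps)
  have uv: "u + v \<noteq> 0" using nz S by (auto simp: rat_number_collapse)
  have "2 ^ min (multiplicity 2 u) (multiplicity 2 v) dvd u + v"
    by (intro dvd_add multiplicity_dvd') auto
  hence "min (multiplicity 2 u) (multiplicity 2 v) \<le> multiplicity 2 (u + v)"
    using uv by (intro multiplicity_geI) auto
  hence "min (val2_rat x) (val2_rat y) \<le> val2_rat (x + y)"
    unfolding S unfolding X Y using w uv by (simp add: val2_rat_Fract)
  hence "val2_rat x \<le> val2_rat (x + y) \<or> val2_rat y \<le> val2_rat (x + y)" by linarith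
  thus ?thesis using nz
    by (auto simp: abs2_rat_def le_max_iff_disj power_int_increasing)
qed

lemma abs2_rat_triangle: "abs2_rat (x + y) \<le> abs2_rat x + abs2_rat y"
  using abs2_rat_ultra[of x y] abs2_rat_nonneg[of x] abs2_rat_nonneg[of y] by linarith

lemma abs2_rat_minus_commute: "abs2_rat (x - y) = abs2_rat (y - x)"
  using abs2_rat_minus[of "x - y"] by simp

lemma abs2_rat_triangle3: "\<bar>abs2_rat x - abs2_rat y\<bar> \<le> abs2_rat (x - y)"
  using abs2_rat_triangle[of "x - y" y]
    abs2_rat_triangle[of "y - x" x, unfolded abs2_rat_minus_commute[of y x]] by simp

section \<open>The field of 2-adic numbers, as the completion of the rationals\<close>

definition cauchy2 :: "(nat \<Rightarrow> rat) \<Rightarrow> bool" where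
  "cauchy2 X \<longleftrightarrow> (\<forall>e>0. \<exists>k. \<forall>m\<ge>k. \<forall>n\<ge>k. abs2_rat (X m - X n) < e)"

definition vanishes2 :: "(nat \<Rightarrow> rat) \<Rightarrow> bool" where
  "vanishes2 X \<longleftrightarrow> (\<lambda>n. abs2_rat (X n)) \<longlonglongrightarrow> 0"

definition q2_rel :: "(nat \<Rightarrow> rat) \<Rightarrow> (nat \<Rightarrow> rat) \<Rightarrow> bool" where
  "q2_rel X Y \<longleftrightarrow> cauchy2 X \<and> cauchy2 Y \<and> vanishes2 (\<lambda>n. X n - Y n)"

lemma cauchy2_const [simp]: "cauchy2 (\<lambda>_. c)"
  by (simp add: cauchy2_def)

lemma vanishes2_0 [simp]: "vanishes2 (\<lambda>_. 0)"
  by (simp add: vanishes2_def)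

lemma vanishes2_const_iff [simp]: "vanishes2 (\<lambda>_. c) \<longleftrightarrow> c = 0"
  by (simp add: vanishes2_def LIMSEQ_const_iff)

lemma vanishes2_minus: "vanishes2 X \<Longrightarrow> vanishes2 (\<lambda>n. - X n)"
  by (simp add: vanishes2_def)

lemma vanishes2_minus_commute: "vanishes2 (\<lambda>n. X n - Y n) \<Longrightarrow> vanishes2 (\<lambda>n. Y n - X n)"
  by (simp add: vanishes2_def abs2_rat_minus_commute)

lemma vanishes2_le:
  assumes "f \<longlonglongrightarrow> (0::real)" "\<And>n. abs2_rat (X n) \<le> f n"
  shows "vanishes2 X"
  unfolding vanishes2_def
  by (rule tendsto_sandwich[OF _ _ tendsto_const assms(1)]) (use assms(2) in auto)

lemma vanishes2_add: "vanishes2 X \<Longrightarrow> vanishes2 Y \<Longrightarrow> vanishes2 (\<lambda>n. X n + Y n)"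
  by (rule vanishes2_le[where f = "\<lambda>n. abs2_rat (X n) + abs2_rat (Y n)"])
     (auto simp: vanishes2_def abs2_rat_triangle intro: tendsto_add_zero)

lemma cauchy2_add:
  assumes "cauchy2 X" "cauchy2 Y"
  shows "cauchy2 (\<lambda>n. X n + Y n)"
  unfolding cauchy2_def
proof (intro allI impI)
  fix e :: real assume e: "e > 0"
  obtain k l where k: "\<And>m n. m \<ge> k \<Longrightarrow> n \<ge> k \<Longrightarrow> abs2_rat (X m - X n) < e"
    and l: "\<And>m n. m \<ge> l \<Longrightarrow> n \<ge> l \<Longrightarrow> abs2_rat (Y m - Y n) < e"
    using assms e unfolding cauchy2_def by metis
  have "abs2_rat (X m + Y m - (X n + Y n)) < e" if "m \<ge> max k l" "n \<ge> max k l" for m n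
    using abs2_rat_ultra[of "X m - X n" "Y m - Y n"] k[of m n] l[of m n] that
    by (simp add: algebra_simps)
  thus "\<exists>k. \<forall>m\<ge>k. \<forall>n\<ge>k. abs2_rat (X m + Y m - (X n + Y n)) < e" by blast
qed

lemma cauchy2_minus:
  assumes "cauchy2 X"
  shows "cauchy2 (\<lambda>n. - X n)"
proof -
  have "abs2_rat (- X m - - X n) = abs2_rat (X m - X n)" for m n
    using abs2_rat_minus_commute[of "X m" "X n"] by (simp add: algebra_simps)
  thus ?thesis using assms unfolding cauchy2_def by metis
qed

lemma cauchy2_abs2_convergent:
  assumes "cauchy2 X"
  shows "convergent (\<lambda>n. abs2_rat (X n))"
proof -
  have "Cauchy (\<lambda>n. abs2_rat (X n))"
    unfolding Cauchy_def dist_real_def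
    using assms abs2_rat_triangle3 unfolding cauchy2_def by (meson order.strict_trans1)
  thus ?thesis by (rule Cauchy_convergent)
qed

lemma cauchy2_bounded:
  assumes "cauchy2 X"
  obtains B where "B > 0" "\<And>n. abs2_rat (X n) < B"
proof -
  have "Bseq (\<lambda>n. abs2_rat (X n))"
    using cauchy2_abs2_convergent[OF assms] by (rule convergent_imp_Bseq)
  then obtain K where "K > 0" "\<And>n. abs2_rat (X n) \<le> K"
    unfolding Bseq_def by auto
  thus ?thesis by (intro that[of "K + 1"]) (simp_all add: add_pos_pos order.strict_trans1[where b = K])
qed

lemma vanishes2_mult_bounded:
  assumes "cauchy2 X" "vanishes2 Y"
  shows "vanishes2 (\<lambda>n. X n * Y n)"
proof -
  obtain B where B: "B > 0" "\<And>n. abs2_rat (X n) < B" using cauchy2_bounded[OF assms(1)] by blast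
  show ?thesis
  proof (rule vanishes2_le)
    show "(\<lambda>n. B * abs2_rat (Y n)) \<longlonglongrightarrow> 0"
      using assms(2) unfolding vanishes2_def by (rule tendsto_mult_right_zero)
    show "abs2_rat (X n * Y n) \<le> B * abs2_rat (Y n)" for n
      unfolding abs2_rat_mult using B(2)[of n] by (intro mult_right_mono) auto
  qed
qed

lemma cauchy2_mult:
  assumes "cauchy2 X" "cauchy2 Y"
  shows "cauchy2 (\<lambda>n. X n * Y n)"
  unfolding cauchy2_def
proof (intro allI impI)
  fix e :: real assume e: "e > 0"
  obtain B where B: "B > 0" "\<And>n. abs2_rat (X n) < B" using cauchy2_bounded[OF assms(1)] by blast
  obtain C where C: "C > 0" "\<And>n. abs2_rat (Y n) < C" using cauchy2_bounded[OF assms(2)] by blast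
  have "e / C > 0" "e / B > 0" using e B C by auto
  then obtain k l where k: "\<And>m n. m \<ge> k \<Longrightarrow> n \<ge> k \<Longrightarrow> abs2_rat (X m - X n) < e / C"
    and l: "\<And>m n. m \<ge> l \<Longrightarrow> n \<ge> l \<Longrightarrow> abs2_rat (Y m - Y n) < e / B"
    using assms unfolding cauchy2_def by metis
  have "abs2_rat (X m * Y m - X n * Y n) < e" if mn: "m \<ge> max k l" "n \<ge> max k l" for m n
  proof -
    have "abs2_rat (X m * (Y m - Y n)) < B * (e / B)"
      unfolding abs2_rat_mult using B(2)[of m] l[of m n] mn B(1) by (intro mult_strict_mono) auto
    moreover have "abs2_rat ((X m - X n) * Y n) < (e / C) * C"
      unfolding abs2_rat_mult using C k[of m n] mn e by (intro mult_strict_mono) auto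
    moreover have "X m * Y m - X n * Y n = X m * (Y m - Y n) + (X m - X n) * Y n"
      by (simp add: algebra_simps)
    ultimately show ?thesis
      using abs2_rat_ultra[of "X m * (Y m - Y n)" "(X m - X n) * Y n"] B C by simp
  qed
  thus "\<exists>k. \<forall>m\<ge>k. \<forall>n\<ge>k. abs2_rat (X m * Y m - X n * Y n) < e" by blast
qed

lemma cauchy2_not_vanishes:
  assumes "cauchy2 X" "\<not> vanishes2 X"
  obtains c k where "c > 0" "\<And>n. n \<ge> k \<Longrightarrow> abs2_rat (X n) > c"
proof -
  obtain L where L: "(\<lambda>n. abs2_rat (X n)) \<longlonglongrightarrow> L"
    using cauchy2_abs2_convergent[OF assms(1)] by (auto simp: convergent_def)
  have "L \<ge> 0" using L by (rule LIMSEQ_le_const) auto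
  moreover have "L \<noteq> 0" using L assms(2) by (auto simp: vanishes2_def)
  ultimately have "L > 0" by simp
  hence "eventually (\<lambda>n. abs2_rat (X n) > L / 2) sequentially"
    using order_tendstoD(1)[OF L, of "L / 2"] by simp
  then obtain k where "\<And>n. n \<ge> k \<Longrightarrow> abs2_rat (X n) > L / 2"
    by (auto simp: eventually_sequentially)
  thus ?thesis using that[of "L / 2" k] \<open>L > 0\<close> by auto
qed

lemma abs2_rat_inverse_diff:
  assumes c: "c > 0" and x: "abs2_rat x > c" and y: "abs2_rat y > c"
  shows "abs2_rat (inverse x - inverse y) \<le> abs2_rat (x - y) / c\<^sup>2"
proof -
  have nz: "x \<noteq> 0" "y \<noteq> 0" using assms by auto
  have "abs2_rat (inverse x - inverse y) = abs2_rat ((y - x) * inverse (x * y))"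
    using nz by (simp add: field_simps)
  also have "\<dots> = abs2_rat (x - y) / (abs2_rat x * abs2_rat y)"
    by (simp only: abs2_rat_mult abs2_rat_inverse abs2_rat_minus_commute[of y x] divide_inverse)
  also have "\<dots> \<le> abs2_rat (x - y) / c\<^sup>2"
    unfolding power2_eq_square using assms
    by (intro divide_left_mono mult_mono mult_pos_pos) auto
  finally show ?thesis .
qed

lemma cauchy2_inverse:
  assumes "cauchy2 X" "\<not> vanishes2 X"
  shows "cauchy2 (\<lambda>n. inverse (X n))"
  unfolding cauchy2_def
proof (intro allI impI)
  fix e :: real assume e: "e > 0"
  obtain c k where c: "c > 0" "\<And>n. n \<ge> k \<Longrightarrow> abs2_rat (X n) > c"
    using cauchy2_not_vanishes[OF assms] by blast
  have "e * c\<^sup>2 > 0" using e c by simp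
  then obtain l where l: "\<And>m n. m \<ge> l \<Longrightarrow> n \<ge> l \<Longrightarrow> abs2_rat (X m - X n) < e * c\<^sup>2"
    using assms(1) unfolding cauchy2_def by metis
  have "abs2_rat (inverse (X m) - inverse (X n)) < e" if mn: "m \<ge> max k l" "n \<ge> max k l" for m n
  proof -
    have "abs2_rat (inverse (X m) - inverse (X n)) \<le> abs2_rat (X m - X n) / c\<^sup>2"
      using c mn by (intro abs2_rat_inverse_diff) auto
    also have "\<dots> < e" using l[of m n] mn c by (simp add: divide_less_eq)
    finally show ?thesis .
  qed
  thus "\<exists>k. \<forall>m\<ge>k. \<forall>n\<ge>k. abs2_rat (inverse (X m) - inverse (X n)) < e" by blast
qed

lemma q2_rel_vanishes_iff: "q2_rel X Y \<Longrightarrow> vanishes2 X \<longleftrightarrow> vanishes2 Y"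
  using vanishes2_add[of Y "\<lambda>n. X n - Y n"]
    vanishes2_add[of X "\<lambda>n. Y n - X n", OF _ vanishes2_minus_commute]
  by (auto simp: q2_rel_def)

lemma vanishes2_inverse_diff:
  assumes "q2_rel X Y" "\<not> vanishes2 X"
  shows "vanishes2 (\<lambda>n. inverse (X n) - inverse (Y n))"
proof -
  have X: "cauchy2 X" and Y: "cauchy2 Y" "\<not> vanishes2 Y" and D: "vanishes2 (\<lambda>n. X n - Y n)"
    using assms q2_rel_vanishes_iff[OF assms(1)] by (auto simp: q2_rel_def)
  obtain c k where c: "c > 0" "\<And>n. n \<ge> k \<Longrightarrow> abs2_rat (X n) > c"
    using cauchy2_not_vanishes[OF X assms(2)] by blast
  obtain d l where d: "d > 0" "\<And>n. n \<ge> l \<Longrightarrow> abs2_rat (Y n) > d"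
    using cauchy2_not_vanishes[OF Y] by blast
  define b where "b = min c d"
  have b: "b > 0" using c d by (simp add: b_def)
  have "\<forall>\<^sub>F n in sequentially. abs2_rat (inverse (X n) - inverse (Y n)) \<le> abs2_rat (X n - Y n) / b\<^sup>2"
    using eventually_ge_at_top[of "max k l"]
  proof eventually_elim
    case (elim n)
    thus ?case using b c(2)[of n] d(2)[of n] by (intro abs2_rat_inverse_diff) (auto simp: b_def)
  qed
  moreover have "(\<lambda>n. abs2_rat (X n - Y n) / b\<^sup>2) \<longlonglongrightarrow> 0"
    using tendsto_divide_zero D unfolding vanishes2_def by blast
  ultimately show ?thesis unfolding vanishes2_def
    by (rule tendsto_sandwich[OF _ _ tendsto_const, rotated]) auto
qed

quotient_type q2 = "nat \<Rightarrow> rat" / partial: q2_rel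
proof (rule part_equivpI)
  show "\<exists>X. q2_rel X X" by (rule exI[of _ "\<lambda>_. 0"]) (simp add: q2_rel_def)
  show "symp q2_rel" by (rule sympI) (auto simp: q2_rel_def intro: vanishes2_minus_commute)
  show "transp q2_rel"
  proof (rule transpI)
    fix X Y Z assume "q2_rel X Y" "q2_rel Y Z"
    thus "q2_rel X Z"
      using vanishes2_add[of "\<lambda>n. X n - Y n" "\<lambda>n. Y n - Z n"] by (auto simp: q2_rel_def)
  qed
qed

instantiation q2 :: field
begin

lift_definition zero_q2 :: q2 is "\<lambda>_. 0" by (simp add: q2_rel_def)

lift_definition one_q2 :: q2 is "\<lambda>_. 1" by (simp add: q2_rel_def)

lift_definition plus_q2 :: "q2 \<Rightarrow> q2 \<Rightarrow> q2" is "\<lambda>X Y n. X n + Y n"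
  subgoal for X X' Y Y'
    using vanishes2_add[of "\<lambda>n. X n - X' n" "\<lambda>n. Y n - Y' n"]
    by (auto simp: q2_rel_def cauchy2_add algebra_simps)
  done

lift_definition uminus_q2 :: "q2 \<Rightarrow> q2" is "\<lambda>X n. - X n"
  subgoal for X X'
    using vanishes2_minus[of "\<lambda>n. X n - X' n"]
    by (auto simp: q2_rel_def cauchy2_minus)
  done

definition "x - y = x + - (y::q2)"

lift_definition times_q2 :: "q2 \<Rightarrow> q2 \<Rightarrow> q2" is "\<lambda>X Y n. X n * Y n"
  subgoal for X X' Y Y'
    using vanishes2_add[OF vanishes2_mult_bounded[of X "\<lambda>n. Y n - Y' n"]
        vanishes2_mult_bounded[of Y' "\<lambda>n. X n - X' n"]]
    by (auto simp: q2_rel_def cauchy2_mult algebra_simps)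
  done

lift_definition inverse_q2 :: "q2 \<Rightarrow> q2" is "\<lambda>X. if vanishes2 X then (\<lambda>_. 0) else (\<lambda>n. inverse (X n))"
  subgoal for X X'
    using q2_rel_vanishes_iff[of X X'] vanishes2_inverse_diff[of X X']
    by (auto simp: q2_rel_def cauchy2_inverse)
  done

definition "x div y = x * inverse (y::q2)"

instance
proof
  fix a b c :: q2
  show "a * b * c = a * (b * c)"
    by transfer (simp add: q2_rel_def cauchy2_mult algebra_simps)
  show "a * b = b * a"
    by transfer (simp add: q2_rel_def cauchy2_mult algebra_simps)
  show "1 * a = a" by transfer (simp add: q2_rel_def)
  show "a + b + c = a + (b + c)"
    by transfer (simp add: q2_rel_def cauchy2_add algebra_simps)
  show "a + b = b + a"
    by transfer (simp add: q2_rel_def cauchy2_add algebra_simps)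
  show "0 + a = a" by transfer (simp add: q2_rel_def)
  show "- a + a = 0" by transfer (simp add: q2_rel_def)
  show "a - b = a + - b" by (simp add: minus_q2_def)
  show "(a + b) * c = a * c + b * c"
    by transfer (simp add: q2_rel_def cauchy2_add cauchy2_mult algebra_simps)
  show "(0::q2) \<noteq> 1" by transfer (simp add: q2_rel_def)
  show "a \<noteq> 0 \<Longrightarrow> inverse a * a = 1"
  proof transfer
    fix X assume "q2_rel X X" and nz: "\<not> q2_rel X (\<lambda>_. 0)"
    hence X: "cauchy2 X" "\<not> vanishes2 X" by (auto simp: q2_rel_def)
    obtain c k where c: "c > 0" "\<And>n. n \<ge> k \<Longrightarrow> abs2_rat (X n) > c"
      using cauchy2_not_vanishes[OF X] by blast
    have "\<forall>\<^sub>F n in sequentially. abs2_rat (inverse (X n) * X n - 1) = 0"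
      using eventually_ge_at_top[of k]
    proof eventually_elim
      case (elim n)
      hence "X n \<noteq> 0" using c by fastforce
      thus ?case by simp
    qed
    hence "vanishes2 (\<lambda>n. inverse (X n) * X n - 1)"
      unfolding vanishes2_def by (rule tendsto_eventually)
    thus "q2_rel (\<lambda>n. (if vanishes2 X then \<lambda>_. 0 else (\<lambda>n. inverse (X n))) n * X n) (\<lambda>_. 1)"
      using X by (simp add: q2_rel_def cauchy2_mult cauchy2_inverse)
  qed
  show "inverse (0::q2) = 0" by transfer (simp add: q2_rel_def)
  show "a div b = a * inverse b" by (simp add: divide_q2_def)
qed

end

lemma of_nat_q2_const: "q2_rel (\<lambda>_. of_nat n) (\<lambda>_. of_nat n) \<and> of_nat n = abs_q2 (\<lambda>_. of_nat n)"
proof (induction n)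
  case 0
  show ?case by (simp add: q2_rel_def zero_q2_def)
next
  case (Suc n)
  thus ?case by (simp add: q2_rel_def one_q2.abs_eq plus_q2.abs_eq)
qed

instance q2 :: field_char_0
proof
  show "inj (of_nat :: nat \<Rightarrow> q2)"
  proof (rule injI)
    fix m n :: nat assume "(of_nat m :: q2) = of_nat n"
    hence "q2_rel (\<lambda>_. of_nat m) (\<lambda>_. of_nat n)"
      using Quotient_rel[OF Quotient_q2, of "\<lambda>_. of_nat m" "\<lambda>_. of_nat n"]
        of_nat_q2_const[of m] of_nat_q2_const[of n] by simp
    thus "m = n" by (simp add: q2_rel_def)
  qed
qed

text \<open>The absolute value \<open>|x|\<^sub>2\<close>, normalised by \<open>|2|\<^sub>2 = 1/2\<close>; it induces the metric and
  hence the topology in which \<^const>\<open>lim\<close> is taken below.\<close>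

lift_definition abs2 :: "q2 \<Rightarrow> real" is "\<lambda>X. lim (\<lambda>n. abs2_rat (X n))"
proof -
  fix X Y assume XY: "q2_rel X Y"
  obtain L where L: "(\<lambda>n. abs2_rat (Y n)) \<longlonglongrightarrow> L"
    using cauchy2_abs2_convergent XY by (auto simp: convergent_def q2_rel_def)
  have "(\<lambda>n. abs2_rat (X n) - abs2_rat (Y n)) \<longlonglongrightarrow> 0"
  proof (rule tendsto_0_le[where K = 1 and f = "\<lambda>n. abs2_rat (X n - Y n)"])
    show "(\<lambda>n. abs2_rat (X n - Y n)) \<longlonglongrightarrow> 0" using XY by (simp add: q2_rel_def vanishes2_def)
    show "\<forall>\<^sub>F n in sequentially. norm (abs2_rat (X n) - abs2_rat (Y n)) \<le> norm (abs2_rat (X n - Y n)) * 1"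
      using abs2_rat_triangle3 by simp
  qed
  from tendsto_add[OF this L] have "(\<lambda>n. abs2_rat (X n)) \<longlonglongrightarrow> L" by simp
  thus "lim (\<lambda>n. abs2_rat (X n)) = lim (\<lambda>n. abs2_rat (Y n))" using L by (simp add: limI)
qed

lemma cauchy2_lim: "cauchy2 X \<Longrightarrow> (\<lambda>n. abs2_rat (X n)) \<longlonglongrightarrow> lim (\<lambda>n. abs2_rat (X n))"
  using cauchy2_abs2_convergent by (simp add: convergent_LIMSEQ_iff)

lemma abs2_eq_0_iff: "abs2 x = 0 \<longleftrightarrow> x = 0"
proof transfer
  fix X assume "q2_rel X X"
  hence X: "cauchy2 X" by (simp add: q2_rel_def)
  show "lim (\<lambda>n. abs2_rat (X n)) = 0 \<longleftrightarrow> q2_rel X (\<lambda>_. 0)"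
    using X cauchy2_lim[OF X] limI[of "\<lambda>n. abs2_rat (X n)" 0] unfolding q2_rel_def vanishes2_def
    by (simp, metis)
qed

lemma abs2_triangle: "abs2 (x + y) \<le> abs2 x + abs2 y"
proof transfer
  fix X Y assume "q2_rel X X" "q2_rel Y Y"
  hence X: "cauchy2 X" and Y: "cauchy2 Y" by (auto simp: q2_rel_def)
  show "lim (\<lambda>n. abs2_rat (X n + Y n)) \<le> lim (\<lambda>n. abs2_rat (X n)) + lim (\<lambda>n. abs2_rat (Y n))"
    by (rule LIMSEQ_le[OF cauchy2_lim[OF cauchy2_add[OF X Y]]
          tendsto_add[OF cauchy2_lim[OF X] cauchy2_lim[OF Y]]])
       (use abs2_rat_triangle in blast)
qed

lemma abs2_minus: "abs2 (- x) = abs2 x"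
  by transfer simp

instantiation q2 :: metric_space
begin

definition dist_q2 :: "q2 \<Rightarrow> q2 \<Rightarrow> real" where
  "dist_q2 x y = abs2 (x - y)"

definition uniformity_q2 :: "(q2 \<times> q2) filter" where
  "uniformity_q2 = (INF e\<in>{0 <..}. principal {(x, y). dist x y < e})"

definition open_q2 :: "q2 set \<Rightarrow> bool" where
  "open_q2 U \<longleftrightarrow> (\<forall>x\<in>U. eventually (\<lambda>(x', y). x' = x \<longrightarrow> y \<in> U) uniformity)"

instance
proof
  show "(uniformity :: (q2 \<times> q2) filter) = (INF e\<in>{0 <..}. principal {(x, y). dist x y < e})"
    by (rule uniformity_q2_def)
  show "open U \<longleftrightarrow> (\<forall>x\<in>U. eventually (\<lambda>(x', y). x' = x \<longrightarrow> y \<in> U) uniformity)" for U :: "q2 set"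
    by (rule open_q2_def)
  show "dist x y = 0 \<longleftrightarrow> x = y" for x y :: q2
    by (simp add: dist_q2_def abs2_eq_0_iff)
  show "dist x y \<le> dist x z + dist y z" for x y z :: q2
    using abs2_triangle[of "x - z" "z - y"] abs2_minus[of "y - z"] by (simp add: dist_q2_def)
qed

end

subsection \<open>Density of the rationals and completeness\<close>

lemma q2_rel_const [simp]: "q2_rel (\<lambda>_. q) (\<lambda>_. r) \<longleftrightarrow> q = r"
  by (simp add: q2_rel_def)

lemma of_rat_q2: "(of_rat q :: q2) = abs_q2 (\<lambda>_. q)"
proof (cases q)
  case (Fract a b)
  have int: "(of_int k :: q2) = abs_q2 (\<lambda>_. of_int k)" for k
  proof (cases k)
    case (nonneg n)
    thus ?thesis using of_nat_q2_const[of n] by simp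
  next
    case (neg n)
    thus ?thesis using of_nat_q2_const[of "Suc n"]
      by (simp add: uminus_q2.abs_eq flip: of_nat_Suc)
  qed
  have "abs_q2 (\<lambda>_. q) * of_int b = abs_q2 (\<lambda>_. q * of_int b)"
    by (simp add: int times_q2.abs_eq)
  also have "q * of_int b = of_int a"
    using Fract by (simp add: Fract_of_int_quotient)
  finally have "abs_q2 (\<lambda>_. q) * of_int b = of_int a" by (simp add: int)
  moreover have "(of_rat q :: q2) = of_int a / of_int b"
    using Fract by (simp add: of_rat_rat)
  moreover have "(of_int b :: q2) \<noteq> 0" using Fract by simp
  ultimately show ?thesis by (metis nonzero_mult_div_cancel_right)
qed

lemma abs2_of_rat: "abs2 (of_rat q) = abs2_rat q"
  by (simp add: of_rat_q2 abs2.abs_eq)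

lemma abs2_two: "abs2 2 = 1 / 2"
proof -
  have "val2_rat (Fract 2 1) = 1" by (subst val2_rat_Fract) auto
  hence "abs2_rat 2 = 1 / 2" by (simp add: abs2_rat_def Fract_of_int_quotient power_int_minus)
  thus ?thesis using abs2_of_rat[of 2] by simp
qed

lemma abs2_mult: "abs2 (x * y) = abs2 x * abs2 y"
proof transfer
  fix X Y assume "q2_rel X X" "q2_rel Y Y"
  hence X: "cauchy2 X" and Y: "cauchy2 Y" by (auto simp: q2_rel_def)
  show "lim (\<lambda>n. abs2_rat (X n * Y n)) = lim (\<lambda>n. abs2_rat (X n)) * lim (\<lambda>n. abs2_rat (Y n))"
    unfolding abs2_rat_mult by (rule limI[OF tendsto_mult[OF cauchy2_lim[OF X] cauchy2_lim[OF Y]]])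
qed

lemma cauchy2_tendsto_q2:
  assumes "cauchy2 X"
  shows "(\<lambda>n. of_rat (X n) :: q2) \<longlonglongrightarrow> abs_q2 X"
proof (rule metric_LIMSEQ_I)
  fix e :: real assume "e > 0"
  then obtain k where k: "\<And>m n. m \<ge> k \<Longrightarrow> n \<ge> k \<Longrightarrow> abs2_rat (X m - X n) < e / 2"
    using assms unfolding cauchy2_def by (metis half_gt_zero)
  have "dist (of_rat (X n)) (abs_q2 X) < e" if n: "n \<ge> k" for n
  proof -
    have C: "cauchy2 (\<lambda>m. X n - X m)"
      using cauchy2_add[OF cauchy2_const cauchy2_minus[OF assms], of "X n"] by simp
    have "of_rat (X n) - abs_q2 X = abs_q2 (\<lambda>m. X n - X m)"
      using assms cauchy2_minus[OF assms]
      by (simp add: of_rat_q2 minus_q2_def uminus_q2.abs_eq plus_q2.abs_eq q2_rel_def)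
    hence "dist (of_rat (X n)) (abs_q2 X) = lim (\<lambda>m. abs2_rat (X n - X m))"
      using C by (simp add: dist_q2_def abs2.abs_eq q2_rel_def)
    also have "\<dots> \<le> e / 2"
      by (rule LIMSEQ_le_const2[OF cauchy2_lim[OF C]]) (use k n in \<open>auto intro: less_imp_le\<close>)
    also have "\<dots> < e" using \<open>e > 0\<close> by simp
    finally show ?thesis .
  qed
  thus "\<exists>k. \<forall>n\<ge>k. dist (of_rat (X n)) (abs_q2 X) < e" by blast
qed

lemma q2_rat_dense:
  assumes "e > 0"
  obtains q where "dist (x::q2) (of_rat q) < e"
proof -
  obtain X where X: "cauchy2 X" "x = abs_q2 X"
    using Quotient_abs_rep[OF Quotient_q2, of x] Quotient_rep_reflp[OF Quotient_q2, of x]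
    by (metis q2_rel_def)
  obtain n where "dist (of_rat (X n)) x < e"
    using metric_LIMSEQ_D[OF cauchy2_tendsto_q2[OF X(1)] assms] X(2) by blast
  thus ?thesis using that by (metis dist_commute)
qed

instance q2 :: complete_space
proof
  fix Y :: "nat \<Rightarrow> q2" assume Y: "Cauchy Y"
  have "\<exists>q. dist (Y n) (of_rat q) < inverse (real (Suc n))" for n
    using q2_rat_dense[of "inverse (real (Suc n))" "Y n"] by auto
  then obtain X where X: "\<And>n. dist (Y n) (of_rat (X n)) < inverse (real (Suc n))" by metis
  have D: "(\<lambda>n. dist (Y n) (of_rat (X n))) \<longlonglongrightarrow> 0"
    by (rule tendsto_sandwich[OF _ _ tendsto_const LIMSEQ_inverse_real_of_nat])
       (use X in \<open>auto intro!: always_eventually less_imp_le simp del: of_nat_Suc\<close>)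
  have "cauchy2 X" unfolding cauchy2_def
  proof (intro allI impI)
    fix e :: real assume e: "e > 0"
    obtain k where k: "\<And>m n. m \<ge> k \<Longrightarrow> n \<ge> k \<Longrightarrow> dist (Y m) (Y n) < e / 3"
      using metric_CauchyD[OF Y, of "e / 3"] e by auto
    obtain l where l: "\<And>n. n \<ge> l \<Longrightarrow> dist (Y n) (of_rat (X n)) < e / 3"
      using metric_LIMSEQ_D[OF D, of "e / 3"] e by auto
    have "abs2_rat (X m - X n) < e" if "m \<ge> max k l" "n \<ge> max k l" for m n
    proof -
      have "abs2_rat (X m - X n) = dist (of_rat (X m)) (of_rat (X n) :: q2)"
        by (simp add: dist_q2_def abs2_of_rat flip: of_rat_diff)
      also have "\<dots> \<le> dist (Y m) (of_rat (X m)) + dist (Y m) (Y n) + dist (Y n) (of_rat (X n))"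
        by (smt (verit) dist_commute dist_triangle)
      also have "\<dots> < e" using k[of m n] l[of m] l[of n] that by simp
      finally show ?thesis .
    qed
    thus "\<exists>k. \<forall>m\<ge>k. \<forall>n\<ge>k. abs2_rat (X m - X n) < e" by blast
  qed
  from tendsto_dist[OF cauchy2_tendsto_q2[OF this] tendsto_const, of "abs_q2 X"]
  have E: "(\<lambda>n. dist (of_rat (X n)) (abs_q2 X)) \<longlonglongrightarrow> 0" by simp
  have "(\<lambda>n. dist (Y n) (abs_q2 X)) \<longlonglongrightarrow> 0"
    by (rule tendsto_sandwich[OF _ _ tendsto_const tendsto_add_zero[OF D E]])
       (auto simp: dist_triangle)
  hence "Y \<longlonglongrightarrow> abs_q2 X" by (subst tendsto_dist_iff)
  thus "convergent Y" by (auto simp: convergent_def)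
qed

section \<open>The 2-adic Hurwitz zeta function\<close>

definition z2 :: "q2 set" where
  "z2 = {x. abs2 x \<le> 1}"

text \<open>The valuation; meaningful for nonzero arguments only.\<close>

definition val2 :: "q2 \<Rightarrow> int" where
  "val2 x = (THE v. abs2 x = 2 powi (- v))"

text \<open>The Teichmueller character: \<open>teich_unit\<close> is meaningful on units of \<open>z2\<close> (absolute value 1),
  \<open>teich\<close> and \<open>angle_bracket\<close> on nonzero 2-adic numbers.\<close>

definition teich_unit :: "q2 \<Rightarrow> q2" where
  "teich_unit x = (THE w. w \<in> {1, -1} \<and> (\<exists>z\<in>z2. x - w = 4 * z))"

definition teich :: "q2 \<Rightarrow> q2" where
  "teich x = 2 powi val2 x * teich_unit (x / 2 powi val2 x)"

definition angle_bracket :: "q2 \<Rightarrow> q2" where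
  "angle_bracket x = x / teich x"

text \<open>The integrand lives on \<open>\<int>\<^sub>2\<close>, but only its values at natural numbers enter. The value is
  unspecified if the limit does not exist.\<close>

definition volkenborn :: "(q2 \<Rightarrow> q2) \<Rightarrow> q2" where
  "volkenborn f = lim (\<lambda>N. 1 / 2 ^ N * (\<Sum>k<2^N. f (of_nat k)))"

text \<open>Meaningful for \<open>j \<ge> 2\<close> and \<open>|x|\<^sub>2 \<ge> 4\<close>.\<close>

definition hurwitz_zeta2 :: "int \<Rightarrow> q2 \<Rightarrow> q2" where
  "hurwitz_zeta2 j x = 1 / of_int (j - 1) * volkenborn (\<lambda>t. angle_bracket (t + x) powi (1 - j))"

end

theory Submission
  imports Defs "HOL-Computational_Algebra.Polynomial_FPS" "HOL-Number_Theory.Cong" "HOL-Number_Theory.Prime_Powers"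
    "HOL-Real_Asymp.Real_Asymp"
begin

unbundle fps_syntax

text \<open>Put \<open>r = s + 2\<close>, \<open>n = 2\<^sup>a - 1\<close> and
  \<open>R(t) = t\<^sup>s (\<Prod>j=1..n. t + j)\<^sup>r / (\<Prod>k=0..n. t + k + 1/4)\<^sup>r\<close>. Partial fractions and the translation
  formula \<open>\<integral> f(t + 1) = \<integral> f(t) + f'(0)\<close> of the Volkenborn integral turn \<open>S = \<integral> R\<^bsup>(s)\<^esup>(t) / s! dt\<close> into a
  rational linear form in \<open>1\<close> and \<open>\<zeta>\<^sub>2(j, 1/4)\<close>, \<open>s + 3 \<le> j \<le> 2 s + 3\<close>; the would-be term \<open>j = s + 2\<close> drops
  out because \<open>R\<close> has no residue at infinity. The coefficients are polynomially bounded in \<open>n\<close>, and multiplication by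
  \<open>d\<^bsup>2 r - 1\<^esup>\<close>, \<open>d = lcm(1, \<dots>, n)\<close>, leaves only powers of 2 in their denominators. Splitting \<open>t = b + 2\<^sup>a \<tau>\<close> shows that
  the class \<open>b = 0\<close> dominates, whence exactly \<open>|S|\<^sub>2 = |n! 4\<^bsup>n + 1\<^esup>|\<^sub>2\<^bsup>r\<^esup> 2\<^sup>a\<close>; so \<open>S \<noteq> 0\<close> and
  \<open>|S|\<^sub>2 = 2\<^bsup>-3 r n + O(log n)\<^esup>\<close>. If all the zeta values were rational, a bounded multiple of \<open>d\<^bsup>2 r - 1\<^esup> S\<close> would be a
  nonzero element \<open>x\<close> of \<open>\<int>[1/2]\<close>, so \<open>|x|\<^sub>2 |x| \<ge> 1\<close>. This contradicts \<open>d \<le> 2\<^bsup>3 n / 2\<^esup>\<close>, a refinement of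
  Chebyshev's estimate (his own constant 1.1056 exceeds \<open>3/2 log 2\<close>).\<close>

subsection \<open>An upper bound for the Chebyshev function\<close>

text \<open>Why \<open>3/2 * log 2\<close>: the two absolute values of d^(2 r - 1) S multiply to
  about 2^(-3 r n) d^(2 r - 1), so log d / n must stay below 3 r / (2 r - 1) * log 2, which
  decreases to 3/2 * log 2 as r grows. A bound valid for every s needs this constant, and it leaves
  the gain 2^(-3 n / 2).

  The arithmetical obstacle is the rational term. Translating the integrals by k produces
  derivatives at l + 1/4, l < k, with powers of 4 l + 1 in their denominators, whose common multiple
  would be far too large. They cancel: seen from the pole -k - 1/4, the zero of R at -(k - l) is the
  factor epsilon - (l + 1/4), again to the power r. Each of the r deleted zeros costs one d, and the
  coefficient of order r - 1 costs r - 1 more, whence 2 r - 1.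

  The factor t^s protects the leading 2-adic term from the s derivatives, as its s-th divided
  derivative is 1. At the same time r - s = 2 keeps R of order t^(-2) at infinity.\<close>

definition psi :: "nat \<Rightarrow> real" where
  "psi n = (\<Sum>k=1..n. mangoldt k)"

lemma psi_nonneg: "psi n \<ge> 0"
  unfolding psi_def by (intro sum_nonneg mangoldt_nonneg)

text \<open>Passing from n to n + 1 raises \<open>n div k\<close> by one exactly for the divisors k
  of n + 1, and the Mangoldt weights of these add up to ln (n + 1).\<close>

lemma ln_fact_eq_sum_mangoldt:
  "ln (fact n) = (\<Sum>k=1..n. mangoldt k * real (n div k))"
proof (induction n)
  case 0
  show ?case by simp
next
  case (Suc n)
  have step: "Suc n div k = n div k + (if k dvd Suc n then 1 else 0)" for k
    by (auto simp: div_Suc dvd_eq_mod_eq_0)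
  have "(\<Sum>k=1..Suc n. mangoldt k * real (Suc n div k)) =
      (\<Sum>k=1..Suc n. mangoldt k * real (n div k)) + (\<Sum>k=1..Suc n. if k dvd Suc n then mangoldt k else 0)"
    unfolding sum.distrib[symmetric] by (intro sum.cong refl) (simp add: step algebra_simps)
  also have "(\<Sum>k=1..Suc n. mangoldt k * real (n div k)) = ln (fact n)"
    unfolding Suc by (simp add: sum.atLeast_Suc_atMost)
  also have "(\<Sum>k=1..Suc n. if k dvd Suc n then mangoldt k else 0) = (\<Sum>k | k dvd Suc n. mangoldt k :: real)"
    by (subst sum.inter_filter[symmetric])
       (auto intro!: sum.cong dest: dvd_imp_le simp: Suc_le_eq intro: Nat.gr0I)
  also have "\<dots> = ln (real (Suc n))"
    by (subst mangoldt_sum) auto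
  finally show ?case by (simp add: ln_mult)
qed

text \<open>A list of pairs \<open>(d, c)\<close> encodes \<open>\<Sum> c \<lfloor>m/d\<rfloor>\<close>, respectively the step function
  with jump \<open>c\<close> at \<open>d\<close>.\<close>

definition floor_comb :: "(nat \<times> int) list \<Rightarrow> nat \<Rightarrow> int" where
  "floor_comb vs m = (\<Sum>(d, c)\<leftarrow>vs. c * int (m div d))"

definition step_comb :: "(nat \<times> int) list \<Rightarrow> nat \<Rightarrow> int" where
  "step_comb vs m = (\<Sum>(d, c)\<leftarrow>vs. if d \<le> m then c else 0)"

abbreviation log_fact_comb :: "(nat \<times> int) list \<Rightarrow> nat \<Rightarrow> real" where
  "log_fact_comb vs x \<equiv> (\<Sum>(d, c)\<leftarrow>vs. real_of_int c * ln (fact (x div d)))"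

abbreviation psi_comb :: "(nat \<times> int) list \<Rightarrow> nat \<Rightarrow> real" where
  "psi_comb js x \<equiv> (\<Sum>(d, c)\<leftarrow>js. real_of_int c * psi (x div d))"

text \<open>Nested floors commute, \<open>x div d div k = x div k div d\<close>, so all factorials
  turn into sums over the same k of a function of \<open>x div k\<close>.\<close>

lemma sum_mangoldt_floor_comb:
  "log_fact_comb vs x =
   (\<Sum>k=1..x. mangoldt k * real_of_int (floor_comb vs (x div k)))"
proof (induction vs)
  case (Cons v vs)
  obtain d c where v: "v = (d, c)" by fastforce
  have "ln (fact (x div d)) = (\<Sum>k=1..x. mangoldt k * real (x div d div k))"
    unfolding ln_fact_eq_sum_mangoldt by (intro sum.mono_neutral_left) auto
  also have "\<dots> = (\<Sum>k=1..x. mangoldt k * real (x div k div d))"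
    by (simp add: div_mult2_eq[symmetric] mult.commute)
  finally have "real_of_int c * ln (fact (x div d)) =
      (\<Sum>k=1..x. mangoldt k * (real_of_int c * real (x div k div d)))"
    by (simp add: sum_distrib_left mult_ac)
  with Cons show ?case
    by (simp add: v floor_comb_def sum.distrib distrib_left)
qed (simp add: floor_comb_def)

lemma sum_mangoldt_step_comb:
  assumes "0 \<notin> fst ` set vs"
  shows "psi_comb vs x =
   (\<Sum>k=1..x. mangoldt k * real_of_int (step_comb vs (x div k)))"
  using assms
proof (induction vs)
  case (Cons v vs)
  obtain d c where v: "v = (d, c)" by fastforce
  have d: "d > 0" using Cons.prems v by auto
  have le: "k \<le> x" if "k * d \<le> x" for k
    using that d by (cases d) auto
  have "psi (x div d) = (\<Sum>k=1..x. if d \<le> x div k then mangoldt k else 0)"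
    unfolding psi_def
    by (subst sum.inter_filter[symmetric])
       (use d le in \<open>auto intro!: sum.cong simp: less_eq_div_iff_mult_less_eq mult.commute\<close>)
  hence "real_of_int c * psi (x div d) =
      (\<Sum>k=1..x. mangoldt k * real_of_int (if d \<le> x div k then c else 0))"
    by (simp add: sum_distrib_left if_distrib mult_ac cong: if_cong)
  with Cons show ?case
    by (simp add: v step_comb_def sum.distrib distrib_left)
qed (simp add: step_comb_def)

text \<open>Both sides are sums over k with the same nonnegative Mangoldt weights, so they can be
  compared at each \<open>m = x div k\<close>; k \<le> x makes these m at least 1.\<close>

lemma chebyshev_inequality:
  assumes "0 \<notin> fst ` set js"
    and "\<And>m. m \<ge> 1 \<Longrightarrow> step_comb js m \<le> floor_comb vs m"
  shows "psi_comb js x \<le> log_fact_comb vs x"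
proof -
  have "psi_comb js x =
      (\<Sum>k=1..x. mangoldt k * real_of_int (step_comb js (x div k)))"
    using assms(1) by (rule sum_mangoldt_step_comb)
  also have "\<dots> \<le> (\<Sum>k=1..x. mangoldt k * real_of_int (floor_comb vs (x div k)))"
    by (intro sum_mono mult_left_mono mangoldt_nonneg)
       (auto intro!: assms(2) simp: div_greater_zero_iff Suc_le_eq)
  also have "\<dots> = log_fact_comb vs x"
    by (rule sum_mangoldt_floor_comb[symmetric])
  finally show ?thesis .
qed

section \<open>Stirling-type asymptotics\<close>

lemma real_div_bounds:
  "real x / real d - 1 \<le> real (x div d)" "real (x div d) \<le> real x / real d"
proof -
  have "real (x div d) = of_int \<lfloor>real x / real d\<rfloor>"
    by (simp add: floor_divide_of_nat_eq)
  thus "real x / real d - 1 \<le> real (x div d)" "real (x div d) \<le> real x / real d"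
    by linarith+
qed

text \<open>Weak Stirling bounds with n + 1 inside the logarithm, which keeps n = 0 regular. The
  induction steps reduce to \<open>1 / (x + 1) \<le> ln (1 + 1 / x) \<le> 1 / x\<close> at x = n +
  1.\<close>

lemma ln_fact_bounds:
  "ln (fact n) \<le> (real n + 1) * ln (real n + 1) - real n"
  "ln (fact n) \<ge> real n * ln (real n + 1) - real n"
proof -
  have up: "ln (1 + 1 / x) \<le> 1 / x" if "x > 0" for x :: real
    using that by (intro ln_add_one_self_le_self) auto
  have lo: "1 / (x + 1) \<le> ln (1 + 1 / x)" if "x > 0" for x :: real
  proof -
    have "ln (x / (x + 1)) \<le> x / (x + 1) - 1" using that by (intro ln_le_minus_one) auto
    also have "\<dots> = - (1 / (x + 1))" using that by (simp add: field_simps)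
    finally have "1 / (x + 1) \<le> - ln (x / (x + 1))" by simp
    also have "\<dots> = ln (1 + 1 / x)" using that by (simp add: ln_div add_divide_distrib[symmetric] field_simps)
    finally show ?thesis .
  qed
  have "ln (fact n) \<le> (real n + 1) * ln (real n + 1) - real n \<and> ln (fact n) \<ge> real n * ln (real n + 1) - real n"
  proof (induction n)
    case (Suc n)
    have l: "ln (real n + 2) = ln (real n + 1) + ln (1 + 1 / (real n + 1))"
    proof -
      have "real n + 2 = (real n + 1) * (1 + 1 / (real n + 1))" by (simp add: distrib_left)
      hence "ln (real n + 2) = ln ((real n + 1) * (1 + 1 / (real n + 1)))" by simp
      also have "\<dots> = ln (real n + 1) + ln (1 + 1 / (real n + 1))" by (intro ln_mult_pos) (auto simp: add_pos_nonneg)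
      finally show ?thesis .
    qed
    have f: "ln (fact (Suc n)) = ln (real n + 1) + ln (fact n)"
      by (simp add: ln_mult add.commute)
    have "1 \<le> (real n + 2) * ln (1 + 1 / (real n + 1))"
      using lo[of "real n + 1"] by (simp add: field_simps)
    moreover have "(real n + 1) * ln (1 + 1 / (real n + 1)) \<le> 1"
      using up[of "real n + 1"] by (simp add: field_simps)
    moreover have "ln (real (Suc n) + 1) = ln (real n + 1) + ln (1 + 1 / (real n + 1))"
      using l by (simp add: add.commute)
    ultimately show ?case using Suc unfolding f by (simp add: algebra_simps)
  qed simp
  thus "ln (fact n) \<le> (real n + 1) * ln (real n + 1) - real n"
    "ln (fact n) \<ge> real n * ln (real n + 1) - real n" by auto
qed

text \<open>The quotient itself grows like ln x / d; removing this term leaves the constant that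
  survives in balanced combinations.\<close>

lemma ln_fact_div_asymptotics:
  assumes d: "d > 0"
  shows "(\<lambda>x. ln (fact (x div d)) / real x - ln (real x) / real d) \<longlonglongrightarrow> - (1 + ln (real d)) / real d"
proof (rule tendsto_sandwich)
  define D where "D = real d"
  have D: "D > 0" using d by (simp add: D_def)
  \<comment> \<open>Replacing \<open>x div d\<close> by its bounds \<open>x / D - 1\<close> and
    \<open>x / D\<close> leaves elementary functions of a real variable with a common limit.\<close>
  define lo hi :: "real \<Rightarrow> real"
    where "lo = (\<lambda>x. ((x / D - 1) * (ln x - ln D) - x / D) / x - ln x / D)"
      and "hi = (\<lambda>x. ((x / D + 1) * (ln (x + D) - ln D) - x / D + 1) / x - ln x / D)"
  have lim: "- (inverse D * ln D) - inverse D = - (1 + ln (real d)) / real d"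
    unfolding D_def[symmetric] using D by (simp add: field_simps)
  have "(\<lambda>n. lo (real n)) \<longlonglongrightarrow> - (inverse D * ln D) - inverse D"
    unfolding lo_def using D by real_asymp
  thus "(\<lambda>n. lo (real n)) \<longlonglongrightarrow> - (1 + ln (real d)) / real d"
    using lim by simp
  have "(\<lambda>n. hi (real n)) \<longlonglongrightarrow> - (inverse D * ln D) - inverse D"
    unfolding hi_def using D by real_asymp
  thus "(\<lambda>n. hi (real n)) \<longlonglongrightarrow> - (1 + ln (real d)) / real d"
    using lim by simp
  have bds: "real x / D - 1 \<le> real (x div d)" "real (x div d) \<le> real x / D" for x
    unfolding D_def by (rule real_div_bounds)+
  show "\<forall>\<^sub>F x in sequentially. lo (real x) \<le> ln (fact (x div d)) / real x - ln (real x) / real d"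
    using eventually_ge_at_top[of "d"]
  proof eventually_elim
    case (elim x)
    have x: "real x > 0" "real x / D \<ge> 1" using elim d by (auto simp: D_def)
    have "ln (real x / D) \<le> ln (real (x div d) + 1)"
      using bds[of x] x D by (intro ln_mono) auto
    hence "ln (real x) - ln D \<le> ln (real (x div d) + 1)"
      using x D by (simp add: ln_div)
    moreover have "0 \<le> ln (real x) - ln D"
      using x D by (simp flip: ln_div)
    ultimately have "(real x / D - 1) * (ln (real x) - ln D) - real x / D \<le> real (x div d) * ln (real (x div d) + 1) - real (x div d)"
      using bds[of x] x D
      by (intro diff_mono mult_mono) auto
    also have "\<dots> \<le> ln (fact (x div d))" by (rule ln_fact_bounds)
    finally show ?case unfolding lo_def D_def[symmetric] using x
      by (intro diff_right_mono divide_right_mono) auto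
  qed
  show "\<forall>\<^sub>F x in sequentially. ln (fact (x div d)) / real x - ln (real x) / real d \<le> hi (real x)"
    using eventually_ge_at_top[of "d"]
  proof eventually_elim
    case (elim x)
    have x: "real x > 0" "real x / D \<ge> 1" using elim d by (auto simp: D_def)
    have "ln (real (x div d) + 1) \<le> ln (real x / D + 1)"
      using bds[of x] by (intro ln_mono) auto
    also have "real x / D + 1 = (real x + D) / D" using D by (simp add: field_simps)
    also have "ln \<dots> = ln (real x + D) - ln D" using x D by (subst ln_div) auto
    finally have l: "ln (real (x div d) + 1) \<le> ln (real x + D) - ln D" .
    have "ln (fact (x div d)) \<le> (real (x div d) + 1) * ln (real (x div d) + 1) - real (x div d)"
      by (rule ln_fact_bounds)
    also have "\<dots> \<le> (real x / D + 1) * (ln (real x + D) - ln D) - (real x / D - 1)"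
      using bds[of x] x D l by (intro diff_mono mult_mono) auto
    finally show ?case unfolding hi_def D_def[symmetric] using x
      by (intro diff_right_mono divide_right_mono) auto
  qed
qed

lemma sum_ln_fact_asymptotics:
  assumes "0 \<notin> fst ` set vs"
  shows "(\<lambda>x. log_fact_comb vs x / real x - ln (real x) * (\<Sum>(d, c)\<leftarrow>vs. real_of_int c / real d))
    \<longlonglongrightarrow> - (\<Sum>(d, c)\<leftarrow>vs. real_of_int c * (1 + ln (real d)) / real d)"
  using assms
proof (induction vs)
  case (Cons v vs)
  obtain d c where v: "v = (d, c)" by fastforce
  have "d > 0" using Cons.prems v by auto
  from tendsto_mult_left[OF ln_fact_div_asymptotics[OF this], of "real_of_int c"]
  have "(\<lambda>x. real_of_int c * (ln (fact (x div d)) / real x - ln (real x) / real d)) \<longlonglongrightarrow>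
      real_of_int c * (- (1 + ln (real d)) / real d)" .
  from tendsto_add[OF this Cons.IH] Cons.prems show ?case
    by (simp add: v algebra_simps add_divide_distrib diff_divide_distrib)
qed simp

text \<open>Chebyshev's simplest choice: \<open>m - 2 * (m div 2)\<close> is 1 at m = 1 and
  nonnegative later, so psi x - psi (x div 2) is O(x), and repeated halving sums a geometric series.
  The bound ensures that the set of eventual upper slopes in \<open>chebyshev_limits\<close> is
  nonempty.\<close>

lemma psi_linear_bound: "\<exists>B. \<forall>x. psi x \<le> B * real x"
proof -
  define vs :: "(nat \<times> int) list" where "vs = [(1, 1), (2, -2)]"
  define js :: "(nat \<times> int) list" where "js = [(1, 1), (2, -1)]"
  define L where "L = log_fact_comb vs"
  have "(\<lambda>x. L x / real x) \<longlonglongrightarrow> - (\<Sum>(d, c)\<leftarrow>vs. real_of_int c * (1 + ln (real d)) / real d)"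
    using sum_ln_fact_asymptotics[of vs] unfolding L_def by (simp add: vs_def)
  hence "Bseq (\<lambda>x. L x / real x)" by (intro convergent_imp_Bseq convergentI)
  then obtain B where B: "B > 0" "\<And>x. \<bar>L x / real x\<bar> \<le> B" unfolding Bseq_def by auto
  have L: "L x \<le> B * real x" for x
  proof (cases "x = 0")
    case False
    thus ?thesis using B(2)[of x] by (simp add: abs_le_iff divide_le_eq)
  qed (simp add: L_def vs_def)
  have step: "psi x - psi (x div 2) \<le> B * real x" for x
  proof -
    have "psi_comb js x \<le> L x"
      unfolding L_def
    proof (rule chebyshev_inequality)
      show "step_comb js m \<le> floor_comb vs m" if "m \<ge> 1" for m
        using that by (auto simp: step_comb_def floor_comb_def js_def vs_def; presburger)
    qed (auto simp: js_def)
    thus ?thesis using L[of x] by (simp add: js_def)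
  qed
  have "psi x \<le> 2 * B * real x" for x
  proof (induction x rule: less_induct)
    case (less x)
    show ?case
    proof (cases "x = 0")
      case False
      hence "psi (x div 2) \<le> 2 * B * real (x div 2)" by (intro less) auto
      also have "\<dots> \<le> B * real x" using B(1) real_div_bounds(2)[of x 2]
        by (simp add: field_simps)
      finally show ?thesis using step[of x] by simp
    qed (simp add: psi_def)
  qed
  thus ?thesis by blast
qed

section \<open>From inequalities for floor sums to asymptotic bounds for psi\<close>

text \<open>The least slope of \<open>psi_comb js\<close> compatible with b x \<le> psi x \<le> a x:
  positive jumps are estimated by b, negative ones by a.\<close>

definition step_bound :: "real \<Rightarrow> real \<Rightarrow> (nat \<times> int) list \<Rightarrow> real" where
  "step_bound a b js = (\<Sum>(d, c)\<leftarrow>js. real_of_int c * (if c \<ge> 0 then b else a) / real d)"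

text \<open>Rounding x / d down costs at most c b for a positive coefficient, which half of
  \<epsilon> x absorbs for large x; for a negative one it helps. Each entry of the list uses up half
  of the remaining \<epsilon>.\<close>

lemma psi_div_bounds:
  assumes "\<forall>\<^sub>F x in sequentially. psi x \<le> a * real x"
    and "\<forall>\<^sub>F x in sequentially. psi x \<ge> b * real x"
    and "a \<ge> 0" "b \<ge> 0" "\<epsilon> > 0"
    and "0 \<notin> fst ` set js"
  shows "\<forall>\<^sub>F x in sequentially. psi_comb js x \<ge> (step_bound a b js - \<epsilon>) * real x"
  using assms(5,6)
proof (induction js arbitrary: \<epsilon>)
  case (Cons v js)
  obtain d c where v: "v = (d, c)" by fastforce
  have d: "d > 0" using Cons.prems v by auto
  have fl: "filterlim (\<lambda>x. x div d) at_top sequentially"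
    using d by (rule filterlim_at_top_div_const_nat)
  have "\<forall>\<^sub>F x in sequentially. real x \<ge> 2 * \<bar>real_of_int c\<bar> * b / \<epsilon>"
    using filterlim_real_sequentially by (simp add: filterlim_at_top)
  moreover have "\<forall>\<^sub>F x in sequentially. psi_comb js x \<ge> (step_bound a b js - \<epsilon> / 2) * real x"
    using Cons.prems by (intro Cons.IH) auto
  moreover have "\<forall>\<^sub>F x in sequentially. psi (x div d) \<le> a * real (x div d)"
    using assms(1) fl by (rule eventually_compose_filterlim)
  moreover have "\<forall>\<^sub>F x in sequentially. psi (x div d) \<ge> b * real (x div d)"
    using assms(2) fl by (rule eventually_compose_filterlim)
  ultimately show ?case
  proof eventually_elim
    case (elim x)
    have bds: "real x / real d - 1 \<le> real (x div d)" "real (x div d) \<le> real x / real d"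
      by (rule real_div_bounds)+
    have "real_of_int c * psi (x div d) \<ge> (real_of_int c * (if c \<ge> 0 then b else a) / real d - \<epsilon> / 2) * real x"
    proof (cases "c \<ge> 0")
      case True
      have "b * (real x / real d - 1) \<le> psi (x div d)"
        using elim(4) mult_left_mono[OF bds(1) \<open>b \<ge> 0\<close>] by linarith
      hence "real_of_int c * (b * (real x / real d - 1)) \<le> real_of_int c * psi (x div d)"
        using True by (intro mult_left_mono) auto
      moreover have "real_of_int c * b \<le> \<epsilon> / 2 * real x"
        using elim(1) True \<open>\<epsilon> > 0\<close> by (simp add: field_simps)
      ultimately show ?thesis using True by (simp add: algebra_simps)
    next
      case False
      have "psi (x div d) \<le> a * (real x / real d)"
        using elim(3) mult_left_mono[OF bds(2) \<open>a \<ge> 0\<close>] by linarith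
      hence "real_of_int c * (a * (real x / real d)) \<le> real_of_int c * psi (x div d)"
        using False by (intro mult_left_mono_neg) auto
      moreover have "\<epsilon> / 2 * real x \<ge> 0" using \<open>\<epsilon> > 0\<close> by simp
      ultimately show ?thesis using False by (simp add: algebra_simps)
    qed
    with elim(2) show ?case
      by (simp add: v step_bound_def algebra_simps)
  qed
qed (simp add: step_bound_def)

text \<open>The balance condition \<open>bal\<close> removes the terms in ln x and also the
  contribution of the 1 in 1 + ln d, so the factorial side is asymptotically linear with an explicit
  slope.\<close>

lemma chebyshev_asymptotics:
  assumes "\<forall>\<^sub>F x in sequentially. psi x \<le> a * real x"
    and "\<forall>\<^sub>F x in sequentially. psi x \<ge> b * real x"
    and "a \<ge> 0" "b \<ge> 0" "\<epsilon> > 0"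
    and js: "0 \<notin> fst ` set js"
    and vs: "0 \<notin> fst ` set vs"
    and bal: "(\<Sum>(d, c)\<leftarrow>vs. real_of_int c / real d) = 0"
    and le: "\<And>m. m \<ge> 1 \<Longrightarrow> step_comb ((1, e) # js) m \<le> floor_comb vs m"
  shows "\<forall>\<^sub>F x in sequentially. real_of_int e * psi x \<le>
    (- (\<Sum>(d, c)\<leftarrow>vs. real_of_int c * ln (real d) / real d) - step_bound a b js + \<epsilon>) * real x"
proof -
  define A where "A = (\<Sum>(d, c)\<leftarrow>vs. real_of_int c * ln (real d) / real d)"
  have "(\<Sum>(d, c)\<leftarrow>vs. real_of_int c * (1 + ln (real d)) / real d) = A + (\<Sum>(d, c)\<leftarrow>vs. real_of_int c / real d)"
    unfolding A_def by (induction vs) (auto simp: algebra_simps add_divide_distrib)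
  hence "(\<lambda>x. log_fact_comb vs x / real x) \<longlonglongrightarrow> - A"
    using sum_ln_fact_asymptotics[OF vs] bal by simp
  hence "\<forall>\<^sub>F x in sequentially. log_fact_comb vs x / real x < - A + \<epsilon> / 2"
    using \<open>\<epsilon> > 0\<close> by (intro order_tendstoD) auto
  moreover have "\<forall>\<^sub>F x in sequentially. psi_comb js x \<ge> (step_bound a b js - \<epsilon> / 2) * real x"
    using assms by (intro psi_div_bounds) auto
  moreover have "\<forall>\<^sub>F x in sequentially. x > (0::nat)" by (rule eventually_gt_at_top)
  ultimately show ?thesis
  proof eventually_elim
    case (elim x)
    have "psi_comb ((1, e) # js) x \<le> log_fact_comb vs x"
      by (rule chebyshev_inequality) (use js le in auto)
    also have "\<dots> \<le> (- A + \<epsilon> / 2) * real x"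
      using elim(1,3) by (simp add: field_simps)
    finally show ?case using elim(2) unfolding A_def[symmetric] by (simp add: algebra_simps)
  qed
qed

section \<open>Verification of the two step functions\<close>

text \<open>Balance makes \<open>floor_comb\<close> periodic with period N, while
  \<open>step_comb\<close> has made all its jumps by N. So every residue is compared twice: with the
  current value of the step function, for m < N, and with its final value, for all later m of the
  class.\<close>

lemma step_comb_le_floor_comb_periodic:
  fixes N :: nat
  assumes N: "N > 0" "\<And>d c. (d, c) \<in> set vs \<Longrightarrow> d dvd N"
    and bal: "(\<Sum>(d, c)\<leftarrow>vs. c * int (N div d)) = 0"
    and js: "\<And>d c. (d, c) \<in> set js \<Longrightarrow> d \<le> N"
    and chk: "\<And>m. m < N \<Longrightarrow> (m = 0 \<or> step_comb js m \<le> floor_comb vs m) \<and> (\<Sum>(d, c)\<leftarrow>js. c) \<le> floor_comb vs m"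
    and m: "m \<ge> 1"
  shows "step_comb js m \<le> floor_comb vs m"
proof (cases "m < N")
  case False
  have "floor_comb vs (q * N + r) = int q * (\<Sum>(d, c)\<leftarrow>vs. c * int (N div d)) + floor_comb vs r" for q r
    using N(2)
  proof (induction vs)
    case (Cons v vs)
    obtain d c where v: "v = (d, c)" by fastforce
    obtain e where e: "N = d * e" using Cons.prems v by fastforce
    with N(1) have "d > 0" by (cases d) auto
    hence "(q * N + r) div d = q * (N div d) + r div d" by (simp add: e mult.left_commute)
    moreover have "floor_comb vs (q * N + r) = int q * (\<Sum>(d, c)\<leftarrow>vs. c * int (N div d)) + floor_comb vs r"
      using Cons.prems by (intro Cons.IH) auto
    ultimately show ?case by (simp add: v floor_comb_def algebra_simps)
  qed (simp add: floor_comb_def)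
  from this[of "m div N" "m mod N"] bal have "floor_comb vs m = floor_comb vs (m mod N)" by simp
  moreover have "step_comb js m = (\<Sum>(d, c)\<leftarrow>js. c)"
    unfolding step_comb_def using False js by (intro arg_cong[of _ _ sum_list] map_cong) force+
  ultimately show ?thesis using chk[of "m mod N"] N(1) by simp
qed (use chk m in auto)

text \<open>The weights on the divisors of 2310 come from a linear programming search; the first entry of
  \<open>upper_js_int\<close> and \<open>lower_js_int\<close> is the term \<open>\<plusminus> \<psi>(x)\<close> to be bounded, the others form a step function below
  \<open>floor_comb\<close>.\<close>

definition upper_js_int :: "(int \<times> int) list" where
  "upper_js_int = [(1, 1), (13, 1), (15, -1), (17, 1), (19, 1), (21, -1), (22, -1), (23, 1), (35, -1), (37, 1), (45, -1), (47, 1), (66, -1), (71, 1), (77, -1), (79, 1), (88, -1), (107, 1), (126, -1), (191, 1), (210, -2), (221, 1), (420, -1), (431, 1), (630, -1), (641, 1), (726, -1), (727, 1), (840, -1), (851, 1), (935, -1)]"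

definition upper_vs_int :: "(int \<times> int) list" where
  "upper_vs_int = [(1, 1), (2, -1), (3, -1), (5, -1), (6, 1), (7, -1), (10, 1), (11, -1), (14, 1), (30, -1), (42, -1), (70, -1), (2310, 1)]"

definition upper_vs :: "(nat \<times> int) list" where
  "upper_vs = map (map_prod nat id) upper_vs_int"

definition upper_js :: "(nat \<times> int) list" where
  "upper_js = map (map_prod nat id) (tl upper_js_int)"

definition lower_js_int :: "(int \<times> int) list" where
  "lower_js_int = [(1, -1), (13, -1), (14, 1), (17, -1), (19, -1), (33, 1), (41, -1), (53, -1), (83, -1), (84, 1), (110, 1), (120, 1), (131, -1), (139, -1), (140, 1), (175, 1), (193, -1), (210, 1), (229, -1), (263, -1), (293, -1), (294, 1), (315, 1), (350, 1), (383, -1), (403, -1), (504, 1), (613, -1), (825, 1), (923, -1), (1000, -1)]"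

definition lower_vs_int :: "(int \<times> int) list" where
  "lower_vs_int = [(1, -1), (2, 1), (3, 1), (5, 1), (6, -1), (7, 1), (10, -1), (11, 1), (15, -1), (21, -1), (30, 2), (42, 1), (55, -1), (70, 1), (105, 2), (110, 1), (165, 2), (210, -2), (330, -1), (2310, -1)]"

definition lower_vs :: "(nat \<times> int) list" where
  "lower_vs = map (map_prod nat id) lower_vs_int"

definition lower_js :: "(nat \<times> int) list" where
  "lower_js = map (map_prod nat id) (tl lower_js_int)"

text \<open>By periodicity of \<open>floor_comb\<close> it suffices to check one period. This is done over the integers, where evaluation
  by rewriting is fast.\<close>

definition table_row :: "int \<Rightarrow> int \<Rightarrow> int \<Rightarrow> int \<Rightarrow> bool" where
  "table_row t i s f \<longleftrightarrow> t \<le> f \<and> (i = 0 \<or> s \<le> f)"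

definition table_check :: "(int \<times> int) list \<Rightarrow> (int \<times> int) list \<Rightarrow> int \<Rightarrow> int list \<Rightarrow> bool" where
  "table_check js vs t is = list_all (\<lambda>i. table_row t i (\<Sum>(d, c)\<leftarrow>js. if d \<le> i then c else 0) (\<Sum>(d, c)\<leftarrow>vs. c * (i div d))) is"

lemma table_checkD:
  assumes "table_check js vs t [a..b]" "a \<le> i" "i \<le> b"
  shows "table_row t i (\<Sum>(d, c)\<leftarrow>js. if d \<le> i then c else 0) (\<Sum>(d, c)\<leftarrow>vs. c * (i div d))"
  using assms unfolding table_check_def list_all_iff by auto

lemma step_comb_le_floor_comb_table:
  assumes chk: "\<And>i. 0 \<le> i \<Longrightarrow> i < int N \<Longrightarrow> table_row (\<Sum>(d, c)\<leftarrow>js. c) i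
      (\<Sum>(d, c)\<leftarrow>map (map_prod int id) js. if d \<le> i then c else 0) (\<Sum>(d, c)\<leftarrow>map (map_prod int id) vs. c * (i div d))"
    and N: "N > 0" "\<And>d c. (d, c) \<in> set vs \<Longrightarrow> d dvd N"
    and bal: "(\<Sum>(d, c)\<leftarrow>vs. c * int (N div d)) = 0"
    and js: "\<And>d c. (d, c) \<in> set js \<Longrightarrow> d \<le> N"
    and m: "m \<ge> 1"
  shows "step_comb js m \<le> floor_comb vs m"
proof (rule step_comb_le_floor_comb_periodic[OF N bal js _ m])
  fix m assume "m < N"
  hence "table_row (\<Sum>(d, c)\<leftarrow>js. c) (int m)
      (\<Sum>(d, c)\<leftarrow>map (map_prod int id) js. if d \<le> int m then c else 0) (\<Sum>(d, c)\<leftarrow>map (map_prod int id) vs. c * (int m div d))"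
    by (intro chk) auto
  moreover have "(\<Sum>(d, c)\<leftarrow>map (map_prod int id) js. if d \<le> int m then c else 0) = step_comb js m"
    by (induction js) (auto simp: step_comb_def)
  moreover have "(\<Sum>(d, c)\<leftarrow>map (map_prod int id) vs. c * (int m div d)) = floor_comb vs m"
    by (induction vs) (auto simp: floor_comb_def zdiv_int)
  ultimately show "(m = 0 \<or> step_comb js m \<le> floor_comb vs m) \<and> (\<Sum>(d, c)\<leftarrow>js. c) \<le> floor_comb vs m"
    by (auto simp: table_row_def)
qed

text \<open>The third argument is the sum of all jumps, 0 for the upper and -5 for the lower list:
  the value which the step function keeps after its last jump. The period is 2310 = 2 * 3 * 5 * 7 *
  11.\<close>

lemma upper_table_a: "table_check upper_js_int upper_vs_int (0) [0..599]"
  by code_simp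

lemma upper_table_b: "table_check upper_js_int upper_vs_int (0) [600..1199]"
  by code_simp

lemma upper_table_c: "table_check upper_js_int upper_vs_int (0) [1200..1799]"
  by code_simp

lemma upper_table_d: "table_check upper_js_int upper_vs_int (0) [1800..2309]"
  by code_simp

lemma upper_check:
  assumes "m \<ge> 1"
  shows "step_comb ((1, 1) # upper_js) m \<le> floor_comb upper_vs m"
proof (rule step_comb_le_floor_comb_table[where N = 2310])
  fix i :: int assume i: "0 \<le> i" "i < int 2310"
  consider "i \<le> 599" | "600 \<le> i" "i \<le> 1199" | "1200 \<le> i" "i \<le> 1799" | "1800 \<le> i" "i \<le> 2309"
    using i by linarith
  thus "table_row (\<Sum>(d, c)\<leftarrow>(1, 1) # upper_js. c) i
      (\<Sum>(d, c)\<leftarrow>map (map_prod int id) ((1, 1) # upper_js). if d \<le> i then c else 0)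
      (\<Sum>(d, c)\<leftarrow>map (map_prod int id) upper_vs. c * (i div d))"
    using table_checkD[OF upper_table_a i(1)] table_checkD[OF upper_table_b, of i]
      table_checkD[OF upper_table_c, of i] table_checkD[OF upper_table_d, of i]
    by cases (simp_all add: upper_js_def upper_js_int_def upper_vs_def upper_vs_int_def)
qed (use assms in \<open>auto simp: upper_js_def upper_js_int_def upper_vs_def upper_vs_int_def\<close>)

lemma lower_table_a: "table_check lower_js_int lower_vs_int (-5) [0..599]"
  by code_simp

lemma lower_table_b: "table_check lower_js_int lower_vs_int (-5) [600..1199]"
  by code_simp

lemma lower_table_c: "table_check lower_js_int lower_vs_int (-5) [1200..1799]"
  by code_simp

lemma lower_table_d: "table_check lower_js_int lower_vs_int (-5) [1800..2309]"
  by code_simp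

lemma lower_check:
  assumes "m \<ge> 1"
  shows "step_comb ((1, -1) # lower_js) m \<le> floor_comb lower_vs m"
proof (rule step_comb_le_floor_comb_table[where N = 2310])
  fix i :: int assume i: "0 \<le> i" "i < int 2310"
  consider "i \<le> 599" | "600 \<le> i" "i \<le> 1199" | "1200 \<le> i" "i \<le> 1799" | "1800 \<le> i" "i \<le> 2309"
    using i by linarith
  thus "table_row (\<Sum>(d, c)\<leftarrow>(1, -1) # lower_js. c) i
      (\<Sum>(d, c)\<leftarrow>map (map_prod int id) ((1, -1) # lower_js). if d \<le> i then c else 0)
      (\<Sum>(d, c)\<leftarrow>map (map_prod int id) lower_vs. c * (i div d))"
    using table_checkD[OF lower_table_a i(1)] table_checkD[OF lower_table_b, of i]
      table_checkD[OF lower_table_c, of i] table_checkD[OF lower_table_d, of i]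
    by cases (simp_all add: lower_js_def lower_js_int_def lower_vs_def lower_vs_int_def)
qed (use assms in \<open>auto simp: lower_js_def lower_js_int_def lower_vs_def lower_vs_int_def\<close>)

section \<open>Coupled inequalities for the limits of psi x / x\<close>

definition jump_up :: "(nat \<times> int) list \<Rightarrow> real" where
  "jump_up js = (\<Sum>(d, c)\<leftarrow>js. if c \<ge> 0 then real_of_int c / real d else 0)"

definition jump_down :: "(nat \<times> int) list \<Rightarrow> real" where
  "jump_down js = (\<Sum>(d, c)\<leftarrow>js. if c \<ge> 0 then 0 else - real_of_int c / real d)"

text \<open>Linearity in a and b turns the two estimates into linear inequalities between the
  limits, and bounds the effect of perturbing them.\<close>

lemma step_bound_eq: "step_bound a b js = b * jump_up js - a * jump_down js"
  unfolding step_bound_def jump_up_def jump_down_def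
  by (induction js) (auto simp: algebra_simps)

lemma jump_up_nonneg: "jump_up js \<ge> 0" and jump_down_nonneg: "jump_down js \<ge> 0"
  unfolding jump_up_def jump_down_def
  by (auto intro!: sum_list_nonneg divide_nonpos_nonneg)

abbreviation chebyshev_bound :: "(nat \<times> int) list \<Rightarrow> (nat \<times> int) list \<Rightarrow> real \<Rightarrow> real \<Rightarrow> real" where
  "chebyshev_bound vs js \<alpha> \<beta> \<equiv>
    - (\<Sum>(d, c)\<leftarrow>vs. real_of_int c * ln (real d) / real d) - \<beta> * jump_up js + \<alpha> * jump_down js"

text \<open>\<open>\<alpha>\<close> and \<open>\<beta>\<close> are the upper and lower limits of \<open>\<psi>(x) / x\<close>; in both inequalities the
  terms \<open>\<psi>(x/d)\<close> are bounded by means of \<open>\<beta>\<close> or \<open>\<alpha>\<close> according to the sign of their coefficient, which couples the two.\<close>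

lemma chebyshev_limits:
  obtains \<alpha> \<beta> where
    "\<And>\<epsilon>. \<epsilon> > 0 \<Longrightarrow> \<forall>\<^sub>F x in sequentially. psi x \<le> (\<alpha> + \<epsilon>) * real x"
    "\<alpha> \<le> chebyshev_bound upper_vs upper_js \<alpha> \<beta>"
    "- \<beta> \<le> chebyshev_bound lower_vs lower_js \<alpha> \<beta>"
proof -
  define SA where "SA = {a. \<forall>\<^sub>F x in sequentially. psi x \<le> a * real x}"
  define SB where "SB = {b. \<forall>\<^sub>F x in sequentially. b * real x \<le> psi x}"
  have ab: "b \<le> a" if "a \<in> SA" "b \<in> SB" for a b
  proof -
    have "\<forall>\<^sub>F x in sequentially. b * real x \<le> a * real x \<and> 0 < real x"
      using that eventually_gt_at_top[of 0] unfolding SA_def SB_def mem_Collect_eq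
      by eventually_elim (use order.trans in \<open>fastforce simp del: mult_le_cancel_right\<close>)
    then obtain x where "b * real x \<le> a * real x" "0 < real x"
      by (auto dest: eventually_happens)
    thus ?thesis by (simp add: mult_le_cancel_right)
  qed
  obtain B where "\<forall>x. psi x \<le> B * real x"
    using psi_linear_bound by blast
  hence B: "B \<in> SA" by (simp add: SA_def)
  have zero: "0 \<in> SB" by (auto simp: SB_def psi_nonneg)
  define \<alpha> where "\<alpha> = Inf SA"
  define \<beta> where "\<beta> = Sup SB"
  have bdd: "bdd_below SA" "bdd_above SB"
    using ab[OF _ zero] ab[OF B] by (auto simp: bdd_below_def bdd_above_def)
  have \<alpha>: "\<alpha> \<ge> 0" unfolding \<alpha>_def using ab[OF _ zero] B by (intro cInf_greatest) auto
  have \<beta>: "\<beta> \<ge> 0" unfolding \<beta>_def using zero bdd by (intro cSup_upper)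
  have SA_up: "a' \<in> SA" if "a \<in> SA" "a \<le> a'" for a a'
    using that(1) unfolding SA_def mem_Collect_eq
    by (rule eventually_mono) (meson mult_right_mono of_nat_0_le_iff order.trans that(2))
  have SB_down: "b' \<in> SB" if "b \<in> SB" "b' \<le> b" for b b'
    using that(1) unfolding SB_def mem_Collect_eq
    by (rule eventually_mono) (meson mult_right_mono of_nat_0_le_iff order.trans that(2))
  have up: "\<alpha> + \<epsilon> \<in> SA" if "\<epsilon> > 0" for \<epsilon>
  proof -
    have "\<exists>a\<in>SA. a < \<alpha> + \<epsilon>"
      using B that unfolding \<alpha>_def by (intro cInf_lessD) auto
    then obtain a where "a \<in> SA" "a < \<alpha> + \<epsilon>" by blast
    thus ?thesis using SA_up by simp
  qed
  \<comment> \<open>The maximum keeps the lower slope nonnegative, as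
    \<open>chebyshev_asymptotics\<close> demands.\<close>
  have lo: "max 0 (\<beta> - \<epsilon>) \<in> SB" if "\<epsilon> > 0" for \<epsilon>
  proof -
    have "\<exists>b\<in>SB. \<beta> - \<epsilon> < b"
      using zero that unfolding \<beta>_def by (intro less_cSupD) auto
    then obtain b where "b \<in> SB" "\<beta> - \<epsilon> < b" by blast
    hence "\<beta> - \<epsilon> \<in> SB" using SB_down by simp
    thus ?thesis using zero by (simp add: max_def)
  qed
  have key: "\<forall>\<^sub>F x in sequentially. real_of_int e * psi x \<le>
      (chebyshev_bound vs js \<alpha> \<beta> + \<epsilon>) * real x"
    if \<epsilon>: "\<epsilon> > 0" and js: "0 \<notin> fst ` set js" and vs: "0 \<notin> fst ` set vs" and
       bal: "(\<Sum>(d, c)\<leftarrow>vs. real_of_int c / real d) = 0" and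
       le: "\<And>m. m \<ge> 1 \<Longrightarrow> step_comb ((1, e) # js) m \<le> floor_comb vs m" for e js vs \<epsilon>
  proof -
    \<comment> \<open>The errors \<delta> in the two slopes and in the estimate enter with total
      weight \<open>1 + jump_up js + jump_down js\<close>, so that together they amount to
      \<epsilon>.\<close>
    define \<delta> where "\<delta> = \<epsilon> / (1 + jump_up js + jump_down js)"
    have \<delta>: "\<delta> > 0" using \<epsilon> jump_up_nonneg[of js] jump_down_nonneg[of js] by (auto simp: \<delta>_def)
    have ev: "\<forall>\<^sub>F x in sequentially. real_of_int e * psi x \<le>
        (- (\<Sum>(d, c)\<leftarrow>vs. real_of_int c * ln (real d) / real d) - step_bound (\<alpha> + \<delta>) (max 0 (\<beta> - \<delta>)) js + \<delta>) * real x"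
      using up[OF \<delta>] lo[OF \<delta>] \<alpha> \<delta>
      by (intro chebyshev_asymptotics js vs bal le) (auto simp: SA_def SB_def)
    have "- step_bound (\<alpha> + \<delta>) (max 0 (\<beta> - \<delta>)) js + \<delta> \<le> - \<beta> * jump_up js + \<alpha> * jump_down js + \<epsilon>"
    proof -
      have "(\<beta> - \<delta>) * jump_up js \<le> max 0 (\<beta> - \<delta>) * jump_up js"
        by (intro mult_right_mono jump_up_nonneg) auto
      moreover have "\<delta> * (1 + jump_up js + jump_down js) = \<epsilon>"
        using jump_up_nonneg[of js] jump_down_nonneg[of js] by (simp add: \<delta>_def)
      ultimately show ?thesis unfolding step_bound_eq by (simp add: algebra_simps)
    qed
    hence mono: "(- S - step_bound (\<alpha> + \<delta>) (max 0 (\<beta> - \<delta>)) js + \<delta>) * real x \<le>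
        (- S - \<beta> * jump_up js + \<alpha> * jump_down js + \<epsilon>) * real x" for x S
      by (intro mult_right_mono) auto
    show ?thesis
      by (rule eventually_mono[OF ev]) (rule order.trans[OF _ mono])
  qed
  show ?thesis
  proof
    show "\<forall>\<^sub>F x in sequentially. psi x \<le> (\<alpha> + \<epsilon>) * real x" if "\<epsilon> > 0" for \<epsilon>
      using up[OF that] by (simp add: SA_def)
    show "\<alpha> \<le> chebyshev_bound upper_vs upper_js \<alpha> \<beta>"
    proof (rule field_le_epsilon)
      fix \<epsilon> :: real assume "\<epsilon> > 0"
      define T where "T = chebyshev_bound upper_vs upper_js \<alpha> \<beta> + \<epsilon>"
      have "\<forall>\<^sub>F x in sequentially. real_of_int 1 * psi x \<le> T * real x"
        unfolding T_def using \<open>\<epsilon> > 0\<close> upper_check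
        by (intro key) (auto simp: upper_js_def upper_js_int_def upper_vs_def upper_vs_int_def)
      hence "T \<in> SA" by (simp add: SA_def)
      hence "\<alpha> \<le> T" unfolding \<alpha>_def using bdd by (intro cInf_lower)
      thus "\<alpha> \<le> chebyshev_bound upper_vs upper_js \<alpha> \<beta> + \<epsilon>"
        unfolding T_def .
    qed
    show "- \<beta> \<le> chebyshev_bound lower_vs lower_js \<alpha> \<beta>"
    proof (rule field_le_epsilon)
      fix \<epsilon> :: real assume "\<epsilon> > 0"
      define T where "T = chebyshev_bound lower_vs lower_js \<alpha> \<beta> + \<epsilon>"
      have "\<forall>\<^sub>F x in sequentially. real_of_int (- 1) * psi x \<le> T * real x"
        unfolding T_def using \<open>\<epsilon> > 0\<close> lower_check
        by (intro key) (auto simp: lower_js_def lower_js_int_def lower_vs_def lower_vs_int_def)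
      hence "- T \<in> SB" by (auto simp: SB_def elim: eventually_mono)
      hence "- T \<le> \<beta>" unfolding \<beta>_def using bdd by (intro cSup_upper)
      thus "- \<beta> \<le> chebyshev_bound lower_vs lower_js \<alpha> \<beta> + \<epsilon>"
        unfolding T_def by simp
    qed
  qed
qed

text \<open>A comparison of integer powers certifies a rational bound for log p / log 2; with ln 2
  as unit the final estimate becomes linear arithmetic.\<close>

lemma ln_le_mult_ln2:
  fixes p :: nat
  assumes "p ^ k \<le> 2 ^ m" "k > 0" "p > 0"
  shows "ln (real p) \<le> real m / real k * ln 2"
proof -
  have "real p ^ k \<le> 2 ^ m" using assms(1) by (metis of_nat_le_iff of_nat_numeral of_nat_power)
  hence "ln (real p ^ k) \<le> ln (2 ^ m)" using assms by (intro ln_mono) auto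
  thus ?thesis using assms by (simp add: ln_realpow field_simps)
qed

lemma mult_ln2_le_ln:
  fixes p :: nat
  assumes "2 ^ m \<le> p ^ k" "k > 0" "p > 0"
  shows "real m / real k * ln 2 \<le> ln (real p)"
proof -
  have "2 ^ m \<le> real p ^ k" using assms(1) by (metis of_nat_le_iff of_nat_numeral of_nat_power)
  hence "ln (2 ^ m) \<le> ln (real p ^ k)" using assms by (intro ln_mono) auto
  thus ?thesis using assms by (simp add: ln_realpow field_simps)
qed

theorem psi_upper_bound: "\<forall>\<^sub>F x in sequentially. psi x \<le> 3 / 2 * ln 2 * real x"
proof -
  obtain \<alpha> \<beta> where 1: "\<And>\<epsilon>. \<epsilon> > 0 \<Longrightarrow> \<forall>\<^sub>F x in sequentially. psi x \<le> (\<alpha> + \<epsilon>) * real x"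
    and 2: "\<alpha> \<le> chebyshev_bound upper_vs upper_js \<alpha> \<beta>"
    and 3: "- \<beta> \<le> chebyshev_bound lower_vs lower_js \<alpha> \<beta>"
    by (rule chebyshev_limits) (rule that; assumption)
  \<comment> \<open>The fractions approximate the logarithms of 3, 5, 7 and 11 to base 2 from below
    and above.\<close>
  have l3: "569 / 359 * ln 2 \<le> ln (3::real)" "ln (3::real) \<le> 485 / 306 * ln 2"
    using mult_ln2_le_ln[of 569 3 359] ln_le_mult_ln2[of 3 306 485] by simp_all
  have l5: "339 / 146 * ln 2 \<le> ln (5::real)" "ln (5::real) \<le> 815 / 351 * ln 2"
    using mult_ln2_le_ln[of 339 5 146] ln_le_mult_ln2[of 5 351 815] by simp_all
  have l7: "306 / 109 * ln 2 \<le> ln (7::real)" "ln (7::real) \<le> 991 / 353 * ln 2"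
    using mult_ln2_le_ln[of 306 7 109] ln_le_mult_ln2[of 7 353 991] by simp_all
  have l11: "1363 / 394 * ln 2 \<le> ln (11::real)" "ln (11::real) \<le> 128 / 37 * ln 2"
    using mult_ln2_le_ln[of 1363 11 394] ln_le_mult_ln2[of 11 37 128] by simp_all
  have m: "ln (6::real) = ln 2 + ln 3" "ln (10::real) = ln 2 + ln 5" "ln (14::real) = ln 2 + ln 7"
    "ln (15::real) = ln 3 + ln 5" "ln (21::real) = ln 3 + ln 7" "ln (55::real) = ln 5 + ln 11"
    using ln_mult[of "2::real" 3] ln_mult[of "2::real" 5] ln_mult[of "2::real" 7]
      ln_mult[of "3::real" 5] ln_mult[of "3::real" 7] ln_mult[of "5::real" 11] by simp_all
  have m2: "ln (30::real) = ln 2 + ln 3 + ln 5" "ln (42::real) = ln 2 + ln 3 + ln 7" "ln (70::real) = ln 2 + ln 5 + ln 7"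
    "ln (105::real) = ln 3 + ln 5 + ln 7" "ln (110::real) = ln 2 + ln 5 + ln 11" "ln (165::real) = ln 3 + ln 5 + ln 11"
    using ln_mult[of "6::real" 5] ln_mult[of "6::real" 7] ln_mult[of "10::real" 7] ln_mult[of "15::real" 7]
      ln_mult[of "10::real" 11] ln_mult[of "15::real" 11] by (simp_all add: m)
  have m3: "ln (210::real) = ln 2 + ln 3 + ln 5 + ln 7" "ln (330::real) = ln 2 + ln 3 + ln 5 + ln 11"
    "ln (2310::real) = ln 2 + ln 3 + ln 5 + ln 7 + ln 11"
    using ln_mult[of "30::real" 7] ln_mult[of "30::real" 11] ln_mult[of "42::real" 55] by (simp_all add: m m2)
  have ln2: "ln (2::real) > 0" by simp
  define U where "U = - (\<Sum>(d, c)\<leftarrow>upper_vs. real_of_int c * ln (real d) / real d)"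
  define L where "L = (\<Sum>(d, c)\<leftarrow>lower_vs. real_of_int c * ln (real d) / real d)"
  have U: "U \<le> 38699 / 25000 * ln 2"
  proof -
    have "U = 269 / 1155 * ln 2 + 86 / 385 * ln 3 + 34 / 231 * ln 5 + 6 / 55 * ln 7 + 19 / 210 * ln 11"
      by (simp add: U_def upper_vs_def upper_vs_int_def m m2 m3 field_simps)
    thus ?thesis using l3 l5 l7 l11 by linarith
  qed
  have L: "158873 / 100000 * ln 2 \<le> L"
  proof -
    have "L = 386 / 1155 * ln 2 + 62 / 385 * ln 3 + 19 / 154 * ln 5 + 47 / 330 * ln 7 + 19 / 210 * ln 11"
      by (simp add: L_def lower_vs_def lower_vs_int_def m m2 m3 field_simps)
    thus ?thesis using l3 l5 l7 l11 by linarith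
  qed
  have up: "jump_up upper_js = 1285460636807216259705589 / 3866745494269200996610183"
      "jump_down upper_js = 142603 / 518364"
    by (simp_all add: jump_up_def jump_down_def upper_js_def upper_js_int_def)
  have lo: "jump_up lower_js = 78251 / 485100"
      "jump_down lower_js = 6894619719740157493886961633050173 / 24269746520746472895228113454173000"
    by (simp_all add: jump_up_def jump_down_def lower_js_def lower_js_int_def)
  \<comment> \<open>Eliminating \<beta> between the two inequalities gives about \<alpha> \<le>
    1.4997 ln 2. Neither suffices alone: the upper one with \<beta> = 0 yields a constant above 2.
    Strictness pays for the \<epsilon> in the next line.\<close>
  have "\<alpha> < 3 / 2 * ln 2"
    using 2 3 U L ln2 unfolding U_def[symmetric] L_def[symmetric] up lo by linarith
  from 1[of "3 / 2 * ln 2 - \<alpha>"] this show ?thesis by simp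
qed

subsection \<open>The 2-adic absolute value\<close>

lemma abs2_rat_power: "abs2_rat (x ^ n) = abs2_rat x ^ n"
  by (induction n) (simp_all add: abs2_rat_mult)

lemma abs2_rat_divide: "abs2_rat (x / y) = abs2_rat x / abs2_rat y"
  by (simp add: divide_inverse abs2_rat_mult abs2_rat_inverse)

lemma abs2_rat_prod: "abs2_rat (prod f A) = (\<Prod>i\<in>A. abs2_rat (f i))"
  by (induction A rule: infinite_finite_induct) (simp_all add: abs2_rat_mult)

lemma abs2_rat_two [simp]: "abs2_rat 2 = 1 / 2"
  using abs2_two abs2_of_rat[of 2] by simp

lemma abs2_rat_power2 [simp]: "abs2_rat (2 ^ n) = 1 / 2 ^ n"
  by (simp add: abs2_rat_power power_divide)

lemma abs2_rat_four [simp]: "abs2_rat 4 = 1 / 4"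
  using abs2_rat_power2[of 2] by simp

lemma abs2_rat_of_int: "abs2_rat (of_int k) = (if k = 0 then 0 else 1 / 2 ^ multiplicity 2 k)"
proof -
  have "val2_rat (of_int k) = int (multiplicity 2 k)" if "k \<noteq> 0"
    using val2_rat_Fract[of k 1] that by (simp add: Fract_of_int_quotient)
  thus ?thesis by (simp add: abs2_rat_def power_int_minus divide_inverse)
qed

lemma abs2_rat_of_int_le_1: "abs2_rat (of_int k) \<le> 1"
  by (simp add: abs2_rat_of_int)

lemma abs2_rat_of_nat_le_1: "abs2_rat (of_nat k) \<le> 1"
  using abs2_rat_of_int_le_1[of "int k"] by simp

lemma abs2_rat_of_int_odd: "odd k \<Longrightarrow> abs2_rat (of_int k) = 1"
  by (auto simp: abs2_rat_of_int not_dvd_imp_multiplicity_0)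

lemma abs2_rat_of_nat_odd: "odd k \<Longrightarrow> abs2_rat (of_nat k) = 1"
  using abs2_rat_of_int_odd[of "int k"] by simp

lemma abs2_rat_add_le: "abs2_rat x \<le> c \<Longrightarrow> abs2_rat y \<le> c \<Longrightarrow> abs2_rat (x + y) \<le> c"
  using abs2_rat_ultra[of x y] by simp

lemma abs2_rat_diff_le: "abs2_rat x \<le> c \<Longrightarrow> abs2_rat y \<le> c \<Longrightarrow> abs2_rat (x - y) \<le> c"
  using abs2_rat_add_le[of x c "- y"] by simp

lemma abs2_rat_sum_le:
  "c \<ge> 0 \<Longrightarrow> (\<And>i. i \<in> A \<Longrightarrow> abs2_rat (f i) \<le> c) \<Longrightarrow> abs2_rat (sum f A) \<le> c"
  by (induction A rule: infinite_finite_induct) (auto intro!: abs2_rat_add_le)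

lemma abs2_rat_mult_le:
  "abs2_rat x \<le> c \<Longrightarrow> abs2_rat y \<le> d \<Longrightarrow> abs2_rat (x * y) \<le> c * d"
  unfolding abs2_rat_mult by (intro mult_mono) (auto intro: order.trans[OF abs2_rat_nonneg])

text \<open>The strong triangle inequality applied to x = (x + y) - y: a strictly dominant term
  determines the size. Nonvanishing of the linear form rests on this.\<close>

lemma abs2_rat_add_eq:
  assumes "abs2_rat y < abs2_rat x"
  shows "abs2_rat (x + y) = abs2_rat x"
  using abs2_rat_ultra[of x y] abs2_rat_ultra[of "x + y" "- y"] assms by simp

subsection \<open>Riemann sums of the Volkenborn integral\<close>

definition vol2 :: "(nat \<Rightarrow> rat) \<Rightarrow> nat \<Rightarrow> rat" where
  "vol2 g N = (\<Sum>k<2 ^ N. g k) / 2 ^ N"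

lemma sum_lessThan_power2_Suc:
  fixes g :: "nat \<Rightarrow> 'a :: comm_ring_1"
  shows "(\<Sum>k<2 ^ Suc N. g k) = 2 * (\<Sum>k<2 ^ N. g k) + (\<Sum>k<2 ^ N. g (k + 2 ^ N) - g k)"
proof -
  have "(\<Sum>k<2 ^ Suc N. g k) = (\<Sum>k<2 ^ N. g k) + (\<Sum>k=2 ^ N..<2 ^ N + 2 ^ N. g k)"
    by (simp add: mult_2 atLeast0LessThan[symmetric] sum.atLeastLessThan_concat)
  also have "(\<Sum>k=2 ^ N..<2 ^ N + 2 ^ N. g k) = (\<Sum>k<2 ^ N. g (k + 2 ^ N))"
    using sum.shift_bounds_nat_ivl[of g 0 "2 ^ N" "2 ^ N"] by (simp add: atLeast0LessThan)
  finally show ?thesis by (simp add: sum_subtractf)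
qed

text \<open>Only increments by powers of 2 are compared: the sum over 2^(N+1) integers arises from
  that over 2^N integers by a shift by 2^N.\<close>

definition lipschitz2 :: "(nat \<Rightarrow> rat) \<Rightarrow> bool" where
  "lipschitz2 g \<longleftrightarrow> (\<forall>k. abs2_rat (g k) \<le> 1) \<and> (\<forall>k N. abs2_rat (g (k + 2 ^ N) - g k) \<le> 1 / 2 ^ N)"

text \<open>Doubling the range gives twice the old sum plus a sum of increments of size at most
  2^-N; the factor 2 in front halves the old bound, so the constant 2 reproduces itself. Hence the
  mean \<open>vol2\<close> enlarges by at most 2, which later congruences modulo 4 can
  afford.\<close>

lemma abs2_sum_lipschitz2:
  assumes "lipschitz2 g"
  shows "abs2_rat (\<Sum>k<2 ^ N. g k) \<le> 2 / 2 ^ N"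
proof (induction N)
  case 0
  show ?case using assms by (auto simp: lipschitz2_def lessThan_Suc intro: order.trans)
next
  case (Suc N)
  have "abs2_rat (2 * (\<Sum>k<2 ^ N. g k)) \<le> 1 / 2 * (2 / 2 ^ N)"
    using Suc by (intro abs2_rat_mult_le) auto
  moreover have "abs2_rat (\<Sum>k<2 ^ N. g (k + 2 ^ N) - g k) \<le> 1 / 2 ^ N"
    using assms by (intro abs2_rat_sum_le) (auto simp: lipschitz2_def)
  ultimately show ?case unfolding sum_lessThan_power2_Suc
    by (intro abs2_rat_add_le) auto
qed

lemma abs2_vol2_le: "lipschitz2 g \<Longrightarrow> abs2_rat (vol2 g N) \<le> 2"
  using abs2_sum_lipschitz2[of g N] by (simp add: vol2_def abs2_rat_divide field_simps)

text \<open>A uniform quadratic Taylor error: 4^-N divided by 2^N still tends to 0, and the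
  Lipschitz derivative controls the sum of the first-order terms. Both are needed for the Riemann
  sums to be Cauchy.\<close>

definition differentiable2 :: "(nat \<Rightarrow> rat) \<Rightarrow> (nat \<Rightarrow> rat) \<Rightarrow> bool" where
  "differentiable2 g g' \<longleftrightarrow> (\<forall>k. abs2_rat (g k) \<le> 1) \<and> lipschitz2 g' \<and>
     (\<forall>k N. abs2_rat (g (k + 2 ^ N) - g k - 2 ^ N * g' k) \<le> 1 / 4 ^ N)"

lemma differentiable2_diff_le:
  assumes "differentiable2 g g'"
  shows "abs2_rat (g (k + 2 ^ N) - g k) \<le> 1 / 2 ^ N"
proof -
  have "abs2_rat (g (k + 2 ^ N) - g k - 2 ^ N * g' k) \<le> 1 / 2 ^ N"
    using assms by (rule_tac order.trans[of _ "1 / 4 ^ N"])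
      (auto simp: differentiable2_def intro!: divide_left_mono power_mono)
  moreover have "abs2_rat (2 ^ N * g' k) \<le> 1 / 2 ^ N * 1"
    using assms by (intro abs2_rat_mult_le) (auto simp: differentiable2_def lipschitz2_def)
  ultimately show ?thesis
    using abs2_rat_add_le[of "g (k + 2 ^ N) - g k - 2 ^ N * g' k" _ "2 ^ N * g' k"] by simp
qed

lemma differentiable2_imp_lipschitz2: "differentiable2 g g' \<Longrightarrow> lipschitz2 g"
  unfolding lipschitz2_def using differentiable2_diff_le by (auto simp: differentiable2_def)

lemma lipschitz2_add: "lipschitz2 f \<Longrightarrow> lipschitz2 g \<Longrightarrow> lipschitz2 (\<lambda>k. f k + g k)"
  unfolding lipschitz2_def
  by (auto intro!: abs2_rat_add_le simp: add_diff_add)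

lemma lipschitz2_mult:
  assumes "lipschitz2 f" "lipschitz2 g"
  shows "lipschitz2 (\<lambda>k. f k * g k)"
  unfolding lipschitz2_def
proof (intro conjI allI)
  show "abs2_rat (f k * g k) \<le> 1" for k
    using abs2_rat_mult_le[of "f k" 1 "g k" 1] assms by (auto simp: lipschitz2_def)
  show "abs2_rat (f (k + 2 ^ N) * g (k + 2 ^ N) - f k * g k) \<le> 1 / 2 ^ N" for k N
  proof -
    have "f (k + 2 ^ N) * g (k + 2 ^ N) - f k * g k =
        (f (k + 2 ^ N) - f k) * g (k + 2 ^ N) + f k * (g (k + 2 ^ N) - g k)"
      by (simp add: algebra_simps)
    moreover have "abs2_rat ((f (k + 2 ^ N) - f k) * g (k + 2 ^ N)) \<le> 1 / 2 ^ N * 1"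
      using assms by (intro abs2_rat_mult_le) (auto simp: lipschitz2_def)
    moreover have "abs2_rat (f k * (g (k + 2 ^ N) - g k)) \<le> 1 * (1 / 2 ^ N)"
      using assms by (intro abs2_rat_mult_le) (auto simp: lipschitz2_def)
    ultimately show ?thesis using abs2_rat_add_le by simp
  qed
qed

lemma lipschitz2_const: "abs2_rat c \<le> 1 \<Longrightarrow> lipschitz2 (\<lambda>_. c)"
  by (simp add: lipschitz2_def)

lemma differentiable2_mult:
  assumes f: "differentiable2 f f'" and g: "differentiable2 g g'"
  shows "differentiable2 (\<lambda>k. f k * g k) (\<lambda>k. f' k * g k + f k * g' k)"
  unfolding differentiable2_def
proof (intro conjI allI)
  show "abs2_rat (f k * g k) \<le> 1" for k
    using abs2_rat_mult_le[of "f k" 1 "g k" 1] assms by (auto simp: differentiable2_def)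
  show "lipschitz2 (\<lambda>k. f' k * g k + f k * g' k)"
    using f g by (intro lipschitz2_add lipschitz2_mult)
      (auto simp: differentiable2_def intro: differentiable2_imp_lipschitz2)
  show "abs2_rat (f (k + 2 ^ N) * g (k + 2 ^ N) - f k * g k - 2 ^ N * (f' k * g k + f k * g' k)) \<le> 1 / 4 ^ N" for k N
  proof -
    have eq: "f (k + 2 ^ N) * g (k + 2 ^ N) - f k * g k - 2 ^ N * (f' k * g k + f k * g' k) =
        (f (k + 2 ^ N) - f k) * (g (k + 2 ^ N) - g k) +
        (g k * (f (k + 2 ^ N) - f k - 2 ^ N * f' k) + f k * (g (k + 2 ^ N) - g k - 2 ^ N * g' k))"
      by (simp add: algebra_simps)
    have "abs2_rat ((f (k + 2 ^ N) - f k) * (g (k + 2 ^ N) - g k)) \<le> 1 / 2 ^ N * (1 / 2 ^ N)"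
      by (intro abs2_rat_mult_le differentiable2_diff_le[OF f] differentiable2_diff_le[OF g])
    also have "\<dots> = 1 / 4 ^ N" by (simp flip: power_mult_distrib)
    finally have 1: "abs2_rat ((f (k + 2 ^ N) - f k) * (g (k + 2 ^ N) - g k)) \<le> 1 / 4 ^ N" .
    have 2: "abs2_rat (g k * (f (k + 2 ^ N) - f k - 2 ^ N * f' k)) \<le> 1 * (1 / 4 ^ N)"
      using f g by (intro abs2_rat_mult_le) (auto simp: differentiable2_def)
    have 3: "abs2_rat (f k * (g (k + 2 ^ N) - g k - 2 ^ N * g' k)) \<le> 1 * (1 / 4 ^ N)"
      using f g by (intro abs2_rat_mult_le) (auto simp: differentiable2_def)
    show ?thesis unfolding eq using 1 2 3 by (intro abs2_rat_add_le) auto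
  qed
qed

lemma differentiable2_shift:
  "differentiable2 g g' \<Longrightarrow> differentiable2 (\<lambda>k. g (k + l)) (\<lambda>k. g' (k + l))"
proof -
  assume *: "differentiable2 g g'"
  have "k + 2 ^ N + l = k + l + 2 ^ N" for k N by simp
  with * show ?thesis unfolding differentiable2_def lipschitz2_def by metis
qed

text \<open>The first-order parts of the increments add up to 2^N times a sum of \<open>g'\<close>,
  which has size at most 2 / 2^N. The total is at most 2 / 4^N, and division by 2^(N+1) leaves 4 /
  2^N.\<close>

lemma abs2_vol2_Suc_diff:
  assumes "differentiable2 g g'"
  shows "abs2_rat (vol2 g (Suc N) - vol2 g N) \<le> 4 / 2 ^ N"
proof -
  have "(\<Sum>k<2 ^ N. g (k + 2 ^ N) - g k) =
      (\<Sum>k<2 ^ N. g (k + 2 ^ N) - g k - 2 ^ N * g' k) + 2 ^ N * (\<Sum>k<2 ^ N. g' k)"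
    unfolding sum_distrib_left sum.distrib[symmetric] by simp
  moreover have "abs2_rat (\<Sum>k<2 ^ N. g (k + 2 ^ N) - g k - 2 ^ N * g' k) \<le> 1 / 4 ^ N"
    using assms by (intro abs2_rat_sum_le) (auto simp: differentiable2_def)
  hence "abs2_rat (\<Sum>k<2 ^ N. g (k + 2 ^ N) - g k - 2 ^ N * g' k) \<le> 2 / 4 ^ N"
    by (rule order.trans) (simp add: divide_right_mono)
  moreover have "abs2_rat (2 ^ N * (\<Sum>k<2 ^ N. g' k)) \<le> 1 / 2 ^ N * (2 / 2 ^ N)"
    using assms by (intro abs2_rat_mult_le abs2_sum_lipschitz2) (auto simp: differentiable2_def)
  hence "abs2_rat (2 ^ N * (\<Sum>k<2 ^ N. g' k)) \<le> 2 / 4 ^ N" by (simp flip: power_mult_distrib)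
  ultimately have "abs2_rat (\<Sum>k<2 ^ N. g (k + 2 ^ N) - g k) \<le> 2 / 4 ^ N"
    by (simp only: abs2_rat_add_le)
  hence "abs2_rat ((\<Sum>k<2 ^ N. g (k + 2 ^ N) - g k) / 2 ^ Suc N) \<le> 2 / 4 ^ N / (1 / 2 ^ Suc N)"
    unfolding abs2_rat_divide abs2_rat_power2 by (intro divide_right_mono) auto
  also have "2 / 4 ^ N / (1 / 2 ^ Suc N) = (4 / 2 ^ N :: real)"
  proof -
    have "(4::real) ^ N = 2 ^ N * 2 ^ N" by (simp flip: power_mult_distrib)
    thus ?thesis by simp
  qed
  also have "(\<Sum>k<2 ^ N. g (k + 2 ^ N) - g k) / 2 ^ Suc N = vol2 g (Suc N) - vol2 g N"
    unfolding vol2_def sum_lessThan_power2_Suc by (simp add: field_simps)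
  finally show ?thesis .
qed

lemma cauchy2_vol2:
  assumes "differentiable2 g g'"
  shows "cauchy2 (vol2 g)"
  unfolding cauchy2_def
proof (intro allI impI)
  fix e :: real assume e: "e > 0"
  have tail: "abs2_rat (vol2 g (N + m) - vol2 g N) \<le> 4 / 2 ^ N" for N m
  proof (induction m)
    case (Suc m)
    have "abs2_rat (vol2 g (Suc (N + m)) - vol2 g (N + m)) \<le> 4 / 2 ^ (N + m)"
      by (rule abs2_vol2_Suc_diff[OF assms])
    also have "\<dots> \<le> 4 / 2 ^ N" by (intro divide_left_mono power_increasing) auto
    finally show ?case
      using Suc abs2_rat_add_le[of "vol2 g (Suc (N + m)) - vol2 g (N + m)" _ "vol2 g (N + m) - vol2 g N"] by simp
  qed simp
  have "(\<lambda>N. 4 / 2 ^ N :: real) \<longlonglongrightarrow> 0" by real_asymp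
  hence "eventually (\<lambda>N. 4 / 2 ^ N < e) sequentially" using e by (intro order_tendstoD)
  then obtain K where K: "4 / 2 ^ K < e" by (auto simp: eventually_sequentially)
  have "abs2_rat (vol2 g m - vol2 g n) < e" if "m \<ge> K" "n \<ge> K" for m n
  proof -
    have "abs2_rat (vol2 g m - vol2 g K) \<le> 4 / 2 ^ K" "abs2_rat (vol2 g n - vol2 g K) \<le> 4 / 2 ^ K"
      using tail[of K "m - K"] tail[of K "n - K"] that by auto
    from abs2_rat_diff_le[OF this] K show ?thesis by simp
  qed
  thus "\<exists>k. \<forall>m\<ge>k. \<forall>n\<ge>k. abs2_rat (vol2 g m - vol2 g n) < e" by blast
qed

definition volkenborn2 :: "(nat \<Rightarrow> rat) \<Rightarrow> q2" where
  "volkenborn2 g = lim (\<lambda>N. of_rat (vol2 g N))"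

lemma tendsto_volkenborn2:
  assumes "differentiable2 g g'"
  shows "(\<lambda>N. of_rat (vol2 g N)) \<longlonglongrightarrow> volkenborn2 g"
  using cauchy2_tendsto_q2[OF cauchy2_vol2[OF assms]] unfolding volkenborn2_def
  by (simp add: limI)

lemma q2_tendsto_iff: "(X \<longlonglongrightarrow> (L :: q2)) \<longleftrightarrow> (\<lambda>n. abs2 (X n - L)) \<longlonglongrightarrow> 0"
  by (subst tendsto_dist_iff) (simp add: dist_q2_def)

lemma q2_tendsto_add:
  assumes "X \<longlonglongrightarrow> (L :: q2)" "Y \<longlonglongrightarrow> M"
  shows "(\<lambda>n. X n + Y n) \<longlonglongrightarrow> L + M"
  unfolding q2_tendsto_iff
proof (rule tendsto_sandwich[OF _ _ tendsto_const])
  show "(\<lambda>n. abs2 (X n - L) + abs2 (Y n - M)) \<longlonglongrightarrow> 0"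
    using assms unfolding q2_tendsto_iff by (rule tendsto_add_zero)
  show "\<forall>\<^sub>F n in sequentially. abs2 (X n + Y n - (L + M)) \<le> abs2 (X n - L) + abs2 (Y n - M)"
    by (intro always_eventually allI order.trans[OF _ abs2_triangle]) (simp add: algebra_simps)
  show "\<forall>\<^sub>F n in sequentially. 0 \<le> abs2 (X n + Y n - (L + M))"
    using zero_le_dist[of "_ :: q2" "_ :: q2"] unfolding dist_q2_def by (intro always_eventually allI) simp
qed

lemma q2_tendsto_mult_left:
  assumes "X \<longlonglongrightarrow> (L :: q2)"
  shows "(\<lambda>n. c * X n) \<longlonglongrightarrow> c * L"
proof -
  have "(\<lambda>n. abs2 c * abs2 (X n - L)) \<longlonglongrightarrow> 0"
    using assms unfolding q2_tendsto_iff by (rule tendsto_mult_right_zero)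
  thus ?thesis unfolding q2_tendsto_iff by (simp flip: abs2_mult add: algebra_simps)
qed

lemma q2_tendsto_sum:
  assumes "\<And>i. i \<in> A \<Longrightarrow> X i \<longlonglongrightarrow> (L i :: q2)"
  shows "(\<lambda>n. \<Sum>i\<in>A. X i n) \<longlonglongrightarrow> (\<Sum>i\<in>A. L i)"
  using assms by (induction A rule: infinite_finite_induct) (auto intro: q2_tendsto_add)

text \<open>The shift replaces g 0 by g (2^N) in the Riemann sum, and this difference divided by 2^N
  tends to the derivative at 0.\<close>

lemma volkenborn2_shift_Suc:
  assumes "differentiable2 g g'"
  shows "volkenborn2 (\<lambda>k. g (Suc k)) = volkenborn2 g + of_rat (g' 0)"
proof -
  have "vol2 (\<lambda>k. g (Suc k)) N = vol2 g N + (g (2 ^ N) - g 0) / 2 ^ N" for N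
    using sum.lessThan_Suc_shift[of g "2 ^ N"] sum.lessThan_Suc[of g "2 ^ N"]
    unfolding vol2_def by (simp add: field_simps)
  hence 1: "of_rat (vol2 (\<lambda>k. g (Suc k)) N) = of_rat (vol2 g N) + (of_rat ((g (2 ^ N) - g 0) / 2 ^ N) :: q2)" for N
    by (simp add: of_rat_add)
  have "(\<lambda>N. abs2_rat ((g (2 ^ N) - g 0) / 2 ^ N - g' 0)) \<longlonglongrightarrow> 0"
  proof (rule tendsto_sandwich[OF _ _ tendsto_const])
    show "\<forall>\<^sub>F N in sequentially. abs2_rat ((g (2 ^ N) - g 0) / 2 ^ N - g' 0) \<le> 1 / 2 ^ N"
    proof (intro always_eventually allI)
      fix N
      have "abs2_rat (g (0 + 2 ^ N) - g 0 - 2 ^ N * g' 0) \<le> 1 / 4 ^ N"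
        using assms unfolding differentiable2_def by blast
      from mult_right_mono[OF this, of "2 ^ N"]
      have "abs2_rat ((g (2 ^ N) - g 0 - 2 ^ N * g' 0) / 2 ^ N) \<le> 1 / 4 ^ N * 2 ^ N"
        by (simp add: abs2_rat_divide)
      also have "(1 / 4 ^ N * 2 ^ N :: real) = 1 / 2 ^ N"
        by (simp add: power_divide[symmetric] flip: power_mult_distrib) (simp add: power_divide)
      finally show "abs2_rat ((g (2 ^ N) - g 0) / 2 ^ N - g' 0) \<le> 1 / 2 ^ N"
        by (simp add: diff_divide_distrib)
    qed
    show "(\<lambda>N. 1 / 2 ^ N :: real) \<longlonglongrightarrow> 0" by real_asymp
  qed auto
  hence "(\<lambda>N. of_rat ((g (2 ^ N) - g 0) / 2 ^ N) :: q2) \<longlonglongrightarrow> of_rat (g' 0)"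
    unfolding q2_tendsto_iff by (simp add: abs2_of_rat flip: of_rat_diff)
  from q2_tendsto_add[OF tendsto_volkenborn2[OF assms] this]
  have "(\<lambda>N. of_rat (vol2 (\<lambda>k. g (Suc k)) N)) \<longlonglongrightarrow> volkenborn2 g + of_rat (g' 0)"
    unfolding 1 .
  thus ?thesis unfolding volkenborn2_def by (rule limI)
qed

lemma volkenborn2_shift:
  assumes "differentiable2 g g'"
  shows "volkenborn2 (\<lambda>k. g (k + m)) = volkenborn2 g + of_rat (\<Sum>l<m. g' l)"
proof (induction m)
  case (Suc m)
  have "volkenborn2 (\<lambda>k. g (k + Suc m)) = volkenborn2 (\<lambda>k. g (k + m)) + of_rat (g' m)"
    using volkenborn2_shift_Suc[OF differentiable2_shift[OF assms, of m]] by simp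
  thus ?case using Suc by (simp add: of_rat_add)
qed simp

subsection \<open>The integrals of the powers of \<open>4 t + 1\<close>\<close>

definition inv_pow :: "nat \<Rightarrow> nat \<Rightarrow> rat" where
  "inv_pow q k = 1 / of_nat (4 * k + 1) ^ q"

definition inv_pow_deriv :: "nat \<Rightarrow> nat \<Rightarrow> rat" where
  "inv_pow_deriv q k = - 4 * of_nat q / of_nat (4 * k + 1) ^ (q + 1)"

lemma abs2_rat_4k1: "abs2_rat (of_nat (4 * k + 1)) = 1"
  by (rule abs2_rat_of_nat_odd) auto

lemma differentiable2_inv_1: "differentiable2 (inv_pow 1) (inv_pow_deriv 1)"
proof -
  define u where "u = (\<lambda>k. of_nat (4 * k + 1) :: rat)"
  have au: "abs2_rat (u k) = 1" for k unfolding u_def by (rule abs2_rat_4k1)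
  have nz: "u k \<noteq> 0" for k using au[of k] by auto
  have us: "u (k + 2 ^ N) = u k + 4 * 2 ^ N" for k N by (simp add: u_def)
  have lip: "lipschitz2 (inv_pow 1)"
    unfolding lipschitz2_def
  proof (intro conjI allI)
    have inv: "inv_pow 1 k = 1 / u k" for k by (simp add: inv_pow_def u_def)
    show "abs2_rat (inv_pow 1 k) \<le> 1" for k
      unfolding inv by (simp add: abs2_rat_divide au)
    show "abs2_rat (inv_pow 1 (k + 2 ^ N) - inv_pow 1 k) \<le> 1 / 2 ^ N" for k N
    proof -
      have "1 / u (k + 2 ^ N) - 1 / u k = - (4 * 2 ^ N) / (u k * u (k + 2 ^ N))"
        using nz[of k] nz[of "k + 2 ^ N"] us[of k N] by (simp add: field_simps)
      also have "abs2_rat \<dots> = 1 / 4 * (1 / 2 ^ N)"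
        by (simp add: abs2_rat_divide abs2_rat_mult au)
      finally show ?thesis unfolding inv by (simp add: field_simps)
    qed
  qed
  have d: "inv_pow_deriv 1 = (\<lambda>k. - 4 * (inv_pow 1 k * inv_pow 1 k))"
    by (auto simp: inv_pow_deriv_def inv_pow_def fun_eq_iff power2_eq_square)
  show ?thesis unfolding differentiable2_def
  proof (intro conjI allI)
    show "abs2_rat (inv_pow 1 k) \<le> 1" for k using lip by (auto simp: lipschitz2_def)
    show "lipschitz2 (inv_pow_deriv 1)" unfolding d
      by (intro lipschitz2_mult lipschitz2_const lip) simp
    show "abs2_rat (inv_pow 1 (k + 2 ^ N) - inv_pow 1 k - 2 ^ N * inv_pow_deriv 1 k) \<le> 1 / 4 ^ N" for k N
    proof -
      have "inv_pow 1 (k + 2 ^ N) - inv_pow 1 k - 2 ^ N * inv_pow_deriv 1 k =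
          1 / u (k + 2 ^ N) - 1 / u k + 2 ^ N * 4 / u k ^ 2"
        by (simp add: inv_pow_def inv_pow_deriv_def u_def power2_eq_square)
      \<comment> \<open>With h = 4 * 2^N the Taylor remainder of 1 / u is h^2 / (u^2 (u + h)), whose
        denominator is a unit.\<close>
      also have "\<dots> = (4 * 2 ^ N) ^ 2 / (u k ^ 2 * u (k + 2 ^ N))"
        using nz[of k] nz[of "k + 2 ^ N"] us[of k N]
        by (simp add: divide_simps) (simp add: algebra_simps power2_eq_square)
      also have "abs2_rat \<dots> = (1 / 4 * (1 / 2 ^ N)) ^ 2"
        by (simp only: abs2_rat_divide abs2_rat_mult abs2_rat_power[of _ 2] au abs2_rat_four abs2_rat_power2) simp
      also have "\<dots> = 1 / 16 * (1 / 4 ^ N)"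
      proof -
        have "(4::real) ^ N = 2 ^ N * 2 ^ N" by (simp flip: power_mult_distrib)
        thus ?thesis by (simp add: power2_eq_square)
      qed
      finally show ?thesis by (simp add: field_simps)
    qed
  qed
qed

lemma differentiable2_inv_pow: "differentiable2 (inv_pow q) (inv_pow_deriv q)"
proof (induction q)
  case 0
  show ?case by (simp add: differentiable2_def lipschitz2_def inv_pow_def inv_pow_deriv_def)
next
  case (Suc q)
  have nz: "(of_nat (4 * k + 1) :: rat) \<noteq> 0" for k
    by (subst of_nat_eq_0_iff) simp
  have eq: "- 4 * of_nat (Suc q) / u ^ (Suc q + 1) =
      - 4 * of_nat 1 / u ^ (1 + 1) * (1 / u ^ q) + 1 / u ^ 1 * (- 4 * of_nat q / u ^ (q + 1))"
    if "u \<noteq> 0" for u :: rat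
    using that by (simp add: field_simps)
  have "inv_pow (Suc q) = (\<lambda>k. inv_pow 1 k * inv_pow q k)"
    by (auto simp: inv_pow_def fun_eq_iff)
  moreover have "inv_pow_deriv (Suc q) = (\<lambda>k. inv_pow_deriv 1 k * inv_pow q k + inv_pow 1 k * inv_pow_deriv q k)"
    unfolding inv_pow_def inv_pow_deriv_def by (intro ext eq nz)
  ultimately show ?case using differentiable2_mult[OF differentiable2_inv_1 Suc] by simp
qed

section \<open>The Teichmueller character at k + 1/4\<close>

lemma val2_eqI: "abs2 x = 2 powi (- v) \<Longrightarrow> val2 x = v"
  unfolding val2_def
proof (rule the_equality)
  fix w assume "abs2 x = 2 powi (- v)" "abs2 x = 2 powi (- w)"
  hence "(2::real) powi (- v) = 2 powi (- w)" by simp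
  thus "w = v"
    using power_int_strict_increasing[of "- v" "- w" "2::real"] power_int_strict_increasing[of "- w" "- v" "2::real"]
    by (cases w v rule: linorder_cases) auto
qed

text \<open>The valuation is -2 and the unit part 4 k + 1 is 1 modulo 4, so the character takes the
  value 1/4.\<close>

lemma angle_bracket_quarter: "angle_bracket (of_nat k + 1 / 4) = of_nat (4 * k + 1)"
proof -
  define y :: q2 where "y = of_nat k + 1 / 4"
  have y: "y = of_rat (of_nat (4 * k + 1) / 4)"
    by (simp add: y_def of_rat_divide of_rat_add of_rat_mult add_divide_distrib)
  have "abs2 y = 4" unfolding y abs2_of_rat abs2_rat_divide abs2_rat_4k1 by simp
  hence v: "val2 y = - 2" by (intro val2_eqI) simp
  have sc: "y / 2 powi (- 2) = of_nat (4 * k + 1)"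
    by (simp add: y_def power_int_minus field_simps)
  have "teich_unit (of_nat (4 * k + 1)) = 1"
    unfolding teich_unit_def
  proof (rule the_equality)
    have "abs2 (of_nat k) \<le> 1" using abs2_of_rat[of "of_nat k"] abs2_rat_of_nat_le_1[of k] by simp
    thus "(1::q2) \<in> {1, - 1} \<and> (\<exists>z\<in>z2. of_nat (4 * k + 1) - 1 = 4 * z)"
      by (auto simp: z2_def intro!: bexI[of _ "of_nat k"])
    fix w :: q2 assume w: "w \<in> {1, - 1} \<and> (\<exists>z\<in>z2. of_nat (4 * k + 1) - w = 4 * z)"
    show "w = 1"
    proof (rule ccontr)
      assume "w \<noteq> 1"
      \<comment> \<open>The sign -1 would make (4 k + 2) / 4 a 2-adic integer, but its absolute
        value is 2.\<close>
      with w obtain z where z: "z \<in> z2" "of_nat (4 * k + 1) + 1 = 4 * z" by auto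
      hence "z = (of_nat (4 * k + 1) + 1) / 4" by simp
      also have "\<dots> = of_rat ((of_nat (4 * k + 1) + 1) / 4)"
        by (simp add: of_rat_divide of_rat_add of_rat_mult)
      also have "(of_nat (4 * k + 1) + 1) / 4 = (of_nat (2 * k + 1) / 2 :: rat)"
        by (simp add: field_simps)
      finally have "z = of_rat (of_nat (2 * k + 1) / 2)" .
      hence "abs2 z = 2" using abs2_rat_of_nat_odd[of "2 * k + 1"]
        by (simp only: abs2_of_rat abs2_rat_divide) simp
      with z show False by (simp add: z2_def)
    qed
  qed
  hence "teich y = 2 powi (- 2)" unfolding teich_def v sc by simp
  thus ?thesis unfolding angle_bracket_def y_def[symmetric] using sc by simp
qed

lemma hurwitz_zeta2_quarter:
  assumes "q \<ge> 1"
  shows "hurwitz_zeta2 (int q + 1) (1 / 4) = volkenborn2 (inv_pow q) / of_nat q"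
proof -
  have "(1 / 2 ^ N * (\<Sum>k<2 ^ N. angle_bracket (of_nat k + 1 / 4) powi (1 - (int q + 1))) :: q2) = of_rat (vol2 (inv_pow q) N)" for N
  proof -
    have "(of_nat (4 * k + 1) :: q2) powi (- int q) = of_rat (inv_pow q k)" for k
      by (simp add: inv_pow_def power_int_minus of_rat_inverse of_rat_power of_rat_add of_rat_mult divide_inverse)
    thus ?thesis unfolding angle_bracket_quarter
      by (simp add: vol2_def of_rat_divide of_rat_sum of_rat_power del: of_nat_add of_nat_mult)
  qed
  thus ?thesis unfolding hurwitz_zeta2_def volkenborn_def volkenborn2_def by simp
qed

subsection \<open>Partial fractions\<close>

definition lin :: "rat \<Rightarrow> rat fps" where
  "lin c = fps_const c + fps_X"

lemma lin_nth_0 [simp]: "lin c $ 0 = c"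
  by (simp add: lin_def)

lemma lin_nth: "lin c $ n = (if n = 0 then c else if n = 1 then 1 else 0)"
  by (simp add: lin_def)

lemma lin_mult_inverse: "c \<noteq> 0 \<Longrightarrow> lin c * inverse (lin c) = 1"
  by (simp add: inverse_mult_eq_1')

lemma lin_eq: "c \<noteq> 0 \<Longrightarrow> lin c = fps_const c * (1 + fps_const (1 / c) * fps_X)"
  by (simp add: lin_def algebra_simps)

text \<open>The Taylor expansion of p at t; the variable of the series is the offset from t, so x +
  c becomes \<open>lin (t + c)\<close>.\<close>

definition shift_fps :: "rat \<Rightarrow> rat poly \<Rightarrow> rat fps" where
  "shift_fps t p = fps_of_poly (pcompose p [:t, 1:])"

lemma shift_fps_linear: "shift_fps t [:c, 1:] = lin (t + c)"
  by (simp add: shift_fps_def pcompose_pCons fps_of_poly_linear lin_def add_ac)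

lemma shift_fps_mult: "shift_fps t (p * q) = shift_fps t p * shift_fps t q"
  by (simp add: shift_fps_def pcompose_mult fps_of_poly_mult)

lemma shift_fps_power: "shift_fps t (p ^ n) = shift_fps t p ^ n"
  by (induction n) (simp_all add: shift_fps_mult, simp add: shift_fps_def pcompose_1)

lemma shift_fps_prod: "shift_fps t (prod f A) = (\<Prod>i\<in>A. shift_fps t (f i))"
  by (simp add: shift_fps_def pcompose_prod fps_of_poly_prod)

lemma shift_fps_sum: "shift_fps t (sum f A) = (\<Sum>i\<in>A. shift_fps t (f i))"
  by (simp add: shift_fps_def pcompose_sum fps_of_poly_sum)

lemma shift_fps_diff: "shift_fps t (p - q) = shift_fps t p - shift_fps t q"
  by (simp add: shift_fps_def pcompose_diff fps_of_poly_diff)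

lemma shift_fps_smult: "shift_fps t (smult c p) = fps_const c * shift_fps t p"
  by (simp add: shift_fps_def pcompose_smult fps_of_poly_smult)

lemma pcompose_power: "pcompose (p ^ n) q = pcompose p q ^ n"
  by (induction n) (simp_all add: pcompose_mult pcompose_1)

lemma power_linear_dvd_if_shift_fps:
  assumes "\<And>i. i < r \<Longrightarrow> shift_fps (- c) p $ i = 0"
  shows "[:c, 1:] ^ r dvd p"
proof -
  have "monom 1 r dvd pcompose p [:- c, 1:]"
    using assms by (auto simp: monom_1_dvd_iff' shift_fps_def)
  then obtain q where q: "pcompose p [:- c, 1:] = monom 1 r * q" by (elim dvdE)
  have "p = pcompose (pcompose p [:- c, 1:]) [:c, 1:]"
    by (simp add: pcompose_assoc[symmetric] pcompose_pCons)
  also have "\<dots> = [:c, 1:] ^ r * pcompose q [:c, 1:]"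
    unfolding q pcompose_mult
    by (simp add: monom_altdef pcompose_power pcompose_pCons)
  finally show ?thesis by simp
qed

lemma poly_eq_0_if_many_roots:
  fixes D :: "rat poly"
  assumes K: "finite K" "inj_on c K"
    and dvd: "\<And>k. k \<in> K \<Longrightarrow> [:c k, 1:] ^ r dvd D"
    and deg: "degree D < r * card K"
  shows "D = 0"
proof (rule ccontr)
  assume D: "D \<noteq> 0"
  have r: "r > 0" using deg by (cases r) auto
  have ord: "order (- c k) D \<ge> r" if "k \<in> K" for k
    using dvd[OF that] D order_divides[of "- c k" r D] by simp
  have root: "poly D (- c k) = 0" if "k \<in> K" for k
    using ord[OF that] r D by (simp add: order_root)
  have inj: "inj_on (\<lambda>k. - c k) K" using K(2) by (auto simp: inj_on_def)
  have "r * card K = (\<Sum>k\<in>K. r)" by simp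
  also have "\<dots> \<le> (\<Sum>k\<in>K. order (- c k) D)" by (intro sum_mono ord)
  also have "\<dots> = (\<Sum>x\<in>(\<lambda>k. - c k) ` K. order x D)" using inj by (simp add: sum.reindex)
  also have "\<dots> \<le> (\<Sum>x | poly D x = 0. order x D)"
    using D root by (intro sum_mono2 poly_roots_finite) auto
  also have "\<dots> \<le> degree D" by (rule sum_order_le_degree[OF D])
  finally show False using deg by simp
qed

text \<open>The decomposition with denominators cleared. \<open>A k\<close> is the expansion at
  \<open>- c k\<close> of the fraction with this pole removed. Both sides agree to order r at every
  pole, which is too many zeros for a difference of degree below r * card K.\<close>

theorem partial_fractions:
  fixes P :: "rat poly" and A :: "'k \<Rightarrow> rat fps"
  assumes K: "finite K" "inj_on c K"
    and deg: "degree P < r * card K"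
    and A: "\<And>k. k \<in> K \<Longrightarrow> A k * (\<Prod>k'\<in>K - {k}. lin (c k' - c k)) ^ r = shift_fps (- c k) P"
  shows "P = (\<Sum>k\<in>K. (\<Sum>i<r. smult (A k $ i) ([:c k, 1:] ^ i)) * (\<Prod>k'\<in>K - {k}. [:c k', 1:]) ^ r)"
proof -
  define T where "T = (\<lambda>k. \<Sum>i<r. smult (A k $ i) ([:c k, 1:] ^ i))"
  define Q where "Q = (\<lambda>k. (\<Prod>k'\<in>K - {k}. [:c k', 1:]) ^ r)"
  have degT: "degree (T k) \<le> r - 1" for k
    unfolding T_def by (intro degree_sum_le order.trans[OF degree_smult_le] order.trans[OF degree_power_le]) auto
  have degQ: "degree (Q k) = r * (card K - 1)" if "k \<in> K" for k
    unfolding Q_def using K that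
    by (simp add: degree_power_eq prod_zero_iff degree_prod_eq_sum_degree)
  have r: "r > 0" using deg by (cases r) auto
  have "P - (\<Sum>k\<in>K. T k * Q k) = 0"
  proof (rule poly_eq_0_if_many_roots[OF K])
    have "degree (\<Sum>k\<in>K. T k * Q k) \<le> r * card K - 1"
    proof (intro degree_sum_le K(1))
      fix k assume k: "k \<in> K"
      hence "card K \<ge> 1" using K(1) by (simp add: Suc_le_eq card_gt_0_iff) blast
      then obtain m where m: "card K = Suc m" by (cases "card K") auto
      have "degree (T k * Q k) \<le> (r - 1) + r * (card K - 1)"
        using degree_mult_le[of "T k" "Q k"] degT[of k] degQ[OF k] by simp
      thus "degree (T k * Q k) \<le> r * card K - 1" using r m by simp
    qed
    thus "degree (P - (\<Sum>k\<in>K. T k * Q k)) < r * card K"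
      using deg by (intro degree_diff_less) auto
    fix k assume k: "k \<in> K"
    show "[:c k, 1:] ^ r dvd P - (\<Sum>k\<in>K. T k * Q k)"
    proof (rule power_linear_dvd_if_shift_fps)
      fix i assume i: "i < r"
      have low: "(fps_X ^ r * f) $ i = 0" for f :: "rat fps" using i by (simp add: fps_X_power_mult_nth)
      \<comment> \<open>The summand of another pole k' contains (x + c k)^r and hence has no terms
        of order below r here.\<close>
      have other: "shift_fps (- c k) (T k' * Q k') $ i = 0" if "k' \<in> K - {k}" for k'
      proof -
        have "shift_fps (- c k) (Q k') = (\<Prod>j\<in>K - {k'}. lin (c j - c k)) ^ r"
          by (simp add: Q_def shift_fps_power shift_fps_prod shift_fps_linear add.commute)
        also have "(\<Prod>j\<in>K - {k'}. lin (c j - c k)) = lin (c k - c k) * (\<Prod>j\<in>K - {k'} - {k}. lin (c j - c k))"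
          using K that k by (intro prod.remove) auto
        finally have "shift_fps (- c k) (T k' * Q k') = fps_X ^ r * (shift_fps (- c k) (T k') * (\<Prod>j\<in>K - {k'} - {k}. lin (c j - c k)) ^ r)"
          by (simp add: shift_fps_mult lin_def power_mult_distrib mult_ac)
        thus ?thesis using low by simp
      qed
      have T: "shift_fps (- c k) (T k) = fps_of_poly (truncate_fps r (A k))"
        unfolding T_def shift_fps_sum shift_fps_smult shift_fps_power shift_fps_linear
        using i by (intro fps_ext) (simp add: lin_def fps_sum_nth fps_X_power_nth if_distrib sum.delta coeff_truncate_fps cong: if_cong)
      obtain B where B: "A k - fps_of_poly (truncate_fps r (A k)) = fps_X ^ r * B"
      proof
        show "A k - fps_of_poly (truncate_fps r (A k)) = fps_X ^ r * fps_shift r (A k)"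
          by (simp add: fps_cutoff_def fps_eq_iff fps_X_power_mult_nth)
      qed
      have Qk: "shift_fps (- c k) (Q k) = (\<Prod>k'\<in>K - {k}. lin (c k' - c k)) ^ r"
        by (simp add: Q_def shift_fps_power shift_fps_prod shift_fps_linear add.commute)
      have "shift_fps (- c k) P - shift_fps (- c k) (T k * Q k) = fps_X ^ r * (B * shift_fps (- c k) (Q k))"
        unfolding A[OF k, symmetric] Qk[symmetric] shift_fps_mult T
        by (simp add: B[symmetric] mult.assoc[symmetric] left_diff_distrib)
      hence "shift_fps (- c k) P $ i - shift_fps (- c k) (T k * Q k) $ i = 0"
        using low by (simp flip: fps_sub_nth)
      moreover have "shift_fps (- c k) (\<Sum>k\<in>K. T k * Q k) $ i = shift_fps (- c k) (T k * Q k) $ i"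
        unfolding shift_fps_sum fps_sum_nth using K k other by (subst sum.remove[of _ k]) auto
      ultimately show "shift_fps (- c k) (P - (\<Sum>k\<in>K. T k * Q k)) $ i = 0"
        by (simp add: shift_fps_diff)
    qed
  qed
  thus ?thesis by (simp add: T_def Q_def)
qed

lemma coeff_mult_degree_le:
  assumes "degree p \<le> a" "degree q \<le> b"
  shows "coeff (p * q) (a + b) = coeff p a * coeff q b"
proof -
  have "coeff (p * q) (a + b) = (\<Sum>i\<le>a + b. coeff p i * coeff q (a + b - i))"
    by (rule coeff_mult)
  also have "\<dots> = (\<Sum>i\<in>{a}. coeff p i * coeff q (a + b - i))"
  proof (intro sum.mono_neutral_right ballI)
    fix i assume i: "i \<in> {..a + b} - {a}"
    show "coeff p i * coeff q (a + b - i) = 0"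
    proof (cases "i > a")
      case True
      thus ?thesis using assms(1) by (simp add: coeff_eq_0)
    next
      case False
      hence "a + b - i > b" using i by auto
      thus ?thesis using assms(2) by (simp add: coeff_eq_0)
    qed
  qed auto
  finally show ?thesis by simp
qed

text \<open>Compare the coefficients of x^(r * card K - 1): P has smaller degree, and on the other
  side the products over the remaining poles are monic of degree r * (card K - 1), so exactly the
  top coefficients \<open>A k $ (r - 1)\<close> survive.\<close>

lemma sum_residues_eq_0:
  fixes P :: "rat poly" and A :: "'k \<Rightarrow> rat fps"
  assumes K: "finite K" "inj_on c K"
    and deg: "degree P + 1 < r * card K" and r: "r > 0"
    and A: "\<And>k. k \<in> K \<Longrightarrow> A k * (\<Prod>k'\<in>K - {k}. lin (c k' - c k)) ^ r = shift_fps (- c k) P"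
  shows "(\<Sum>k\<in>K. A k $ (r - 1)) = 0"
proof -
  have "0 = coeff P (r * card K - 1)" using deg by (intro coeff_eq_0[symmetric]) auto
  also have "P = (\<Sum>k\<in>K. (\<Sum>i<r. smult (A k $ i) ([:c k, 1:] ^ i)) * (\<Prod>k'\<in>K - {k}. [:c k', 1:]) ^ r)"
    using deg by (intro partial_fractions K A) auto
  also have "coeff \<dots> (r * card K - 1) = (\<Sum>k\<in>K. A k $ (r - 1))"
    unfolding coeff_sum
  proof (intro sum.cong refl)
    fix k assume k: "k \<in> K"
    define T where "T = (\<Sum>i<r. smult (A k $ i) ([:c k, 1:] ^ i))"
    define Q where "Q = (\<Prod>k'\<in>K - {k}. [:c k', 1:]) ^ r"
    have degT: "degree T \<le> r - 1"
      unfolding T_def by (intro degree_sum_le order.trans[OF degree_smult_le] order.trans[OF degree_power_le]) auto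
    have degQ: "degree Q = r * (card K - 1)"
      unfolding Q_def using K k
      by (simp add: degree_power_eq prod_zero_iff degree_prod_eq_sum_degree)
    have lQ: "lead_coeff Q = 1"
      unfolding Q_def by (simp add: lead_coeff_power lead_coeff_prod)
    have card: "card K \<ge> 1" using K(1) k by (simp add: Suc_le_eq card_gt_0_iff) blast
    then obtain m where m: "card K = Suc m" by (cases "card K") auto
    have "coeff (T * Q) (r * card K - 1) = coeff (T * Q) ((r - 1) + r * (card K - 1))"
      using r m by (intro arg_cong[of _ _ "coeff (T * Q)"]) auto
    also have "\<dots> = coeff T (r - 1) * coeff Q (r * (card K - 1))"
      using degT degQ by (intro coeff_mult_degree_le) auto
    also have "coeff Q (r * (card K - 1)) = 1" using lQ degQ by simp
    also have "coeff T (r - 1) = (\<Sum>i<r. if i = r - 1 then A k $ i else 0)"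
      unfolding T_def coeff_sum
    proof (intro sum.cong refl)
      fix i assume i: "i \<in> {..<r}"
      have "coeff ([:c k, 1:] ^ i) (r - 1) = (if i = r - 1 then 1 else 0)"
      proof (cases "i = r - 1")
        case True
        have "lead_coeff ([:c k, 1:] ^ i) = 1" by (simp add: lead_coeff_power)
        moreover have "degree ([:c k, 1:] ^ i) = i" by (simp add: degree_power_eq)
        ultimately show ?thesis using True by simp
      qed (use i in \<open>auto intro!: coeff_eq_0 simp: degree_power_eq\<close>)
      thus "coeff (smult (A k $ i) ([:c k, 1:] ^ i)) (r - 1) = (if i = r - 1 then A k $ i else 0)"
        by simp
    qed
    also have "\<dots> = A k $ (r - 1)" using r by simp
    finally show "coeff ((\<Sum>i<r. smult (A k $ i) ([:c k, 1:] ^ i)) * (\<Prod>k'\<in>K - {k}. [:c k', 1:]) ^ r) (r * card K - 1) = A k $ (r - 1)"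
      by (simp add: T_def Q_def)
  qed
  finally show ?thesis by simp
qed

lemma partial_fractions_fps:
  fixes P :: "rat poly" and A :: "'k \<Rightarrow> rat fps"
  assumes K: "finite K" "inj_on c K"
    and deg: "degree P < r * card K"
    and A: "\<And>k. k \<in> K \<Longrightarrow> A k * (\<Prod>k'\<in>K - {k}. lin (c k' - c k)) ^ r = shift_fps (- c k) P"
    and t: "\<And>k. k \<in> K \<Longrightarrow> t + c k \<noteq> 0"
  shows "shift_fps t P * (\<Prod>k\<in>K. inverse (lin (t + c k))) ^ r =
    (\<Sum>k\<in>K. \<Sum>i<r. fps_const (A k $ i) * inverse (lin (t + c k)) ^ (r - i))"
proof -
  have "shift_fps t P = (\<Sum>k\<in>K. (\<Sum>i<r. fps_const (A k $ i) * lin (t + c k) ^ i) * (\<Prod>k'\<in>K - {k}. lin (t + c k')) ^ r)"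
    by (subst partial_fractions[OF K deg A], assumption)
       (simp add: shift_fps_sum shift_fps_mult shift_fps_smult shift_fps_power shift_fps_prod shift_fps_linear)
  hence "shift_fps t P * (\<Prod>k\<in>K. inverse (lin (t + c k))) ^ r =
      (\<Sum>k\<in>K. \<Sum>i<r. fps_const (A k $ i) * lin (t + c k) ^ i * (\<Prod>k'\<in>K - {k}. lin (t + c k')) ^ r * (\<Prod>k\<in>K. inverse (lin (t + c k))) ^ r)"
    by (simp add: sum_distrib_right)
  also have "\<dots> = (\<Sum>k\<in>K. \<Sum>i<r. fps_const (A k $ i) * inverse (lin (t + c k)) ^ (r - i))"
  proof (intro sum.cong refl)
    fix k i assume k: "k \<in> K" and i: "i \<in> {..<r}"
    have "(\<Prod>k\<in>K. inverse (lin (t + c k))) = inverse (lin (t + c k)) * (\<Prod>k'\<in>K - {k}. inverse (lin (t + c k')))"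
      using K k by (intro prod.remove) auto
    moreover have "(\<Prod>k'\<in>K - {k}. lin (t + c k')) * (\<Prod>k'\<in>K - {k}. inverse (lin (t + c k'))) = 1"
      unfolding prod.distrib[symmetric] using t by (intro prod.neutral ballI lin_mult_inverse) auto
    ultimately have 1: "(\<Prod>k'\<in>K - {k}. lin (t + c k')) * (\<Prod>k\<in>K. inverse (lin (t + c k))) = inverse (lin (t + c k))"
      by (simp only: mult.left_commute) simp
    have "lin (t + c k) ^ i * ((\<Prod>k'\<in>K - {k}. lin (t + c k')) ^ r * (\<Prod>k\<in>K. inverse (lin (t + c k))) ^ r)
        = lin (t + c k) ^ i * inverse (lin (t + c k)) ^ r"
      unfolding power_mult_distrib[symmetric] 1 ..
    also have "inverse (lin (t + c k)) ^ r = inverse (lin (t + c k)) ^ i * inverse (lin (t + c k)) ^ (r - i)"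
      using i by (simp flip: power_add)
    also have "lin (t + c k) ^ i * \<dots> = inverse (lin (t + c k)) ^ (r - i)"
      by (simp only: mult.assoc[symmetric] power_mult_distrib[symmetric] lin_mult_inverse[OF t[OF k]]) simp
    finally show "fps_const (A k $ i) * lin (t + c k) ^ i * (\<Prod>k'\<in>K - {k}. lin (t + c k')) ^ r * (\<Prod>k\<in>K. inverse (lin (t + c k))) ^ r =
        fps_const (A k $ i) * inverse (lin (t + c k)) ^ (r - i)"
      by (simp add: mult.assoc)
  qed
  finally show ?thesis .
qed

lemma inverse_lin_power_nth:
  assumes "y \<noteq> 0" "i > 0"
  shows "(inverse (lin y) ^ i) $ s = (- 1) ^ s * of_nat ((i + s - 1) choose s) / y ^ (i + s)"
proof -
  have "lin y = fps_const y * (1 - fps_const (- 1 / y) * fps_X)"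
    using lin_eq[OF assms(1)] by simp
  hence "inverse (lin y) ^ i = fps_const (1 / y ^ i) * inverse ((1 - fps_const (- 1 / y) * fps_X) ^ i)"
    by (simp add: fps_inverse_mult fps_inverse_power power_mult_distrib fps_const_inverse power_inverse divide_inverse
        del: fps_const_neg)
  also have "inverse ((1 - fps_const (- 1 / y) * fps_X) ^ i) = Abs_fps (\<lambda>k. of_nat ((i + k - 1) choose k) * (- 1 / y) ^ k)"
    by (rule one_minus_const_fps_X_neg_power') (rule assms)
  finally show ?thesis by (simp add: power_add power_divide power_minus' del: power_minus_even power_minus_odd)
qed

subsection \<open>Dyadic rationals and denominators\<close>

definition dyadic :: "rat \<Rightarrow> bool" where
  "dyadic x \<longleftrightarrow> (\<exists>e. 2 ^ e * x \<in> \<int>)"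

lemma dyadic_of_int [intro, simp]: "dyadic (of_int k)"
  unfolding dyadic_def by (intro exI[of _ 0]) simp

lemma dyadic_of_nat [intro, simp]: "dyadic (of_nat k)"
  using dyadic_of_int[of "int k"] by simp

lemma dyadic_0 [simp]: "dyadic 0" and dyadic_1 [simp]: "dyadic 1"
  using dyadic_of_nat[of 0] dyadic_of_nat[of 1] by simp_all

lemma dyadic_add [intro]:
  assumes "dyadic x" "dyadic y"
  shows "dyadic (x + y)"
proof -
  obtain e f where "2 ^ e * x \<in> \<int>" "2 ^ f * y \<in> \<int>" using assms by (auto simp: dyadic_def)
  moreover have "(2 :: rat) ^ f \<in> \<int>" "(2 :: rat) ^ e \<in> \<int>" by auto
  ultimately have "2 ^ f * (2 ^ e * x) + 2 ^ e * (2 ^ f * y) \<in> \<int>"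
    using Ints_add Ints_mult by blast
  thus ?thesis unfolding dyadic_def by (intro exI[of _ "e + f"]) (simp add: power_add algebra_simps)
qed

lemma dyadic_mult [intro]:
  assumes "dyadic x" "dyadic y"
  shows "dyadic (x * y)"
proof -
  obtain e f where "2 ^ e * x \<in> \<int>" "2 ^ f * y \<in> \<int>" using assms by (auto simp: dyadic_def)
  hence "(2 ^ e * x) * (2 ^ f * y) \<in> \<int>" by (rule Ints_mult)
  thus ?thesis unfolding dyadic_def by (intro exI[of _ "e + f"]) (simp add: power_add algebra_simps)
qed

lemma dyadic_minus [intro]: "dyadic x \<Longrightarrow> dyadic (- x)"
  using dyadic_mult[OF dyadic_of_int[of "- 1"], of x] by simp

lemma dyadic_power [intro]: "dyadic x \<Longrightarrow> dyadic (x ^ n)"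
  by (induction n) auto

lemma dyadic_sum [intro]: "(\<And>i. i \<in> A \<Longrightarrow> dyadic (f i)) \<Longrightarrow> dyadic (sum f A)"
  by (induction A rule: infinite_finite_induct) auto

lemma dyadic_divide_power2 [intro]:
  assumes "dyadic x"
  shows "dyadic (x / 2 ^ k)"
proof -
  obtain e where "2 ^ e * x \<in> \<int>" using assms by (auto simp: dyadic_def)
  thus ?thesis unfolding dyadic_def by (intro exI[of _ "e + k"]) (simp add: power_add)
qed

lemma dyadic_divide_4 [intro]: "dyadic x \<Longrightarrow> dyadic (x / 4)"
  using dyadic_divide_power2[of x 2] by simp

text \<open>Each Taylor order may cost one factor d, and w counts additional ones. Both gradings add
  under multiplication, so the power of d needed for a product can be read off its factors.\<close>

definition graded_dyadic :: "nat \<Rightarrow> nat \<Rightarrow> rat fps \<Rightarrow> bool" where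
  "graded_dyadic d w f \<longleftrightarrow> (\<forall>j. dyadic (of_nat d ^ (w + j) * f $ j))"

lemma graded_dyadic_mult [intro]:
  assumes "graded_dyadic d v f" "graded_dyadic d w g"
  shows "graded_dyadic d (v + w) (f * g)"
  unfolding graded_dyadic_def
proof
  fix j
  have "of_nat d ^ (v + w + j) * (f * g) $ j = (\<Sum>i=0..j. (of_nat d ^ (v + i) * f $ i) * (of_nat d ^ (w + (j - i)) * g $ (j - i)))"
    unfolding fps_mult_nth sum_distrib_left
  proof (intro sum.cong refl)
    fix i assume "i \<in> {0..j}"
    hence "(of_nat d :: rat) ^ (v + w + j) = of_nat d ^ (v + i) * of_nat d ^ (w + (j - i))"
      unfolding power_add[symmetric] by (intro arg_cong[of _ _ "(^) (of_nat d)"]) auto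
    thus "of_nat d ^ (v + w + j) * (f $ i * g $ (j - i)) = (of_nat d ^ (v + i) * f $ i) * (of_nat d ^ (w + (j - i)) * g $ (j - i))"
      by simp
  qed
  moreover have "dyadic \<dots>"
    by (intro dyadic_sum dyadic_mult[OF assms(1)[unfolded graded_dyadic_def, rule_format] assms(2)[unfolded graded_dyadic_def, rule_format]])
  ultimately show "dyadic (of_nat d ^ (v + w + j) * (f * g) $ j)" by simp
qed

lemma graded_dyadic_const: "dyadic c \<Longrightarrow> graded_dyadic d 0 (fps_const c)"
  by (auto simp: graded_dyadic_def)

lemma graded_dyadic_1 [simp]: "graded_dyadic d 0 1"
  using graded_dyadic_const[of 1 d] by simp

lemma graded_dyadic_power: "graded_dyadic d w f \<Longrightarrow> graded_dyadic d (w * n) (f ^ n)"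
  by (induction n) auto

lemma graded_dyadic_prod: "(\<And>i. i \<in> A \<Longrightarrow> graded_dyadic d 0 (f i)) \<Longrightarrow> graded_dyadic d 0 (prod f A)"
proof (induction A rule: infinite_finite_induct)
  case (insert i A)
  hence "graded_dyadic d (0 + 0) (f i * prod f A)" by (intro graded_dyadic_mult) auto
  thus ?case using insert by simp
qed auto

lemma graded_dyadic_sum: "(\<And>i. i \<in> A \<Longrightarrow> graded_dyadic d w (f i)) \<Longrightarrow> graded_dyadic d w (sum f A)"
  by (auto simp: graded_dyadic_def fps_sum_nth sum_distrib_left)

lemma graded_dyadic_lin: "dyadic c \<Longrightarrow> graded_dyadic d 0 (lin c)"
  by (auto simp: graded_dyadic_def lin_nth)

lemma graded_dyadic_affine:
  assumes "dyadic c" "dyadic (of_nat d * b)"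
  shows "graded_dyadic d 0 (fps_const c + fps_const b * fps_X)"
  unfolding graded_dyadic_def
proof
  fix j :: nat
  consider "j = 0" | "j = 1" | "j \<ge> 2" by linarith
  thus "dyadic (of_nat d ^ (0 + j) * (fps_const c + fps_const b * fps_X) $ j)"
    by cases (use assms in auto)
qed

lemma graded_dyadic_inverse:
  assumes "b \<noteq> 0" "dyadic (of_nat d / b)"
  shows "graded_dyadic d 0 (fps_const b * inverse (lin b))"
  unfolding graded_dyadic_def
proof
  fix j
  have "(fps_const b * inverse (lin b)) $ j = (- 1) ^ j / b ^ j"
    using inverse_lin_power_nth[OF assms(1), of 1 j] assms(1) by (simp add: power_add)
  hence "of_nat d ^ (0 + j) * (fps_const b * inverse (lin b)) $ j = (- 1) ^ j * (of_nat d / b) ^ j"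
    by (simp add: power_divide)
  moreover have "dyadic ((- 1) ^ j * (of_nat d / b) ^ j)"
    using assms(2) dyadic_of_int[of "(- 1) ^ j"] by (intro dyadic_mult[OF _ dyadic_power]) simp_all
  ultimately show "dyadic (of_nat d ^ (0 + j) * (fps_const b * inverse (lin b)) $ j)" by simp
qed

text \<open>Modulo the odd part \<open>M\<close> of \<open>m!\<close> the number \<open>c/4\<close> is congruent to an integer.\<close>

lemma dyadic_gbinomial_quarter: "dyadic ((of_int c / 4) gchoose m)"
proof -
  obtain v M where M: "fact m = 2 ^ v * M" "odd (M :: int)"
  proof -
    obtain y where "(fact m :: int) = 2 ^ multiplicity 2 (fact m :: int) * y" "odd y"
      by (rule multiplicity_decompose'[of "fact m :: int" 2]) auto
    thus ?thesis by (rule that)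
  qed
  have "coprime (2 ^ 2) M" using M(2) by (intro coprime_power_left_iff[THEN iffD2]) auto
  hence "coprime 4 M" by simp
  then obtain u where u: "[4 * u = 1] (mod M)" using cong_solve_coprime_int by blast
  define b where "b = u * c"
  have "[4 * b = c] (mod M)"
    using cong_scalar_right[OF u, of c] by (simp add: b_def mult.assoc)
  hence "[c - 4 * int i = 4 * b - 4 * int i] (mod M)" for i
    by (intro cong_diff cong_sym[of "4 * b" c]) auto
  hence "[(\<Prod>i<m. c - 4 * int i) = (\<Prod>i<m. 4 * b - 4 * int i)] (mod M)"
    by (intro cong_prod)
  moreover have "M dvd (\<Prod>i<m. 4 * b - 4 * int i)"
  proof -
    have "M dvd fact m" unfolding M(1) by simp
    also have "fact m dvd pochhammer (- b) m" by (rule fact_dvd_pochhammer)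
    also have "\<dots> dvd (- 4) ^ m * pochhammer (- b) m" by simp
    also have "\<dots> = (\<Prod>i<m. (- 4) * (- b + int i))"
      unfolding pochhammer_prod atLeast0LessThan prod.distrib by simp
    also have "\<dots> = (\<Prod>i<m. 4 * b - 4 * int i)"
      by (intro prod.cong) auto
    finally show ?thesis .
  qed
  ultimately have "M dvd (\<Prod>i<m. c - 4 * int i)" using cong_dvd_iff by blast
  then obtain z where z: "(\<Prod>i<m. c - 4 * int i) = M * z" by (elim dvdE)
  have "M \<noteq> 0" using M(2) by auto
  have "(of_int c / 4) gchoose m = (\<Prod>i<m. of_int c / 4 - of_nat i) / fact m"
    by (simp add: gbinomial_prod_rev atLeast0LessThan)
  also have "(\<Prod>i<m. of_int c / 4 - of_nat i) = (\<Prod>i<m. (of_int (c - 4 * int i) / 4 :: rat))"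
    by (intro prod.cong) auto
  also have "\<dots> = of_int (M * z) / 4 ^ m" unfolding z[symmetric] by (simp add: prod_dividef)
  also have "(fact m :: rat) = of_int (fact m)" by simp
  also have "of_int (M * z) / 4 ^ m / of_int (fact m) = (of_int z / 2 ^ (v + 2 * m) :: rat)"
  proof -
    have "(4 :: rat) ^ m = 2 ^ (2 * m)" by (simp add: power_mult)
    moreover have "of_int M \<noteq> (0 :: rat)" using \<open>M \<noteq> 0\<close> by simp
    ultimately show ?thesis unfolding M(1) by (simp add: power_add mult_ac)
  qed
  finally show ?thesis by auto
qed

section \<open>Denominators of blocks of consecutive linear factors\<close>

lemma fps_const_prod: "(\<Prod>i\<in>A. fps_const (f i)) = fps_const (\<Prod>i\<in>A. f i)"
  by (induction A rule: infinite_finite_induct) simp_all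

text \<open>The binomial coefficient (y + m + X) choose m as a series in X.\<close>

definition zero_block :: "rat \<Rightarrow> nat \<Rightarrow> rat fps" where
  "zero_block y m = fps_const (1 / fact m) * (\<Prod>j=1..m. lin (y + of_nat j))"

text \<open>The Chu-Vandermonde identity separates y from X: for a quarter-integer y the binomials
  in y are dyadic without help from d, and only X choose l needs it. As a polynomial identity it is
  checked at every rational e.\<close>

lemma zero_block_Vandermonde:
  "zero_block y m = (\<Sum>l\<in>{0..m}. fps_const ((y + of_nat m) gchoose (m - l)) * (fps_const (1 / fact l) * (\<Prod>i<l. lin (- of_nat i))))"
proof -
  define P where "P = smult (1 / fact m) (\<Prod>j=1..m. [:y + of_nat j, 1:])"
  define Q where "Q = (\<lambda>l. smult (1 / fact l) (\<Prod>i<l. [:- of_nat i, 1 :: rat:]))"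
  have "P = (\<Sum>l\<in>{0..m}. smult ((y + of_nat m) gchoose (m - l)) (Q l))"
    unfolding poly_eq_poly_eq_iff[symmetric]
  proof
    fix e :: rat
    have "(\<Prod>j=1..m. y + of_nat j + e) = (\<Prod>i<m. y + of_nat (Suc i) + e)"
      by (rule prod.reindex_bij_witness[of _ Suc "\<lambda>j. j - 1"]) auto
    also have "\<dots> = (\<Prod>i<m. y + of_nat (Suc (m - Suc i)) + e)"
      by (rule prod.nat_diff_reindex[symmetric])
    also have "\<dots> = (\<Prod>i<m. y + of_nat m + e - of_nat i)"
      by (intro prod.cong refl) (auto simp: of_nat_diff Suc_diff_Suc)
    finally have "poly P e = (y + of_nat m + e) gchoose m"
      by (simp add: P_def poly_prod gbinomial_prod_rev atLeast0LessThan)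
    also have "\<dots> = (e + (y + of_nat m)) gchoose m" by (simp add: add_ac)
    also have "\<dots> = (\<Sum>l\<in>{0..m}. (e gchoose l) * ((y + of_nat m) gchoose (m - l)))"
      by (rule gbinomial_Vandermonde[symmetric])
    also have "\<dots> = poly (\<Sum>l\<in>{0..m}. smult ((y + of_nat m) gchoose (m - l)) (Q l)) e"
      unfolding poly_sum
      by (intro sum.cong refl) (simp add: Q_def poly_prod gbinomial_prod_rev atLeast0LessThan mult_ac)
    finally show "poly P e = poly (\<Sum>l\<in>{0..m}. smult ((y + of_nat m) gchoose (m - l)) (Q l)) e" .
  qed
  hence "fps_of_poly P = (\<Sum>l\<in>{0..m}. fps_const ((y + of_nat m) gchoose (m - l)) * fps_of_poly (Q l))"
    by (simp add: fps_of_poly_sum fps_of_poly_smult)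
  thus ?thesis
    by (simp add: P_def Q_def zero_block_def fps_of_poly_smult fps_of_poly_prod fps_of_poly_linear lin_def add.commute)
qed

text \<open>X choose l is X / l times the product of X / i - 1 over 0 < i < l, so every X comes with
  one denominator, a divisor of d.\<close>

lemma graded_dyadic_falling:
  assumes "\<And>i. 1 \<le> i \<Longrightarrow> i \<le> l \<Longrightarrow> i dvd d"
  shows "graded_dyadic d 0 (fps_const (1 / fact l) * (\<Prod>i<l. lin (- of_nat i)))"
proof (cases l)
  case (Suc l')
  have dv: "dyadic (of_nat d * (1 / of_nat i))" if i: "1 \<le> i" "i \<le> l" for i
  proof -
    obtain e where "d = i * e" using assms[OF i] by (elim dvdE)
    hence "of_nat d * (1 / of_nat i) = (of_nat e :: rat)" using i by simp
    thus ?thesis by simp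
  qed
  have "(\<Prod>i<l. lin (- of_nat i)) = lin 0 * (\<Prod>i<l'. lin (- of_nat (Suc i)))"
    unfolding Suc by (subst prod.lessThan_Suc_shift) simp
  also have "(\<Prod>i<l'. lin (- of_nat (Suc i))) = (\<Prod>i=1..l'. lin (- of_nat i))"
    by (rule prod.reindex_bij_witness[of _ "\<lambda>j. j - 1" Suc]) auto
  also have "(\<Prod>i=1..l'. lin (- of_nat i)) = (\<Prod>i=1..l'. fps_const (of_nat i)) * (\<Prod>i=1..l'. fps_const (- 1) + fps_const (1 / of_nat i) * fps_X)"
    unfolding prod.distrib[symmetric] by (intro prod.cong refl) (simp add: lin_def algebra_simps del: fps_const_neg)
  also have "(\<Prod>i=1..l'. fps_const (of_nat i)) = (fps_const (fact l') :: rat fps)"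
    by (simp add: fps_const_prod fact_prod)
  finally have "fps_const (1 / fact l) * (\<Prod>i<l. lin (- of_nat i)) =
      (fps_const 0 + fps_const (1 / of_nat l) * fps_X) * (\<Prod>i=1..l'. fps_const (- 1) + fps_const (1 / of_nat i) * fps_X)"
    by (simp add: Suc lin_def mult.assoc[symmetric] mult.commute[of fps_X] del: of_nat_Suc)
  moreover have "graded_dyadic d (0 + 0) ((fps_const 0 + fps_const (1 / of_nat l) * fps_X) * (\<Prod>i=1..l'. fps_const (- 1) + fps_const (1 / of_nat i) * fps_X))"
  proof (rule graded_dyadic_mult)
    show "graded_dyadic d 0 (fps_const 0 + fps_const (1 / of_nat l) * fps_X)"
      by (rule graded_dyadic_affine, simp, rule dv) (auto simp: Suc)
    show "graded_dyadic d 0 (\<Prod>i=1..l'. fps_const (- 1) + fps_const (1 / of_nat i) * fps_X)"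
      using dyadic_of_int[of "- 1"] by (intro graded_dyadic_prod graded_dyadic_affine dv) (auto simp: Suc)
  qed
  ultimately show ?thesis by simp
qed simp

lemma graded_dyadic_zero_block:
  assumes "\<And>i. 1 \<le> i \<Longrightarrow> i \<le> m \<Longrightarrow> i dvd d" "y = of_int c / 4"
  shows "graded_dyadic d 0 (zero_block y m)"
  unfolding zero_block_Vandermonde
proof (intro graded_dyadic_sum)
  fix l assume l: "l \<in> {0..m}"
  have "y + of_nat m = of_int (c + 4 * int m) / 4" using assms(2) by (simp add: field_simps)
  hence "dyadic ((y + of_nat m) gchoose (m - l))" using dyadic_gbinomial_quarter by metis
  from graded_dyadic_mult[OF graded_dyadic_const[OF this] graded_dyadic_falling[of l d]] assms(1) l
  show "graded_dyadic d 0 (fps_const (y + of_nat m gchoose m - l) * (fps_const (1 / fact l) * (\<Prod>i<l. lin (- of_nat i))))"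
    by simp
qed

text \<open>The numbers 1 / (m * ((m + k) choose m)) form Leibniz's harmonic triangle: each is a
  difference of two entries with smaller k, and at k = 0 they are 1 / m.\<close>

lemma divide_binomial_in_Ints:
  assumes "1 \<le> m" "\<And>i. 1 \<le> i \<Longrightarrow> i \<le> m + k \<Longrightarrow> i dvd d"
  shows "of_nat d / (of_nat m * of_nat ((m + k) choose m)) \<in> (\<int> :: rat set)"
  using assms
proof (induction k arbitrary: m)
  case 0
  then obtain e where "d = m * e" by (metis add_0_right dvdE order_refl)
  thus ?case using 0 by simp
next
  case (Suc k)
  have 1: "of_nat d / (of_nat m * of_nat ((m + k) choose m)) \<in> (\<int> :: rat set)"
    using Suc.prems by (intro Suc.IH) auto
  have 2: "of_nat d / (of_nat (Suc m) * of_nat ((Suc m + k) choose Suc m)) \<in> (\<int> :: rat set)"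
    using Suc.prems by (intro Suc.IH) auto
  define f where "f = (fact :: nat \<Rightarrow> rat)"
  have bin: "of_nat ((a + b) choose a) = f (a + b) / (f a * f b)" for a b
    unfolding f_def by (simp add: binomial_fact)
  have f: "f (Suc j) = of_nat (Suc j) * f j" "f j \<noteq> 0" for j by (auto simp: f_def)
  have "of_nat d / (of_nat m * of_nat ((m + Suc k) choose m)) =
      of_nat d / (of_nat m * of_nat ((m + k) choose m)) - of_nat d / (of_nat (Suc m) * of_nat ((Suc m + k) choose Suc m) :: rat)"
  proof -
    have "f m = of_nat m * f (m - 1)" using f(1)[of "m - 1"] Suc.prems(1) by simp
    hence fm: "f m / of_nat m = f (m - 1)" using Suc.prems(1) by simp
    have a: "of_nat d / (of_nat m * of_nat ((m + Suc k) choose m)) = of_nat d * (f (m - 1) * f (Suc k)) / f (Suc (m + k))"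
      unfolding bin fm[symmetric] by simp
    have b: "of_nat d / (of_nat m * of_nat ((m + k) choose m)) = of_nat d * (f (m - 1) * f k) / f (m + k)"
      unfolding bin fm[symmetric] by simp
    have c: "of_nat d / (of_nat (Suc m) * of_nat ((Suc m + k) choose Suc m)) = of_nat d * (f m * f k) / f (Suc (m + k))"
      unfolding bin using f(1)[of m] f(2)[of m] by (simp del: of_nat_Suc)
    have "f (m - 1) * f (Suc k) + f m * f k = f (m - 1) * f k * of_nat (Suc (m + k))"
      using f(1)[of k] \<open>f m = of_nat m * f (m - 1)\<close> by (simp add: algebra_simps)
    hence "of_nat d * (f (m - 1) * f (Suc k)) + of_nat d * (f m * f k) = of_nat d * (f (m - 1) * f k) * of_nat (Suc (m + k))"
      by (metis distrib_left mult.assoc)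
    thus ?thesis unfolding a b c using f(1)[of "m + k"] f(2)[of "m + k"]
      by (simp add: field_simps del: of_nat_Suc)
  qed
  also have "\<dots> \<in> \<int>" using 1 2 by (rule Ints_diff)
  finally show ?case .
qed

text \<open>\<open>expansion n k\<close> is the expansion of \<open>\<Prod>(t + j) / \<Prod>(t + k' + 1/4)\<close> at its pole
  \<open>- k - 1/4\<close>, with the pole removed; in \<open>expansion_cancel n k m\<close> the zero at \<open>- m\<close> is removed as well.\<close>

definition pole_inverses :: "nat \<Rightarrow> nat \<Rightarrow> rat fps" where
  "pole_inverses n k = (\<Prod>k'\<in>{..n} - {k}. inverse (lin (of_nat k' - of_nat k)))"

definition expansion :: "nat \<Rightarrow> nat \<Rightarrow> rat fps" where
  "expansion n k = (\<Prod>j=1..n. lin (- (of_nat k + 1 / 4) + of_nat j)) * pole_inverses n k"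

definition expansion_cancel :: "nat \<Rightarrow> nat \<Rightarrow> nat \<Rightarrow> rat fps" where
  "expansion_cancel n k m = (\<Prod>j\<in>{1..n} - {m}. lin (- (of_nat k + 1 / 4) + of_nat j)) * pole_inverses n k"

lemma prod_pole_differences:
  assumes "k \<le> n"
  shows "(\<Prod>k'\<in>{..n} - {k}. of_nat k' - of_nat k) = ((- 1) ^ k * fact k * fact (n - k) :: rat)"
proof -
  have "{..n} - {k} = {..<k} \<union> {k+1..n}" using assms by auto
  moreover have "(\<Prod>k'\<in>{..<k} \<union> {k+1..n}. of_nat k' - of_nat k :: rat) = (\<Prod>k'<k. of_nat k' - of_nat k) * (\<Prod>k'=k+1..n. of_nat k' - of_nat k)"
    by (rule prod.union_disjoint) auto
  ultimately have "(\<Prod>k'\<in>{..n} - {k}. of_nat k' - of_nat k :: rat) = (\<Prod>k'<k. of_nat k' - of_nat k) * (\<Prod>k'=k+1..n. of_nat k' - of_nat k)"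
    by metis
  also have "(\<Prod>k'<k. of_nat k' - of_nat k :: rat) = (\<Prod>i<k. of_nat (k - Suc i) - of_nat k)"
    by (rule prod.nat_diff_reindex[symmetric])
  also have "\<dots> = (\<Prod>i<k. - 1 * of_nat (Suc i))"
    by (intro prod.cong refl) (auto simp: of_nat_diff)
  also have "\<dots> = (- 1) ^ k * fact k"
    by (simp only: prod.distrib prod_constant) (simp add: fact_prod_Suc atLeast0LessThan)
  also have "(\<Prod>k'=k+1..n. of_nat k' - of_nat k :: rat) = (\<Prod>i=1..n-k. of_nat i)"
    using assms by (intro prod.reindex_bij_witness[of _ "\<lambda>i. i + k" "\<lambda>i. i - k"]) (auto simp: of_nat_diff)
  also have "\<dots> = fact (n - k)" by (simp add: fact_prod)
  finally show ?thesis by simp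
qed

text \<open>After normalising each factor to c / (c + X) the constant is n! / (k! (n - k)!) up to
  sign, an integer. The coefficients are then built from 1 / c with 0 < |c| \<le> n, and d / c is an
  integer.\<close>

lemma graded_dyadic_pole_inverses:
  assumes k: "k \<le> n" and d: "\<And>i. 1 \<le> i \<Longrightarrow> i \<le> n \<Longrightarrow> i dvd d"
  shows "graded_dyadic d 0 (fps_const (fact n) * pole_inverses n k)"
proof -
  define c where "c = (\<lambda>k'. of_nat k' - of_nat k :: rat)"
  have c0: "c k' \<noteq> 0" if "k' \<in> {..n} - {k}" for k' using that by (auto simp: c_def)
  have C: "(\<Prod>k'\<in>{..n} - {k}. c k') = (- 1) ^ k * fact k * fact (n - k)"
    unfolding c_def by (rule prod_pole_differences[OF k])
  have "fps_const (\<Prod>k'\<in>{..n} - {k}. c k') * pole_inverses n k = (\<Prod>k'\<in>{..n} - {k}. fps_const (c k') * inverse (lin (c k')))"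
    unfolding pole_inverses_def c_def by (simp add: prod.distrib fps_const_prod)
  moreover have "fact n = of_int ((- 1) ^ k * int (n choose k)) * (\<Prod>k'\<in>{..n} - {k}. c k')"
    unfolding C using k by (simp add: binomial_fact power_mult_distrib[symmetric])
  ultimately have e: "fps_const (fact n) * pole_inverses n k =
      fps_const (of_int ((- 1) ^ k * int (n choose k))) * (\<Prod>k'\<in>{..n} - {k}. fps_const (c k') * inverse (lin (c k')))"
    by (metis (no_types, lifting) fps_const_mult mult.assoc)
  have g: "graded_dyadic d 0 (\<Prod>k'\<in>{..n} - {k}. fps_const (c k') * inverse (lin (c k')))"
  proof (intro graded_dyadic_prod graded_dyadic_inverse c0)
    fix k' assume k': "k' \<in> {..n} - {k}"
    show "dyadic (of_nat d / c k')"
    proof (cases "k' > k")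
      case True
      have "k' - k dvd d" using True k' by (intro d) auto
      then obtain e where "d = (k' - k) * e" by (elim dvdE)
      hence "of_nat d / c k' = of_nat e" using True by (simp add: c_def of_nat_diff)
      thus ?thesis by simp
    next
      case False
      have "k - k' dvd d" using False k' k by (intro d) auto
      then obtain e where "d = (k - k') * e" by (elim dvdE)
      moreover have "c k' = - of_nat (k - k')" using False by (simp add: c_def of_nat_diff)
      moreover have "(of_nat (k - k') :: rat) \<noteq> 0" using False k' by auto
      ultimately have e: "of_nat d / c k' = - of_nat e" by (simp only: of_nat_mult minus_divide_right[symmetric] nonzero_mult_div_cancel_left simp_thms)
      thus ?thesis by (simp add: dyadic_minus)
    qed
  qed
  show ?thesis unfolding e
    using graded_dyadic_mult[OF graded_dyadic_const[OF dyadic_of_int] g] by (simp only: add_0_left)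
qed

lemma graded_dyadic_expansion:
  assumes k: "k \<le> n" and d: "\<And>i. 1 \<le> i \<Longrightarrow> i \<le> n \<Longrightarrow> i dvd d"
  shows "graded_dyadic d 0 (expansion n k)"
proof -
  have "expansion n k = zero_block (- (of_nat k + 1 / 4)) n * (fps_const (fact n) * pole_inverses n k)"
    by (simp add: expansion_def zero_block_def mult_ac)
  moreover have "graded_dyadic d 0 (zero_block (- (of_nat k + 1 / 4)) n)"
    by (rule graded_dyadic_zero_block[where c = "- (4 * int k + 1)"]) (use d in \<open>auto simp: field_simps\<close>)
  ultimately show ?thesis using graded_dyadic_mult[OF _ graded_dyadic_pole_inverses[OF k d]] by fastforce
qed

text \<open>Without the factor m the zeros form two blocks of lengths m - 1 and n - m, whose
  factorials no longer match n!. The defect is 1 / (m * (n choose m)), which one extra d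
  clears.\<close>

lemma graded_dyadic_expansion_cancel:
  assumes k: "k \<le> n" and m: "1 \<le> m" "m \<le> n" and d: "\<And>i. 1 \<le> i \<Longrightarrow> i \<le> n \<Longrightarrow> i dvd d"
  shows "graded_dyadic d 1 (expansion_cancel n k m)"
proof -
  define y :: rat where "y = - (of_nat k + 1 / 4)"
  define q :: rat where "q = fact (m - 1) * fact (n - m) / fact n"
  have "{1..n} - {m} = {1..m - 1} \<union> {m+1..n}" using m by auto
  moreover have "(\<Prod>j\<in>{1..m - 1} \<union> {m+1..n}. lin (y + of_nat j)) = (\<Prod>j=1..m-1. lin (y + of_nat j)) * (\<Prod>j=m+1..n. lin (y + of_nat j))"
    by (rule prod.union_disjoint) auto
  ultimately have "(\<Prod>j\<in>{1..n} - {m}. lin (y + of_nat j)) = (\<Prod>j=1..m-1. lin (y + of_nat j)) * (\<Prod>j=m+1..n. lin (y + of_nat j))"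
    by metis
  also have "(\<Prod>j=m+1..n. lin (y + of_nat j)) = (\<Prod>j=1..n-m. lin (y + of_nat m + of_nat j))"
    using m by (intro prod.reindex_bij_witness[of _ "\<lambda>i. i + m" "\<lambda>i. i - m"]) (auto simp: of_nat_diff)
  finally have "expansion_cancel n k m = fps_const q * (zero_block y (m - 1) * (zero_block (y + of_nat m) (n - m) * (fps_const (fact n) * pole_inverses n k)))"
    by (simp add: expansion_cancel_def zero_block_def q_def y_def mult_ac)
  moreover have "graded_dyadic d 1 (fps_const q)"
  proof -
    have "q = 1 / (of_nat m * of_nat ((m + (n - m)) choose m))"
    proof -
      obtain m' where m': "m = Suc m'" using m by (cases m) auto
      show ?thesis using m by (simp add: q_def binomial_fact m' del: of_nat_Suc)
    qed
    hence "of_nat d * q \<in> \<int>"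
      using divide_binomial_in_Ints[of m "n - m" d] m d by simp
    hence "dyadic (of_nat d * q)" by (auto elim: Ints_cases)
    thus ?thesis by (auto simp: graded_dyadic_def)
  qed
  moreover have "graded_dyadic d 0 (zero_block y (m - 1))"
    by (rule graded_dyadic_zero_block[where c = "- (4 * int k + 1)"]) (use d m in \<open>auto simp: field_simps y_def\<close>)
  moreover have "graded_dyadic d 0 (zero_block (y + of_nat m) (n - m))"
    by (rule graded_dyadic_zero_block[where c = "4 * int m - (4 * int k + 1)"]) (use d m in \<open>auto simp: field_simps y_def\<close>)
  moreover note graded_dyadic_pole_inverses[OF k d]
  ultimately show ?thesis
    using graded_dyadic_mult[of d 1 "fps_const q" 0] graded_dyadic_mult[of d 0 _ 0] by fastforce
qed

subsection \<open>Archimedean bounds\<close>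

text \<open>By the binomial theorem rates add under products while constants multiply. So n factors
  with constant 1 have rate O(n), and a coefficient of fixed order is polynomial in n.\<close>

definition fps_bound :: "rat \<Rightarrow> rat \<Rightarrow> rat fps \<Rightarrow> bool" where
  "fps_bound C M f \<longleftrightarrow> C \<ge> 0 \<and> M \<ge> 0 \<and> (\<forall>j. \<bar>f $ j\<bar> \<le> C * M ^ j)"

lemma fps_bound_mult:
  assumes "fps_bound C M f" "fps_bound D N g"
  shows "fps_bound (C * D) (M + N) (f * g)"
  unfolding fps_bound_def
proof (intro conjI allI)
  have nn: "C \<ge> 0" "D \<ge> 0" "M \<ge> 0" "N \<ge> 0" using assms by (auto simp: fps_bound_def)
  show "C * D \<ge> 0" "M + N \<ge> 0" using nn by auto
  fix j
  have "\<bar>(f * g) $ j\<bar> \<le> (\<Sum>i=0..j. \<bar>f $ i\<bar> * \<bar>g $ (j - i)\<bar>)"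
    unfolding fps_mult_nth by (rule order.trans[OF sum_abs]) (simp add: abs_mult)
  also have "\<dots> \<le> (\<Sum>i=0..j. (C * M ^ i) * (D * N ^ (j - i)))"
    using assms nn by (intro sum_mono mult_mono) (auto simp: fps_bound_def)
  also have "\<dots> \<le> (\<Sum>i=0..j. C * D * (of_nat (j choose i) * M ^ i * N ^ (j - i)))"
  proof (intro sum_mono)
    fix i assume i: "i \<in> {0..j}"
    hence "(1 :: rat) \<le> of_nat (j choose i)" by (simp add: Suc_le_eq)
    hence "1 * (C * D * M ^ i * N ^ (j - i)) \<le> of_nat (j choose i) * (C * D * M ^ i * N ^ (j - i))"
      using nn by (intro mult_right_mono) auto
    thus "(C * M ^ i) * (D * N ^ (j - i)) \<le> C * D * (of_nat (j choose i) * M ^ i * N ^ (j - i))"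
      by (simp add: mult_ac)
  qed
  also have "\<dots> = C * D * (M + N) ^ j"
    by (simp add: binomial_ring sum_distrib_left atMost_atLeast0)
  finally show "\<bar>(f * g) $ j\<bar> \<le> C * D * (M + N) ^ j" .
qed

lemma fps_bound_const: "\<bar>c\<bar> \<le> C \<Longrightarrow> fps_bound C 0 (fps_const c)"
  by (auto simp: fps_bound_def power_0_left)

lemma fps_bound_power: "fps_bound C M f \<Longrightarrow> fps_bound (C ^ n) (of_nat n * M) (f ^ n)"
proof (induction n)
  case 0
  thus ?case using fps_bound_const[of 1 1] by simp
next
  case (Suc n)
  from fps_bound_mult[OF Suc.prems Suc.IH[OF Suc.prems]] show ?case by (simp add: algebra_simps)
qed

lemma fps_bound_prod:
  "finite A \<Longrightarrow> (\<And>i. i \<in> A \<Longrightarrow> fps_bound 1 M (f i)) \<Longrightarrow> fps_bound 1 (of_nat (card A) * M) (prod f A)"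
proof (induction A rule: finite_induct)
  case empty
  thus ?case using fps_bound_const[of 1 1] by simp
next
  case (insert i A)
  have "fps_bound (1 * 1) (M + of_nat (card A) * M) (f i * prod f A)"
    using insert by (intro fps_bound_mult) auto
  thus ?case using insert by (simp add: algebra_simps)
qed

lemma fps_bound_linear:
  assumes "\<bar>y\<bar> \<ge> 1 / 4"
  shows "fps_bound 1 4 (1 + fps_const (1 / y) * fps_X)"
  unfolding fps_bound_def
proof (intro conjI allI)
  fix j :: nat
  have "\<bar>1 / y\<bar> \<le> 4" using assms by (simp add: abs_divide divide_le_eq)
  moreover have "(1 + fps_const b * fps_X) $ j = (if j = 0 then 1 else if j = 1 then b else 0)" for b :: rat
    by simp
  ultimately show "\<bar>(1 + fps_const (1 / y) * fps_X) $ j\<bar> \<le> 1 * 4 ^ j"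
    by (simp only:) simp
qed auto

lemma fps_bound_inverse_linear:
  assumes "\<bar>y\<bar> \<ge> 1 / 4"
  shows "fps_bound 1 4 (fps_const y * inverse (lin y))"
  unfolding fps_bound_def
proof (intro conjI allI)
  fix j :: nat
  have y: "y \<noteq> 0" "\<bar>1 / y\<bar> \<le> 4" using assms by (auto simp: abs_divide divide_le_eq)
  have "(fps_const y * inverse (lin y)) $ j = (- 1) ^ j * (1 / y) ^ j"
    using inverse_lin_power_nth[OF y(1), of 1 j] y(1) by (simp add: power_add power_divide)
  hence "\<bar>(fps_const y * inverse (lin y)) $ j\<bar> = \<bar>1 / y\<bar> ^ j" by (simp add: abs_mult power_abs)
  also have "\<dots> \<le> 4 ^ j" using y by (intro power_mono) auto
  finally show "\<bar>(fps_const y * inverse (lin y)) $ j\<bar> \<le> 1 * 4 ^ j" by simp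
qed auto

lemma quarter_offset_abs:
  fixes j k :: nat
  defines "y \<equiv> - (of_nat k + 1 / 4) + of_nat j :: rat"
  shows "\<bar>y\<bar> \<ge> 1 / 4" "j > k \<Longrightarrow> \<bar>y\<bar> \<le> of_nat (j - k)" "j \<le> k \<Longrightarrow> \<bar>y\<bar> \<le> of_nat (Suc (k - j))"
proof -
  show "j > k \<Longrightarrow> \<bar>y\<bar> \<le> of_nat (j - k)" "j \<le> k \<Longrightarrow> \<bar>y\<bar> \<le> of_nat (Suc (k - j))"
    by (auto simp: y_def of_nat_diff)
  show "\<bar>y\<bar> \<ge> 1 / 4"
  proof (cases "j > k")
    case True
    hence "(of_nat j :: rat) \<ge> of_nat (Suc k)" by (simp only: of_nat_le_iff)
    thus ?thesis by (simp add: y_def)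
  next
    case False
    hence "(of_nat j :: rat) \<le> of_nat k" by (simp only: of_nat_le_iff)
    thus ?thesis by (simp add: y_def)
  qed
qed

text \<open>Each of the 2 n factors, normalised to constant term 1, has rate 4. The constants
  balance: the offsets -(k + 1/4) + j are bounded in size by k, ..., 1 and 1, ..., n - k, so their
  product is at most k! (n - k)!, the product of the distances between the poles.\<close>

lemma fps_bound_expansion:
  assumes k: "k \<le> n"
  shows "fps_bound 1 (8 * of_nat n) (expansion n k)"
proof -
  define y where "y = (\<lambda>j. - (of_nat k + 1 / 4) + of_nat j :: rat)"
  define c where "c = (\<lambda>k'. of_nat k' - of_nat k :: rat)"
  have y: "\<bar>y j\<bar> \<ge> 1 / 4" for j unfolding y_def by (rule quarter_offset_abs)
  have y0: "y j \<noteq> 0" for j using y[of j] by auto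
  have c: "\<bar>c k'\<bar> \<ge> 1" if "k' \<noteq> k" for k'
  proof -
    have "c k' = of_int (int k' - int k)" by (simp add: c_def)
    moreover have "\<bar>int k' - int k\<bar> \<ge> 1" using that by auto
    ultimately show ?thesis by (metis of_int_1_le_iff of_int_abs)
  qed
  define Y C where "Y = (\<Prod>j=1..n. y j)" and "C = (\<Prod>k'\<in>{..n} - {k}. c k')"
  have Ceq: "C = (- 1) ^ k * fact k * fact (n - k)"
    unfolding C_def c_def by (rule prod_pole_differences[OF k])
  have C0: "C \<noteq> 0" unfolding Ceq by simp
  have "fps_const C * pole_inverses n k = (\<Prod>k'\<in>{..n} - {k}. fps_const (c k') * inverse (lin (c k')))"
    unfolding pole_inverses_def C_def c_def by (simp add: prod.distrib fps_const_prod)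
  from this[symmetric] have p: "pole_inverses n k = fps_const (1 / C) * (\<Prod>k'\<in>{..n} - {k}. fps_const (c k') * inverse (lin (c k')))"
    using C0 by (simp flip: mult.assoc)
  have z: "(\<Prod>j=1..n. lin (y j)) = fps_const Y * (\<Prod>j=1..n. 1 + fps_const (1 / y j) * fps_X)"
    unfolding Y_def fps_const_prod[symmetric] prod.distrib[symmetric]
    by (intro prod.cong refl lin_eq y0)
  have "\<bar>Y\<bar> \<le> \<bar>C\<bar>"
  proof -
    have "{1..n} = {1..k} \<union> {k+1..n}" using k by auto
    moreover have "(\<Prod>j\<in>{1..k} \<union> {k+1..n}. \<bar>y j\<bar>) = (\<Prod>j=1..k. \<bar>y j\<bar>) * (\<Prod>j=k+1..n. \<bar>y j\<bar>)"
      by (rule prod.union_disjoint) auto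
    ultimately have "\<bar>Y\<bar> = (\<Prod>j=1..k. \<bar>y j\<bar>) * (\<Prod>j=k+1..n. \<bar>y j\<bar>)"
      unfolding Y_def abs_prod by metis
    also have "\<dots> \<le> (\<Prod>j=1..k. of_nat (Suc (k - j))) * (\<Prod>j=k+1..n. of_nat (j - k))"
      by (intro mult_mono prod_mono prod_nonneg conjI)
         (auto simp: y_def intro!: quarter_offset_abs(2,3)[unfolded y_def])
    also have "(\<Prod>j=1..k. of_nat (Suc (k - j)) :: rat) = (\<Prod>i=1..k. of_nat i)"
      by (rule prod.reindex_bij_witness[of _ "\<lambda>i. Suc k - i" "\<lambda>j. Suc k - j"]) (auto simp: Suc_diff_le)
    also have "(\<Prod>j=k+1..n. of_nat (j - k) :: rat) = (\<Prod>i=1..n-k. of_nat i)"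
      using k by (intro prod.reindex_bij_witness[of _ "\<lambda>i. i + k" "\<lambda>i. i - k"]) auto
    also have "(\<Prod>i=1..k. of_nat i) * (\<Prod>i=1..n-k. of_nat i) = \<bar>C\<bar>"
      unfolding Ceq by (simp add: abs_mult) (simp add: fact_prod)
    finally show ?thesis .
  qed
  hence YC: "\<bar>Y / C\<bar> \<le> 1" using C0 by (simp add: abs_divide divide_le_eq)
  have e: "expansion n k = fps_const (Y / C) * ((\<Prod>j=1..n. 1 + fps_const (1 / y j) * fps_X) * (\<Prod>k'\<in>{..n} - {k}. fps_const (c k') * inverse (lin (c k'))))"
  proof -
    have "expansion n k = (\<Prod>j=1..n. lin (y j)) * pole_inverses n k" by (simp add: expansion_def y_def)
    also have "fps_const (Y / C) = fps_const Y * fps_const (1 / C)" by simp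
    ultimately show ?thesis unfolding z p by (simp only: mult_ac)
  qed
  have 1: "fps_bound 1 (of_nat (card {1..n}) * 4) (\<Prod>j=1..n. 1 + fps_const (1 / y j) * fps_X)"
    by (intro fps_bound_prod fps_bound_linear y) auto
  have 2: "fps_bound 1 (of_nat (card ({..n} - {k})) * 4) (\<Prod>k'\<in>{..n} - {k}. fps_const (c k') * inverse (lin (c k')))"
    using c by (intro fps_bound_prod fps_bound_inverse_linear) (force intro: order.trans[of _ 1])+
  have "card ({..n} - {k}) = n" using k by simp
  with fps_bound_mult[OF fps_bound_const[OF YC] fps_bound_mult[OF 1 2]] show ?thesis
    unfolding e by (simp add: algebra_simps del: One_nat_def)
qed

section \<open>Further Lipschitz functions\<close>

lemma lipschitz2_sum: "(\<And>i. i \<in> A \<Longrightarrow> lipschitz2 (f i)) \<Longrightarrow> lipschitz2 (\<lambda>k. \<Sum>i\<in>A. f i k)"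
  by (induction A rule: infinite_finite_induct) (auto intro: lipschitz2_add lipschitz2_const)

lemma lipschitz2_mult_const: "lipschitz2 f \<Longrightarrow> abs2_rat c \<le> 1 \<Longrightarrow> lipschitz2 (\<lambda>k. c * f k)"
  by (intro lipschitz2_mult lipschitz2_const)

lemma lipschitz2_of_nat: "lipschitz2 of_nat"
  by (auto simp: lipschitz2_def abs2_rat_of_nat_le_1)

lemma lipschitz2_inverse:
  assumes "lipschitz2 f" "\<And>k. abs2_rat (f k) = 1"
  shows "lipschitz2 (\<lambda>k. inverse (f k))"
  unfolding lipschitz2_def
proof (intro conjI allI)
  show "abs2_rat (inverse (f k)) \<le> 1" for k using assms(2) by (simp add: abs2_rat_inverse)
  fix k N
  have nz: "f i \<noteq> 0" for i using assms(2)[of i] by auto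
  have "inverse (f (k + 2 ^ N)) - inverse (f k) = - (f (k + 2 ^ N) - f k) * (inverse (f k) * inverse (f (k + 2 ^ N)))"
    using nz[of k] nz[of "k + 2 ^ N"] by (simp add: field_simps)
  also have "abs2_rat \<dots> = abs2_rat (f (k + 2 ^ N) - f k)"
    using assms(2) by (simp add: abs2_rat_mult abs2_rat_inverse abs2_rat_minus_commute)
  also have "\<dots> \<le> 1 / 2 ^ N" using assms(1) by (auto simp: lipschitz2_def)
  finally show "abs2_rat (inverse (f (k + 2 ^ N)) - inverse (f k)) \<le> 1 / 2 ^ N" .
qed

subsection \<open>Lipschitz families of power series\<close>

definition fps_lipschitz2 :: "(nat \<Rightarrow> rat fps) \<Rightarrow> bool" where
  "fps_lipschitz2 F \<longleftrightarrow> (\<forall>j. lipschitz2 (\<lambda>k. F k $ j))"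

lemma fps_lipschitz2_add: "fps_lipschitz2 F \<Longrightarrow> fps_lipschitz2 G \<Longrightarrow> fps_lipschitz2 (\<lambda>k. F k + G k)"
  by (auto simp: fps_lipschitz2_def intro: lipschitz2_add)

lemma fps_lipschitz2_mult: "fps_lipschitz2 F \<Longrightarrow> fps_lipschitz2 G \<Longrightarrow> fps_lipschitz2 (\<lambda>k. F k * G k)"
  by (auto simp: fps_lipschitz2_def fps_mult_nth intro!: lipschitz2_sum lipschitz2_mult)

lemma fps_lipschitz2_const: "abs2_rat c \<le> 1 \<Longrightarrow> fps_lipschitz2 (\<lambda>_. fps_const c)"
  by (auto simp: fps_lipschitz2_def intro!: lipschitz2_const)

lemma fps_lipschitz2_1: "fps_lipschitz2 (\<lambda>_. 1)"
  using fps_lipschitz2_const[of 1] by simp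

lemma fps_lipschitz2_power: "fps_lipschitz2 F \<Longrightarrow> fps_lipschitz2 (\<lambda>k. F k ^ n)"
  by (induction n) (auto intro: fps_lipschitz2_mult fps_lipschitz2_1)

lemma fps_lipschitz2_prod: "(\<And>i. i \<in> A \<Longrightarrow> fps_lipschitz2 (F i)) \<Longrightarrow> fps_lipschitz2 (\<lambda>k. \<Prod>i\<in>A. F i k)"
  by (induction A rule: infinite_finite_induct) (auto intro: fps_lipschitz2_mult fps_lipschitz2_1)

lemma fps_lipschitz2_lin: "fps_lipschitz2 (\<lambda>k. lin (of_nat k))"
  unfolding fps_lipschitz2_def
proof
  fix j show "lipschitz2 (\<lambda>k. lin (of_nat k) $ j)"
    by (cases "j = 0") (auto simp: lin_nth intro: lipschitz2_of_nat lipschitz2_const)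
qed

lemma fps_lipschitz2_affine:
  assumes "abs2_rat c \<le> 1" "abs2_rat d \<le> 1"
  shows "fps_lipschitz2 (\<lambda>k. fps_const c + fps_const d * lin (of_nat k))"
  by (intro fps_lipschitz2_add fps_lipschitz2_mult fps_lipschitz2_const fps_lipschitz2_lin assms)

text \<open>The coefficients of the inverse obey a recursion in which only the constant term is
  inverted, and that is a unit.\<close>

lemma fps_lipschitz2_inverse:
  assumes F: "fps_lipschitz2 F" and u: "\<And>k. abs2_rat (F k $ 0) = 1"
  shows "fps_lipschitz2 (\<lambda>k. inverse (F k))"
proof -
  have inv: "lipschitz2 (\<lambda>k. inverse (F k $ 0))"
    using F by (intro lipschitz2_inverse u) (auto simp: fps_lipschitz2_def)
  have nz: "F k $ 0 \<noteq> 0" for k using u[of k] by auto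
  have "lipschitz2 (\<lambda>k. inverse (F k) $ j)" for j
  proof (induction j rule: less_induct)
    case (less j)
    show ?case
    proof (cases j)
      case (Suc i)
      have rec: "inverse (F k) $ j = (- 1) * (inverse (F k $ 0) * (\<Sum>l=1..j. F k $ l * inverse (F k) $ (j - l)))" for k
      proof -
        have "(F k * inverse (F k)) $ j = 0"
          using nz[of k] Suc by (simp add: inverse_mult_eq_1')
        hence "F k $ 0 * inverse (F k) $ j + (\<Sum>l=1..j. F k $ l * inverse (F k) $ (j - l)) = 0"
          unfolding fps_mult_nth by (subst (asm) sum.atLeast_Suc_atMost) auto
        thus ?thesis using nz[of k] by (simp add: field_simps eq_neg_iff_add_eq_0)
      qed
      show ?thesis unfolding rec
        using F less by (intro lipschitz2_mult_const lipschitz2_mult inv lipschitz2_sum)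
          (auto simp: fps_lipschitz2_def)
    qed (use inv in simp)
  qed
  thus ?thesis by (simp add: fps_lipschitz2_def)
qed

text \<open>The quotient D has to be Lipschitz too, so that its Riemann means are at most 2. Then 4
  D contributes at most 1/2, strictly less than a main term of size 1.\<close>

definition mod4 :: "(nat \<Rightarrow> rat fps) \<Rightarrow> (nat \<Rightarrow> rat fps) \<Rightarrow> bool" where
  "mod4 F G \<longleftrightarrow> fps_lipschitz2 G \<and> (\<exists>D. fps_lipschitz2 D \<and> (\<forall>k. F k = G k + fps_const 4 * D k))"

lemma mod4I: "fps_lipschitz2 G \<Longrightarrow> fps_lipschitz2 D \<Longrightarrow> (\<And>k. F k = G k + fps_const 4 * D k) \<Longrightarrow> mod4 F G"
  by (auto simp: mod4_def)

lemma mod4_refl: "fps_lipschitz2 F \<Longrightarrow> mod4 F F"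
  using fps_lipschitz2_const[of 0] by (intro mod4I[of F "\<lambda>_. 0"]) simp_all

lemma mod4_mult:
  assumes "mod4 F G" "mod4 F' G'"
  shows "mod4 (\<lambda>k. F k * F' k) (\<lambda>k. G k * G' k)"
proof -
  obtain D D' where D: "fps_lipschitz2 D" "\<And>k. F k = G k + fps_const 4 * D k"
    and D': "fps_lipschitz2 D'" "\<And>k. F' k = G' k + fps_const 4 * D' k"
    and G: "fps_lipschitz2 G" "fps_lipschitz2 G'" using assms by (auto simp: mod4_def)
  have "fps_lipschitz2 (\<lambda>k. D k * G' k + (G k * D' k + fps_const 4 * (D k * D' k)))"
    by (intro fps_lipschitz2_add fps_lipschitz2_mult fps_lipschitz2_const D D' G) simp
  thus ?thesis
    by (rule mod4I[rotated]) (use G in \<open>auto simp: D(2) D'(2) algebra_simps intro: fps_lipschitz2_mult\<close>)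
qed

lemma mod4_power: "mod4 F G \<Longrightarrow> mod4 (\<lambda>k. F k ^ n) (\<lambda>k. G k ^ n)"
  by (induction n) (auto intro: mod4_mult mod4_refl fps_lipschitz2_1)

lemma mod4_prod: "(\<And>i. i \<in> A \<Longrightarrow> mod4 (F i) (G i)) \<Longrightarrow> mod4 (\<lambda>k. \<Prod>i\<in>A. F i k) (\<lambda>k. \<Prod>i\<in>A. G i k)"
  by (induction A rule: infinite_finite_induct) (auto intro: mod4_mult mod4_refl fps_lipschitz2_1)

lemma mod4_trans:
  assumes "mod4 F G" "mod4 G H"
  shows "mod4 F H"
proof -
  obtain D D' where D: "fps_lipschitz2 D" "\<And>k. F k = G k + fps_const 4 * D k"
    and D': "fps_lipschitz2 D'" "\<And>k. G k = H k + fps_const 4 * D' k"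
    and H: "fps_lipschitz2 H" using assms by (auto simp: mod4_def)
  show ?thesis
    by (rule mod4I[OF H fps_lipschitz2_add[OF D'(1) D(1)]]) (simp add: D(2) D'(2) algebra_simps)
qed

lemma mod4_power_one_plus:
  assumes "fps_lipschitz2 T"
  shows "mod4 (\<lambda>k. (1 + fps_const 2 * T k) ^ r) (\<lambda>k. 1 + fps_const (2 * of_nat r) * T k)"
proof (induction r)
  case 0
  show ?case using mod4_refl[OF fps_lipschitz2_1] by simp
next
  case (Suc r)
  have two: "abs2_rat (2 * of_nat i) \<le> 1" for i
    using abs2_rat_of_nat_le_1[of "2 * i"] by simp
  have L: "fps_lipschitz2 (\<lambda>k. 1 + fps_const (2 * of_nat i) * T k)" for i
    by (intro fps_lipschitz2_add fps_lipschitz2_1 fps_lipschitz2_mult fps_lipschitz2_const assms two)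
  have "mod4 (\<lambda>k. (1 + fps_const 2 * T k) * (1 + fps_const 2 * T k) ^ r)
      (\<lambda>k. (1 + fps_const 2 * T k) * (1 + fps_const (2 * of_nat r) * T k))"
    using L[of 1] by (intro mod4_mult mod4_refl Suc) simp
  moreover have "mod4 (\<lambda>k. (1 + fps_const 2 * T k) * (1 + fps_const (2 * of_nat r) * T k)) (\<lambda>k. 1 + fps_const (2 * of_nat (Suc r)) * T k)"
  proof (rule mod4I[OF L])
    show "fps_lipschitz2 (\<lambda>k. fps_const (of_nat r) * (T k * T k))"
      by (intro fps_lipschitz2_mult fps_lipschitz2_const assms abs2_rat_of_nat_le_1)
    fix k
    have e: "fps_const (2 * of_nat r) = fps_const 2 * fps_const (of_nat r :: rat)"
      "fps_const (2 * of_nat (Suc r)) = fps_const 2 + fps_const 2 * fps_const (of_nat r :: rat)"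
      "fps_const 4 = fps_const 2 * (fps_const 2 :: rat fps)" by (simp_all add: algebra_simps)
    show "(1 + fps_const 2 * T k) * (1 + fps_const (2 * of_nat r) * T k) =
        1 + fps_const (2 * of_nat (Suc r)) * T k + fps_const 4 * (fps_const (of_nat r) * (T k * T k))"
      unfolding e by (simp only: algebra_simps mult_1 mult_1_right)
  qed
  ultimately show ?case unfolding power_Suc by (rule mod4_trans)
qed

subsection \<open>The 2-adic size of the integral\<close>

text \<open>The coefficient \<open>[\<epsilon>^s]\<close> of \<open>R (t + \<epsilon>)\<close> is \<open>R\<^bsup>(s)\<^esup> t / s!\<close>.\<close>

definition rat_fun :: "nat \<Rightarrow> nat \<Rightarrow> nat \<Rightarrow> rat \<Rightarrow> rat fps" where
  "rat_fun n r s t = lin t ^ s * (\<Prod>j=1..n. lin (t + of_nat j)) ^ r * (\<Prod>k\<in>{..n}. inverse (lin (t + (of_nat k + 1 / 4)))) ^ r"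

lemma lin_compose: "lin y oo (fps_const c * fps_X) = fps_const y + fps_const c * fps_X"
  by (simp add: lin_def fps_compose_add_distrib)

lemma rat_fun_compose:
  assumes "t \<ge> 0"
  shows "rat_fun n r s t oo (fps_const c * fps_X) =
    (fps_const t + fps_const c * fps_X) ^ s * (\<Prod>j=1..n. fps_const (t + of_nat j) + fps_const c * fps_X) ^ r
     * (\<Prod>k\<in>{..n}. inverse (fps_const (t + (of_nat k + 1 / 4)) + fps_const c * fps_X)) ^ r"
proof -
  have c0: "(fps_const c * fps_X) $ 0 = 0" by simp
  have nz: "t + (of_nat k + 1 / 4) \<noteq> 0" for k
  proof -
    have "t + (of_nat k + 1 / 4) > 0" using assms by (intro add_nonneg_pos add_nonneg_pos) auto
    thus ?thesis by simp
  qed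
  show ?thesis unfolding rat_fun_def
    by (simp add: fps_compose_mult_distrib[OF c0] fps_compose_power[OF c0, symmetric]
        fps_compose_prod_distrib[OF c0] fps_inverse_compose[OF c0] lin_compose nz)
qed

text \<open>The product over the zeros at t = b + 2^a (k + X), with the constants b + j pulled out.
  \<open>den_family\<close> does the same for the poles, with a factor 4 pulled out of each inverse;
  the denominators that remain have odd constant terms.\<close>

definition num_family :: "nat \<Rightarrow> nat \<Rightarrow> nat \<Rightarrow> nat \<Rightarrow> rat fps" where
  "num_family a n b k = (\<Prod>j=1..n. 1 + fps_const (2 ^ a / of_nat (b + j)) * lin (of_nat k))"

definition den_family :: "nat \<Rightarrow> nat \<Rightarrow> nat \<Rightarrow> nat \<Rightarrow> rat fps" where
  "den_family a n b k = (\<Prod>i\<in>{..n}. inverse (fps_const (of_nat (4 * (b + i) + 1)) + fps_const (4 * 2 ^ a) * lin (of_nat k)))"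

lemma fps_lipschitz2_den_family: "fps_lipschitz2 (den_family a n b)"
  unfolding den_family_def
proof (intro fps_lipschitz2_prod fps_lipschitz2_inverse fps_lipschitz2_affine)
  show "abs2_rat (of_nat (4 * (b + i) + 1)) \<le> 1" for i by (rule abs2_rat_of_nat_le_1)
  show "abs2_rat (4 * 2 ^ a) \<le> 1" using abs2_rat_of_nat_le_1[of "4 * 2 ^ a"] by simp
  show "abs2_rat ((fps_const (of_nat (4 * (b + i) + 1)) + fps_const (4 * 2 ^ a) * lin (of_nat k)) $ 0) = 1" for i k
  proof -
    have "(fps_const (of_nat (4 * (b + i) + 1)) + fps_const (4 * 2 ^ a) * lin (of_nat k)) $ 0 =
        (of_nat (4 * (b + i + 2 ^ a * k) + 1) :: rat)"
      by (simp add: algebra_simps)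
    thus ?thesis by (simp only: abs2_rat_4k1)
  qed
qed

lemma affine_eq:
  "fps_const c * (fps_const u + fps_const e * lin y) = fps_const (c * u + c * e * y) + fps_const (c * e) * fps_X"
  by (rule fps_ext) (simp add: lin_nth algebra_simps)

text \<open>Scaling the formal variable by 2^a lets it enter only through the sum k + X, so every
  factor is affine in \<open>lin (of_nat k)\<close>.\<close>

lemma rat_fun_scaled:
  "rat_fun n r s (of_nat (b + 2 ^ a * k)) oo (fps_const (2 ^ a) * fps_X) =
    (fps_const (of_nat b) + fps_const (2 ^ a) * lin (of_nat k)) ^ s *
    (fps_const ((\<Prod>j=1..n. of_nat (b + j)) ^ r * (4 ^ (n + 1)) ^ r) * (num_family a n b k ^ r * den_family a n b k ^ r))"
proof -
  have "fps_const (of_nat (b + 2 ^ a * k) + of_nat j) + fps_const (2 ^ a) * fps_X =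
      fps_const (of_nat (b + j)) * (1 + fps_const (2 ^ a / of_nat (b + j)) * lin (of_nat k) :: rat fps)" if "j \<ge> 1" for j
  proof -
    have "(of_nat (b + j) :: rat) \<noteq> 0" using that by (subst of_nat_eq_0_iff) simp
    hence "of_nat (b + j) * (2 ^ a / of_nat (b + j)) = (2 ^ a :: rat)" by simp
    moreover have "of_nat (b + 2 ^ a * k) + of_nat j = (of_nat (b + j) * 1 + 2 ^ a * of_nat k :: rat)" by simp
    ultimately show ?thesis using affine_eq[of "of_nat (b + j)" 1 "2 ^ a / of_nat (b + j)" "of_nat k"]
      by (simp only: fps_const_1_eq_1)
  qed
  hence 1: "(\<Prod>j=1..n. fps_const (of_nat (b + 2 ^ a * k) + of_nat j) + fps_const (2 ^ a) * fps_X) =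
      fps_const (\<Prod>j=1..n. of_nat (b + j)) * num_family a n b k"
    unfolding num_family_def fps_const_prod[symmetric] prod.distrib[symmetric]
    by (intro prod.cong refl) auto
  have "inverse (fps_const (of_nat (b + 2 ^ a * k) + (of_nat i + 1 / 4)) + fps_const (2 ^ a) * fps_X) =
      fps_const 4 * inverse (fps_const (of_nat (4 * (b + i) + 1)) + fps_const (4 * 2 ^ a) * lin (of_nat k) :: rat fps)" for i
  proof -
    have "of_nat (b + 2 ^ a * k) + (of_nat i + 1 / 4) = (1 / 4 * of_nat (4 * (b + i) + 1) + 1 / 4 * (4 * 2 ^ a) * of_nat k :: rat)"
      by (simp add: field_simps)
    moreover have "1 / 4 * (4 * 2 ^ a) = (2 ^ a :: rat)" by simp
    ultimately have "fps_const (of_nat (b + 2 ^ a * k) + (of_nat i + 1 / 4)) + fps_const (2 ^ a) * fps_X =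
        fps_const (1 / 4) * (fps_const (of_nat (4 * (b + i) + 1)) + fps_const (4 * 2 ^ a) * lin (of_nat k) :: rat fps)"
      by (simp only: affine_eq)
    thus ?thesis by (simp only: fps_inverse_mult fps_const_inverse) simp
  qed
  hence "(\<Prod>i\<in>{..n}. inverse (fps_const (of_nat (b + 2 ^ a * k) + (of_nat i + 1 / 4)) + fps_const (2 ^ a) * fps_X)) =
      (\<Prod>i\<in>{..n}. fps_const 4) * den_family a n b k"
    unfolding den_family_def prod.distrib[symmetric] by simp
  hence 2: "(\<Prod>i\<in>{..n}. inverse (fps_const (of_nat (b + 2 ^ a * k) + (of_nat i + 1 / 4)) + fps_const (2 ^ a) * fps_X)) =
      fps_const (4 ^ (n + 1)) * den_family a n b k"
    unfolding fps_const_prod by simp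
  have 3: "fps_const (of_nat (b + 2 ^ a * k)) + fps_const (2 ^ a) * fps_X = (fps_const (of_nat b) + fps_const (2 ^ a) * lin (of_nat k) :: rat fps)"
    using affine_eq[of 1 "of_nat b" "2 ^ a" "of_nat k"] by simp
  show ?thesis
    unfolding rat_fun_compose[OF of_nat_0_le_iff] 1 2 3
    by (simp only: power_mult_distrib fps_const_mult[symmetric] fps_const_power[symmetric] mult_ac)
qed

section \<open>Valuations below a power of 2, and the residue classes\<close>

lemma abs2_rat_of_nat_less_power2:
  assumes "0 < b" "b < 2 ^ a"
  obtains m where "m < a" "2 ^ m dvd b" "abs2_rat (of_nat b) = 1 / 2 ^ m"
proof
  define m where "m = multiplicity 2 (int b)"
  have d: "int (2 ^ m) dvd int b" unfolding m_def using multiplicity_dvd[of 2 "int b"] by simp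
  thus "2 ^ m dvd b" by (simp only: int_dvd_int_iff)
  hence "2 ^ m \<le> b" using assms(1) by (rule dvd_imp_le)
  hence "(2 :: nat) ^ m < 2 ^ a" using assms(2) by (rule le_less_trans)
  thus "m < a" by simp
  show "abs2_rat (of_nat b) = 1 / 2 ^ m"
    using abs2_rat_of_int[of "int b"] assms by (simp add: m_def)
qed

lemma abs2_rat_of_nat_ge:
  assumes "0 < b" "b < 2 ^ a"
  shows "abs2_rat (of_nat b) \<ge> 2 / 2 ^ a"
proof -
  obtain m where m: "m < a" "abs2_rat (of_nat b) = 1 / 2 ^ m"
    using abs2_rat_of_nat_less_power2[OF assms] by blast
  hence "2 / 2 ^ a \<le> 2 / (2 :: real) ^ Suc m" by (intro divide_left_mono power_increasing) auto
  thus ?thesis using m by simp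
qed

text \<open>2^(a - 1) is the only positive integer below 2^a with valuation a - 1.\<close>

lemma abs2_rat_of_nat_ge':
  assumes "0 < b" "b < 2 ^ a" "b \<noteq> 2 ^ (a - 1)"
  shows "abs2_rat (of_nat b) \<ge> 4 / 2 ^ a"
proof -
  obtain m where m: "m < a" "2 ^ m dvd b" "abs2_rat (of_nat b) = 1 / 2 ^ m"
    using abs2_rat_of_nat_less_power2[OF assms(1,2)] by blast
  have "m \<noteq> a - 1"
  proof
    assume e: "m = a - 1"
    obtain c where c: "b = 2 ^ m * c" using m(2) by (elim dvdE)
    have "b < 2 * 2 ^ m" using assms(2) m(1) unfolding e by (cases a) auto
    hence "c < 2" "c \<noteq> 0" using assms(1) unfolding c by simp_all
    thus False using assms(3) c e by (simp add: less_2_cases_iff)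
  qed
  hence "4 / 2 ^ a \<le> 4 / (2 :: real) ^ (m + 2)" using m by (intro divide_left_mono power_increasing) auto
  thus ?thesis using m by simp
qed

text \<open>The range 2^(a+1) is wide enough for the sums b + j with b, j \<le> n < 2^a.\<close>

lemma abs2_rat_power2_divide_le:
  assumes "0 < b" "b < 2 ^ Suc a"
  shows "abs2_rat (2 ^ a / of_nat b) \<le> 1"
proof -
  have "1 / 2 ^ a \<le> abs2_rat (of_nat b)" using abs2_rat_of_nat_ge[OF assms] by simp
  moreover have "abs2_rat (of_nat b) > 0" using assms(1) by (simp add: order.not_eq_order_implies_strict)
  ultimately show ?thesis by (simp add: abs2_rat_divide pos_divide_le_eq mult.commute)
qed

lemma fps_lipschitz2_num_family:
  assumes "n < 2 ^ a" "b \<le> n"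
  shows "fps_lipschitz2 (num_family a n b)"
  unfolding num_family_def
proof (intro fps_lipschitz2_prod)
  fix j assume "j \<in> {1..n}"
  hence "abs2_rat (2 ^ a / of_nat (b + j)) \<le> 1"
    using assms by (intro abs2_rat_power2_divide_le) auto
  from fps_lipschitz2_affine[OF _ this, of 1]
  show "fps_lipschitz2 (\<lambda>k. 1 + fps_const (2 ^ a / of_nat (b + j)) * lin (of_nat k))" by simp
qed

lemma prod_add_binomial: "(\<Prod>j=1..n. of_nat (b + j)) = (fact n * of_nat ((n + b) choose b) :: rat)"
proof -
  have "(fact (n + b) :: rat) = fact b * (\<Prod>j=1..n. of_nat (b + j))"
    by (induction n) (simp_all add: algebra_simps)
  thus ?thesis by (simp add: binomial_fact)
qed

text \<open>The product is n! times (n + b) choose b. Since b * ((n + b) choose b) is n + 1 = 2^a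
  times an integer, this binomial is at least as divisible by 2 as 2^a / b. The choice n = 2^a - 1
  thus makes the classes b > 0 small.\<close>

lemma abs2_prod_add_le:
  assumes n: "n + 1 = 2 ^ a" and b: "0 < b"
  shows "abs2_rat (\<Prod>j=1..n. of_nat (b + j)) \<le> abs2_rat (fact n) * (1 / (2 ^ a * abs2_rat (of_nat b)))"
proof -
  obtain c where c: "b = Suc c" using b by (cases b) auto
  have "of_nat b * of_nat ((n + b) choose b) = (of_nat (n + 1) * of_nat ((n + 1 + c) choose c) :: rat)"
  proof -
    have "n + 1 + c = n + b" unfolding c by simp
    moreover have "(of_nat ((n + b) choose b) :: rat) = fact (n + b) / (fact b * fact n)"
      "(of_nat ((n + b) choose c) :: rat) = fact (n + b) / (fact c * fact (n + 1))"
      using binomial_fact[of b "n + b", where ?'a = rat] binomial_fact[of c "n + b", where ?'a = rat] c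
      by (simp_all del: fact_Suc binomial_Suc_Suc)
    moreover have "(fact b :: rat) = of_nat b * fact c" "(fact (n + 1) :: rat) = of_nat (n + 1) * fact n"
      unfolding c by simp_all
    moreover have "B * (F / (B * C * G)) = M * (F / (C * (M * G)))" if "B \<noteq> 0" "M \<noteq> 0" for B C F G M :: rat
      using that by simp
    moreover have "(of_nat b :: rat) \<noteq> 0" "(of_nat (n + 1) :: rat) \<noteq> 0" using b by (simp_all del: of_nat_add)
    ultimately show ?thesis by (simp only:)
  qed
  hence "abs2_rat (of_nat b) * abs2_rat (of_nat ((n + b) choose b)) = 1 / 2 ^ a * abs2_rat (of_nat ((n + 1 + c) choose c))"
    unfolding n abs2_rat_mult[symmetric] by (simp add: abs2_rat_mult)
  also have "\<dots> \<le> 1 / 2 ^ a * 1" by (intro mult_left_mono abs2_rat_of_nat_le_1) auto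
  finally have "abs2_rat (of_nat b) * abs2_rat (of_nat ((n + b) choose b)) \<le> 1 / 2 ^ a" by simp
  moreover have "abs2_rat (of_nat b) > 0" using b by (simp add: order.not_eq_order_implies_strict)
  ultimately have "abs2_rat (of_nat ((n + b) choose b)) \<le> 1 / 2 ^ a / abs2_rat (of_nat b)"
    by (subst pos_le_divide_eq) (simp_all add: mult.commute)
  hence "abs2_rat (of_nat ((n + b) choose b)) \<le> 1 / (2 ^ a * abs2_rat (of_nat b))" by simp
  thus ?thesis unfolding prod_add_binomial abs2_rat_mult by (intro mult_left_mono) auto
qed

lemma lin_power_nth_gt: "j > m \<Longrightarrow> lin c ^ m $ j = 0"
proof (induction m arbitrary: j)
  case (Suc m)
  thus ?case by (cases j) (simp_all add: lin_def distrib_right)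
qed simp

lemma lin_power_nth_self: "lin c ^ m $ m = 1"
  by (induction m) (simp_all add: lin_def distrib_right lin_power_nth_gt[unfolded lin_def])

lemma lin_power_Suc_nth: "lin c ^ Suc m $ m = of_nat (Suc m) * c"
proof (induction m)
  case (Suc m)
  have "lin c ^ Suc (Suc m) $ Suc m = c * lin c ^ Suc m $ Suc m + lin c ^ Suc m $ m"
    by (subst power_Suc) (simp add: lin_def distrib_right del: power_Suc)
  thus ?case unfolding Suc lin_power_nth_self by (simp add: algebra_simps)
qed simp

text \<open>Among the numbers 2^a / j with 0 < j < 2^a all but one have valuation at least 2; the
  exception is 2, at j = 2^(a - 1).\<close>

lemma mod4_num_family_0:
  assumes "n + 1 = 2 ^ a" "a \<ge> 1"
  shows "mod4 (num_family a n 0) (\<lambda>k. 1 + fps_const 2 * lin (of_nat k))"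
proof -
  define G where "G = (\<lambda>(j :: nat) k. if j = 2 ^ (a - 1) then 1 + fps_const 2 * lin (of_nat k) else 1 :: rat fps)"
  obtain a' where a': "a = Suc a'" using assms(2) by (cases a) auto
  have "mod4 (num_family a n 0) (\<lambda>k. \<Prod>j=1..n. G j k)"
    unfolding num_family_def
  proof (intro mod4_prod)
    fix j assume j: "j \<in> {1..n}"
    show "mod4 (\<lambda>k. 1 + fps_const (2 ^ a / of_nat (0 + j)) * lin (of_nat k)) (G j)"
    proof (cases "j = 2 ^ (a - 1)")
      case True
      have "(2 ^ a / of_nat (0 + j) :: rat) = 2" by (simp add: True a')
      thus ?thesis using mod4_refl[OF fps_lipschitz2_affine[of 1 2]] unfolding G_def True by simp
    next
      case False
      have "abs2_rat (of_nat j) \<ge> 4 / 2 ^ a"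
        using j assms False by (intro abs2_rat_of_nat_ge') auto
      hence "4 \<le> 2 ^ a * abs2_rat (of_nat j)" by (simp add: pos_divide_le_eq mult.commute)
      hence "4 / (2 ^ a * abs2_rat (of_nat j)) \<le> 1" by (subst divide_le_eq_1_pos) auto
      hence "abs2_rat (2 ^ a / of_nat j / 4) \<le> 1" by (simp only: abs2_rat_divide abs2_rat_power2 abs2_rat_four) simp
      hence "fps_lipschitz2 (\<lambda>k. fps_const (2 ^ a / of_nat j / 4) * lin (of_nat k))"
        by (intro fps_lipschitz2_mult fps_lipschitz2_const fps_lipschitz2_lin)
      from mod4I[OF fps_lipschitz2_1 this] show ?thesis
        using False unfolding G_def by (simp flip: mult.assoc)
    qed
  qed
  moreover have "(\<Prod>j=1..n. G j k) = 1 + fps_const 2 * lin (of_nat k)" for k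
  proof -
    have "2 ^ a' \<in> {1..n}" using assms unfolding a' by auto
    thus ?thesis unfolding G_def using a' by (subst prod.delta) auto
  qed
  ultimately show ?thesis by simp
qed

lemma mod4_den_family_0:
  "mod4 (den_family a n 0) (\<lambda>_. fps_const (\<Prod>i\<in>{..n}. inverse (of_nat (4 * i + 1))))"
  unfolding den_family_def fps_const_prod[symmetric]
proof (intro mod4_prod)
  fix i
  define u :: rat where "u = of_nat (4 * (0 + i) + 1)"
  define V where "V = (\<lambda>k. fps_const u + fps_const (4 * 2 ^ a) * lin (of_nat k))"
  have u: "abs2_rat u = 1" unfolding u_def by (rule abs2_rat_4k1)
  have V0: "abs2_rat (V k $ 0) = 1" for k
  proof -
    have "V k $ 0 = of_nat (4 * (i + 2 ^ a * k) + 1)" by (simp add: V_def u_def algebra_simps)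
    thus ?thesis by (simp only: abs2_rat_4k1)
  qed
  have V: "fps_lipschitz2 V" unfolding V_def
    using u abs2_rat_of_nat_le_1[of "4 * 2 ^ a"] by (intro fps_lipschitz2_affine) auto
  have "abs2_rat (- (2 ^ a) / u) \<le> 1" using u by (simp add: abs2_rat_divide)
  hence D: "fps_lipschitz2 (\<lambda>k. fps_const (- (2 ^ a) / u) * (lin (of_nat k) * inverse (V k)))"
    by (intro fps_lipschitz2_mult fps_lipschitz2_const fps_lipschitz2_lin fps_lipschitz2_inverse V V0)
  have "fps_lipschitz2 (\<lambda>_. fps_const (inverse u))"
    using u by (intro fps_lipschitz2_const) (simp add: abs2_rat_inverse)
  moreover have "inverse (V k) = fps_const (inverse u) + fps_const 4 * (fps_const (- (2 ^ a) / u) * (lin (of_nat k) * inverse (V k)))" for k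
  proof -
    have u0: "u \<noteq> 0" using u by auto
    have "V k $ 0 \<noteq> 0" using V0[of k] by auto
    hence "V k * inverse (V k) = 1" by (simp add: inverse_mult_eq_1')
    hence "fps_const (inverse u) * (V k * inverse (V k)) = fps_const (inverse u)" by simp
    moreover have "fps_const (inverse u) * (V k * inverse (V k)) = inverse (V k) - fps_const 4 * (fps_const (- (2 ^ a) / u) * (lin (of_nat k) * inverse (V k)))"
    proof -
      have "fps_const (inverse u) * V k = 1 - fps_const 4 * (fps_const (- (2 ^ a) / u) * lin (of_nat k))"
        unfolding V_def distrib_left mult.assoc[symmetric] fps_const_mult
        using u0 by (simp add: divide_inverse mult_ac flip: fps_const_neg)
      thus ?thesis by (metis (no_types, lifting) left_diff_distrib mult.assoc mult_1)
    qed
    ultimately show ?thesis by (metis diff_add_cancel)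
  qed
  ultimately have "mod4 (\<lambda>k. inverse (V k)) (\<lambda>_. fps_const (inverse u))" using D by (rule_tac mod4I)
  thus "mod4 (\<lambda>k. inverse (fps_const (of_nat (4 * (0 + i) + 1)) + fps_const (4 * 2 ^ a) * lin (of_nat k))) (\<lambda>_. fps_const (inverse (of_nat (4 * i + 1))))"
    unfolding V_def u_def by simp
qed

lemma vol2_const_plus:
  "vol2 (\<lambda>k. c + d * f k) N = c + d * vol2 f N"
  by (simp add: vol2_def sum.distrib sum_distrib_left add_divide_distrib)

lemma vol2_split:
  "vol2 g (N + a) = (\<Sum>b<2 ^ a. vol2 (\<lambda>k. g (b + 2 ^ a * k)) N) / 2 ^ a"
proof -
  have "(\<Sum>t<2 ^ N * 2 ^ a. g t) = (\<Sum>k<2 ^ N. \<Sum>t=k * 2 ^ a..<k * 2 ^ a + 2 ^ a. g t)"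
    by (rule sum.nat_group[symmetric])
  also have "\<dots> = (\<Sum>k<2 ^ N. \<Sum>b<2 ^ a. g (b + 2 ^ a * k))"
  proof (rule sum.cong[OF refl])
    fix k :: nat
    show "(\<Sum>t=k * 2 ^ a..<k * 2 ^ a + 2 ^ a. g t) = (\<Sum>b<2 ^ a. g (b + 2 ^ a * k))"
      using sum.shift_bounds_nat_ivl[of g 0 "k * 2 ^ a" "2 ^ a"] by (simp add: atLeast0LessThan add_ac mult_ac)
  qed
  also have "\<dots> = (\<Sum>b<2 ^ a. \<Sum>k<2 ^ N. g (b + 2 ^ a * k))" by (rule sum.swap)
  finally show ?thesis
    by (simp add: vol2_def power_add sum_divide_distrib[symmetric] mult.commute)
qed

definition rat_coeff :: "nat \<Rightarrow> nat \<Rightarrow> nat \<Rightarrow> nat \<Rightarrow> rat" where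
  "rat_coeff n r s t = rat_fun n r s (of_nat t) $ s"

lemma rat_coeff_scaled:
  "2 ^ (a * s) * rat_coeff n r s (b + 2 ^ a * k) =
    ((fps_const (of_nat b) + fps_const (2 ^ a) * lin (of_nat k)) ^ s *
    (fps_const ((\<Prod>j=1..n. of_nat (b + j)) ^ r * (4 ^ (n + 1)) ^ r) * (num_family a n b k ^ r * den_family a n b k ^ r))) $ s"
  unfolding rat_fun_scaled[symmetric] fps_compose_linear by (simp add: rat_coeff_def power_mult)

text \<open>With A = |b|_2 and Q = |n! 4^(n+1)|_2 the constant of the class is at most Q^r (2^a
  A)^(s - r), where r - s = 2. As 0 < b < 2^a gives 2^a A \<ge> 2, this is at most Q^r / 4, and the
  Riemann mean gives back at most a factor 2.\<close>

lemma abs2_vol2_rat_coeff_pos_le: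
  assumes n: "n + 1 = 2 ^ a" and b: "0 < b" "b \<le> n"
  shows "abs2_rat (vol2 (\<lambda>k. rat_coeff n (s + 2) s (b + 2 ^ a * k)) N) \<le> abs2_rat (fact n * 4 ^ (n + 1)) ^ (s + 2) / 2"
proof -
  define r where "r = s + 2"
  define P :: rat where "P = (\<Prod>j=1..n. of_nat (b + j))"
  define A where "A = abs2_rat (of_nat b)"
  define f where "f = (\<lambda>k. ((1 + fps_const (2 ^ a / of_nat b) * lin (of_nat k)) ^ s * (num_family a n b k ^ r * den_family a n b k ^ r)) $ s)"
  have A: "A \<ge> 2 / 2 ^ a" unfolding A_def using n b by (intro abs2_rat_of_nat_ge) auto
  hence A0: "A > 0" by (rule less_le_trans[rotated]) simp
  have A2: "2 ^ a * A \<ge> 2" using A by (simp add: pos_divide_le_eq mult.commute)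
  have "abs2_rat (2 ^ a / of_nat b) \<le> 1"
    using n b by (intro abs2_rat_power2_divide_le) auto
  hence "fps_lipschitz2 (\<lambda>k. (1 + fps_const (2 ^ a / of_nat b) * lin (of_nat k)) ^ s * (num_family a n b k ^ r * den_family a n b k ^ r))"
    using n b by (intro fps_lipschitz2_mult fps_lipschitz2_power fps_lipschitz2_add fps_lipschitz2_1 fps_lipschitz2_const
      fps_lipschitz2_lin fps_lipschitz2_num_family fps_lipschitz2_den_family) auto
  hence lip: "lipschitz2 f" by (simp add: fps_lipschitz2_def f_def)
  define c where "c = of_nat b ^ s * (P * 4 ^ (n + 1)) ^ r / 2 ^ (a * s)"
  have "rat_coeff n r s (b + 2 ^ a * k) = c * f k" for k
  proof -
    have "fps_const (of_nat b) + fps_const (2 ^ a) * lin (of_nat k) = fps_const (of_nat b) * (1 + fps_const (2 ^ a / of_nat b) * lin (of_nat k) :: rat fps)"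
      using b by (simp add: distrib_left flip: mult.assoc)
    hence "2 ^ (a * s) * rat_coeff n r s (b + 2 ^ a * k) =
        (fps_const (of_nat b ^ s * (P * 4 ^ (n + 1)) ^ r) * ((1 + fps_const (2 ^ a / of_nat b) * lin (of_nat k)) ^ s * (num_family a n b k ^ r * den_family a n b k ^ r))) $ s"
      unfolding rat_coeff_scaled P_def[symmetric]
      by (simp only: power_mult_distrib fps_const_mult[symmetric] fps_const_power[symmetric] mult_ac)
    hence "2 ^ (a * s) * rat_coeff n r s (b + 2 ^ a * k) = of_nat b ^ s * (P * 4 ^ (n + 1)) ^ r * f k"
      unfolding fps_mult_left_const_nth f_def .
    thus ?thesis unfolding c_def times_divide_eq_left by (subst eq_divide_eq) (simp add: mult.commute)
  qed
  hence "vol2 (\<lambda>k. rat_coeff n r s (b + 2 ^ a * k)) N = c * vol2 f N"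
    using vol2_const_plus[of 0 c f N] by simp
  moreover have "abs2_rat (c * vol2 f N) \<le> (abs2_rat (fact n * 4 ^ (n + 1)) ^ r / 4) * 2"
  proof (rule abs2_rat_mult_le[OF _ abs2_vol2_le[OF lip]])
    define Q where "Q = abs2_rat (fact n * 4 ^ (n + 1))"
    have "abs2_rat (P * 4 ^ (n + 1)) \<le> abs2_rat (fact n) * (1 / (2 ^ a * A)) * abs2_rat (4 ^ (n + 1))"
      unfolding P_def A_def using n b by (intro abs2_rat_mult_le abs2_prod_add_le) auto
    hence le: "abs2_rat (P * 4 ^ (n + 1)) \<le> Q / (2 ^ a * A)" by (simp add: Q_def abs2_rat_mult)
    have "abs2_rat c = A ^ s * abs2_rat (P * 4 ^ (n + 1)) ^ r * 2 ^ (a * s)"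
      by (simp add: c_def A_def abs2_rat_mult abs2_rat_divide abs2_rat_power power_divide)
    also have "\<dots> \<le> A ^ s * (Q / (2 ^ a * A)) ^ r * 2 ^ (a * s)"
      using A0 le by (intro mult_right_mono mult_left_mono power_mono) auto
    also have "\<dots> = (2 ^ a * A) ^ s * (Q / (2 ^ a * A)) ^ r" by (simp add: power_mult_distrib power_mult)
    also have "\<dots> = Q ^ r * (1 / (2 ^ a * A)) ^ 2" using A0
      by (simp add: r_def power_divide power_add power2_eq_square mult_ac)
    also have "\<dots> \<le> Q ^ r * (1 / 2) ^ 2"
      using A2 by (intro mult_left_mono power_mono divide_left_mono) (auto simp: Q_def)
    finally show "abs2_rat c \<le> Q ^ r / 4" by (simp add: power2_eq_square)
  qed
  ultimately show ?thesis unfolding r_def by simp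
qed

text \<open>For b = 0 the factor t^s supplies the power 2^(a s) that the scaling costs. Modulo 4
  there remains, up to a unit, the coefficient of X^s in (k + X)^s (1 + 2 r (k + X)), which is 1 + 2
  r (s + 1) k.\<close>

lemma abs2_vol2_rat_coeff_zero:
  assumes n: "n + 1 = 2 ^ a" and a: "a \<ge> 1"
  shows "abs2_rat (vol2 (\<lambda>k. rat_coeff n (s + 2) s (0 + 2 ^ a * k)) N) = abs2_rat (fact n * 4 ^ (n + 1)) ^ (s + 2)"
proof -
  define r where "r = s + 2"
  define v :: rat where "v = (\<Prod>i\<in>{..n}. inverse (of_nat (4 * i + 1)))"
  have v: "abs2_rat v = 1"
    unfolding v_def abs2_rat_prod by (intro prod.neutral ballI) (simp only: abs2_rat_inverse abs2_rat_4k1, simp)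
  have den: "mod4 (\<lambda>k. den_family a n 0 k ^ r) (\<lambda>_. fps_const v ^ r)"
    unfolding v_def by (rule mod4_power[OF mod4_den_family_0])
  have "mod4 (\<lambda>k. lin (of_nat k) ^ s * (num_family a n 0 k ^ r * den_family a n 0 k ^ r))
      (\<lambda>k. lin (of_nat k) ^ s * ((1 + fps_const (2 * of_nat r) * lin (of_nat k)) * fps_const v ^ r))"
    by (intro mod4_mult mod4_refl fps_lipschitz2_power fps_lipschitz2_lin den
      mod4_trans[OF mod4_power[OF mod4_num_family_0[OF n a]] mod4_power_one_plus])
  then obtain D where D: "fps_lipschitz2 D" "\<And>k. lin (of_nat k) ^ s * (num_family a n 0 k ^ r * den_family a n 0 k ^ r) =
      lin (of_nat k) ^ s * ((1 + fps_const (2 * of_nat r) * lin (of_nat k)) * fps_const v ^ r) + fps_const 4 * D k"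
    unfolding mod4_def by blast
  \<comment> \<open>r (s + 1) = (s + 2) (s + 1) is a product of consecutive integers, so the term 2
    r (s + 1) k disappears modulo 4 and the main part does not depend on k.\<close>
  have "even (r * (s + 1))" by (simp add: r_def)
  then obtain e where e: "r * (s + 1) = 2 * e" by (elim evenE)
  define f where "f = (\<lambda>k. v ^ r * of_nat e * of_nat k + D k $ s)"
  have lip: "lipschitz2 f" unfolding f_def
  proof (intro lipschitz2_add lipschitz2_mult_const lipschitz2_of_nat)
    show "abs2_rat (v ^ r * of_nat e) \<le> 1"
      using abs2_rat_of_nat_le_1[of e] by (simp add: abs2_rat_mult abs2_rat_power v)
    show "lipschitz2 (\<lambda>k. D k $ s)" using D(1) by (simp add: fps_lipschitz2_def)
  qed
  define c where "c = (fact n * 4 ^ (n + 1)) ^ r * v ^ r"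
  define c' :: rat where "c' = (fact n * 4 ^ (n + 1)) ^ r * 4"
  have "rat_coeff n r s (0 + 2 ^ a * k) = c + c' * f k" for k
  proof -
    have "2 ^ (a * s) * rat_coeff n r s (0 + 2 ^ a * k) =
        (fps_const (2 ^ (a * s) * (fact n * 4 ^ (n + 1)) ^ r) * (lin (of_nat k) ^ s * (num_family a n 0 k ^ r * den_family a n 0 k ^ r))) $ s"
    proof -
      have "(\<Prod>j=1..n. of_nat (0 + j)) = (fact n :: rat)" by (simp add: fact_prod)
      thus ?thesis unfolding rat_coeff_scaled unfolding power_mult
        by (simp only: power_mult_distrib fps_const_mult[symmetric] fps_const_power[symmetric] mult_ac
          fps_const_0_eq_0 add_0_left of_nat_0)
    qed
    also have "\<dots> = 2 ^ (a * s) * (fact n * 4 ^ (n + 1)) ^ r *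
        (lin (of_nat k) ^ s * ((1 + fps_const (2 * of_nat r) * lin (of_nat k)) * fps_const v ^ r) + fps_const 4 * D k) $ s"
      unfolding D(2) fps_mult_left_const_nth ..
    also have "lin (of_nat k) ^ s * ((1 + fps_const (2 * of_nat r) * lin (of_nat k)) * fps_const v ^ r) =
        fps_const (v ^ r) * (lin (of_nat k) ^ s + fps_const (2 * of_nat r) * lin (of_nat k) ^ Suc s)"
      by (simp add: algebra_simps)
    also have "(fps_const (v ^ r) * (lin (of_nat k) ^ s + fps_const (2 * of_nat r) * lin (of_nat k) ^ Suc s) + fps_const 4 * D k) $ s
        = v ^ r * (1 + 2 * of_nat r * (of_nat (Suc s) * of_nat k)) + 4 * D k $ s"
      by (simp only: fps_add_nth fps_mult_left_const_nth lin_power_nth_self lin_power_Suc_nth)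
    also have "2 * of_nat r * (of_nat (Suc s) * of_nat k) = 2 * of_nat (r * (s + 1)) * (of_nat k :: rat)"
      by (simp add: algebra_simps)
    finally have "2 ^ (a * s) * rat_coeff n r s (0 + 2 ^ a * k) = 2 ^ (a * s) * (c + c' * f k)"
      unfolding e by (simp add: c_def c'_def f_def algebra_simps)
    thus ?thesis by simp
  qed
  hence "vol2 (\<lambda>k. rat_coeff n r s (0 + 2 ^ a * k)) N = c + c' * vol2 f N"
    using vol2_const_plus[of c c' f N] by simp
  moreover have "abs2_rat (c + c' * vol2 f N) = abs2_rat c"
  proof (rule abs2_rat_add_eq)
    define Q where "Q = abs2_rat (fact n * 4 ^ (n + 1)) ^ r"
    have "Q > 0" unfolding Q_def by (intro zero_less_power order.not_eq_order_implies_strict) auto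
    moreover have "abs2_rat (c' * vol2 f N) \<le> (Q * (1 / 4)) * 2"
      unfolding c'_def Q_def by (intro abs2_rat_mult_le abs2_vol2_le lip) (auto simp: abs2_rat_power)
    moreover have "abs2_rat c = Q" by (simp add: c_def Q_def abs2_rat_mult abs2_rat_power v)
    ultimately show "abs2_rat (c' * vol2 f N) < abs2_rat c" by simp
  qed
  moreover have "abs2_rat c = abs2_rat (fact n * 4 ^ (n + 1)) ^ r" by (simp add: c_def abs2_rat_mult abs2_rat_power v)
  ultimately show ?thesis unfolding r_def by simp
qed

text \<open>Class 0 strictly dominates all others, and the mean over the 2^a classes contributes the
  factor 2^a. The value is the same for every N and therefore passes to the limit.\<close>

theorem abs2_vol2_rat_coeff:
  assumes n: "n + 1 = 2 ^ a" and a: "a \<ge> 1"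
  shows "abs2_rat (vol2 (rat_coeff n (s + 2) s) (N + a)) = abs2_rat (fact n * 4 ^ (n + 1)) ^ (s + 2) * 2 ^ a"
proof -
  define w where "w = (\<lambda>b. vol2 (\<lambda>k. rat_coeff n (s + 2) s (b + 2 ^ a * k)) N)"
  define Q where "Q = abs2_rat (fact n * 4 ^ (n + 1)) ^ (s + 2)"
  have Q: "Q > 0" unfolding Q_def by (intro zero_less_power order.not_eq_order_implies_strict) auto
  have "abs2_rat (\<Sum>b<2 ^ a. w b) = Q"
  proof -
    have "(\<Sum>b<2 ^ a. w b) = w 0 + (\<Sum>b\<in>{..<2 ^ a} - {0}. w b)" by (intro sum.remove) auto
    also have "abs2_rat \<dots> = abs2_rat (w 0)"
    proof (rule abs2_rat_add_eq)
      have "abs2_rat (\<Sum>b\<in>{..<2 ^ a} - {0}. w b) \<le> Q / 2"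
        using Q unfolding w_def Q_def
        by (intro abs2_rat_sum_le abs2_vol2_rat_coeff_pos_le n) (auto simp: n[symmetric])
      thus "abs2_rat (\<Sum>b\<in>{..<2 ^ a} - {0}. w b) < abs2_rat (w 0)"
        using Q abs2_vol2_rat_coeff_zero[OF assms, of s N] by (simp add: w_def Q_def)
    qed
    also have "\<dots> = Q" unfolding w_def Q_def by (rule abs2_vol2_rat_coeff_zero[OF assms])
    finally show ?thesis .
  qed
  thus ?thesis unfolding vol2_split w_def[symmetric] Q_def[symmetric] by (simp add: abs2_rat_divide)
qed

section \<open>The 2-adic valuation of n!\<close>

lemma power2_mult_fact_dvd: "(2 :: nat) ^ m * fact m dvd fact (2 * m)"
proof (induction m)
  case (Suc m)
  have "(fact (2 * Suc m) :: nat) = 2 * Suc m * (Suc (2 * m) * fact (2 * m))" by (simp add: algebra_simps)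
  moreover have "(2 :: nat) ^ Suc m * fact (Suc m) = 2 * Suc m * (2 ^ m * fact m)" by (simp add: algebra_simps)
  ultimately show ?case using Suc by (metis dvd_mult mult_dvd_mono dvd_refl)
qed simp

text \<open>Doubling the argument repeatedly collects the exponents 1 + 2 + ... + 2^(a - 1) =
  n.\<close>

lemma power2_dvd_fact: "n + 1 = 2 ^ a \<Longrightarrow> (2 :: nat) ^ n dvd fact (2 ^ a)"
proof (induction a arbitrary: n)
  case (Suc a)
  define m :: nat where "m = 2 ^ a - 1"
  have m: "m + 1 = 2 ^ a" by (simp add: m_def)
  have "n = 2 ^ a + m" using Suc.prems m by simp
  hence "(2 :: nat) ^ n = 2 ^ (2 ^ a) * 2 ^ m" by (simp only: power_add)
  also have "\<dots> dvd 2 ^ (2 ^ a) * fact (2 ^ a)" using Suc.IH[OF m] by (intro mult_dvd_mono) auto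
  also have "\<dots> dvd fact (2 * 2 ^ a)" by (rule power2_mult_fact_dvd)
  finally show ?case by simp
qed simp

lemma abs2_fact_le:
  assumes "n + 1 = 2 ^ a"
  shows "abs2_rat (fact n) \<le> 2 ^ a / 2 ^ n"
proof -
  obtain c :: nat where c: "fact (2 ^ a) = 2 ^ n * c" using power2_dvd_fact[OF assms] by (elim dvdE)
  have "(fact (2 ^ a) :: nat) = 2 ^ a * fact n" unfolding assms[symmetric] by simp
  hence "2 ^ a * fact n = (of_nat (2 ^ n * c) :: rat)" unfolding c[symmetric] by (metis of_nat_fact of_nat_mult of_nat_numeral of_nat_power)
  hence "abs2_rat (2 ^ a) * abs2_rat (fact n) = 1 / 2 ^ n * abs2_rat (of_nat c)"
    unfolding abs2_rat_mult[symmetric] by (simp add: abs2_rat_mult)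
  also have "\<dots> \<le> 1 / 2 ^ n * 1" by (intro mult_left_mono abs2_rat_of_nat_le_1) auto
  finally show ?thesis by (simp add: field_simps)
qed

subsection \<open>The linear form\<close>

text \<open>The Taylor series of (t + k + 1/4)^r R(t) at its pole; the terms of order below r are
  the partial fraction coefficients.\<close>

definition local_coeffs :: "nat \<Rightarrow> nat \<Rightarrow> nat \<Rightarrow> nat \<Rightarrow> rat fps" where
  "local_coeffs n r s k = lin (- (of_nat k + 1 / 4)) ^ s * expansion n k ^ r"

text \<open>The coefficient of epsilon^s in (y + epsilon)^(-(r - i)) for y = (4 l + 1) / 4, except
  for the power of 4 l + 1, which is left to \<open>inv_pow\<close>.\<close>

definition weight :: "nat \<Rightarrow> nat \<Rightarrow> nat \<Rightarrow> rat" where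
  "weight r s i = (- 1) ^ s * of_nat ((r - i + s - 1) choose s) * 4 ^ (r - i + s)"

definition numerator_poly :: "nat \<Rightarrow> nat \<Rightarrow> nat \<Rightarrow> rat poly" where
  "numerator_poly n r s = [:0, 1:] ^ s * (\<Prod>j=1..n. [:of_nat j, 1:]) ^ r"

lemma shift_numerator_poly:
  "shift_fps t (numerator_poly n r s) = lin t ^ s * (\<Prod>j=1..n. lin (t + of_nat j)) ^ r"
  by (simp add: numerator_poly_def shift_fps_mult shift_fps_power shift_fps_prod shift_fps_linear)

lemma degree_numerator_poly: "degree (numerator_poly n r s) \<le> s + r * n"
proof -
  have "degree (\<Prod>j=1..n. [:of_nat j, 1 :: rat:]) \<le> n"
    using degree_prod_sum_le[of "{1..n}" "\<lambda>j. [:of_nat j, 1 :: rat:]"] by simp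
  hence "degree ((\<Prod>j=1..n. [:of_nat j, 1 :: rat:]) ^ r) \<le> n * r"
    by (intro order.trans[OF degree_power_le] mult_right_mono) auto
  moreover have "degree ([:0, 1 :: rat:] ^ s) \<le> s" using degree_power_le[of "[:0, 1 :: rat:]" s] by simp
  ultimately show ?thesis unfolding numerator_poly_def
    by (intro order.trans[OF degree_mult_le]) (simp add: mult.commute)
qed

lemma local_coeffs_poles:
  "local_coeffs n r s k * (\<Prod>k'\<in>{..n} - {k}. lin ((of_nat k' + 1 / 4) - (of_nat k + 1 / 4))) ^ r =
     shift_fps (- (of_nat k + 1 / 4)) (numerator_poly n r s)"
proof -
  have "pole_inverses n k * (\<Prod>k'\<in>{..n} - {k}. lin ((of_nat k' + 1 / 4) - (of_nat k + 1 / 4))) = 1"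
    unfolding pole_inverses_def prod.distrib[symmetric]
  proof (intro prod.neutral ballI)
    fix k' assume "k' \<in> {..n} - {k}"
    hence "(of_nat k' - of_nat k :: rat) \<noteq> 0" by simp
    thus "inverse (lin (of_nat k' - of_nat k)) * lin ((of_nat k' + 1 / 4) - (of_nat k + 1 / 4)) = 1"
      using lin_mult_inverse[of "of_nat k' - of_nat k"] by (simp add: mult.commute)
  qed
  hence "expansion n k ^ r * (\<Prod>k'\<in>{..n} - {k}. lin ((of_nat k' + 1 / 4) - (of_nat k + 1 / 4))) ^ r =
      (\<Prod>j=1..n. lin (- (of_nat k + 1 / 4) + of_nat j)) ^ r"
    unfolding power_mult_distrib[symmetric] expansion_def by (simp only: mult.assoc mult_1_right)
  thus ?thesis unfolding shift_numerator_poly local_coeffs_def by (simp only: mult.assoc)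
qed

lemma rat_coeff_eq:
  assumes "s < r"
  shows "rat_coeff n r s t = (\<Sum>k\<le>n. \<Sum>i<r. weight r s i * local_coeffs n r s k $ i * inv_pow (r - i + s) (t + k))"
proof -
  define c where "c = (\<lambda>k. of_nat k + 1 / 4 :: rat)"
  have c0: "of_nat t + c k \<noteq> 0" for k
  proof -
    have "of_nat t + c k > 0" unfolding c_def by (intro add_nonneg_pos) auto
    thus ?thesis by simp
  qed
  have "rat_fun n r s (of_nat t) = shift_fps (of_nat t) (numerator_poly n r s) * (\<Prod>k\<in>{..n}. inverse (lin (of_nat t + c k))) ^ r"
    by (simp add: rat_fun_def shift_numerator_poly c_def)
  also have "\<dots> = (\<Sum>k\<in>{..n}. \<Sum>i<r. fps_const (local_coeffs n r s k $ i) * inverse (lin (of_nat t + c k)) ^ (r - i))"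
  proof (rule partial_fractions_fps)
    show "degree (numerator_poly n r s) < r * card {..n}"
      using degree_numerator_poly[of n r s] assms by simp
    show "local_coeffs n r s k * (\<Prod>k'\<in>{..n} - {k}. lin (c k' - c k)) ^ r = shift_fps (- c k) (numerator_poly n r s)" for k
      unfolding c_def by (rule local_coeffs_poles)
  qed (auto simp: c0, auto simp: inj_on_def c_def)
  finally have "rat_coeff n r s t = (\<Sum>k\<le>n. \<Sum>i<r. local_coeffs n r s k $ i * (inverse (lin (of_nat t + c k)) ^ (r - i)) $ s)"
    by (simp add: rat_coeff_def fps_sum_nth)
  also have "\<dots> = (\<Sum>k\<le>n. \<Sum>i<r. weight r s i * local_coeffs n r s k $ i * inv_pow (r - i + s) (t + k))"
  proof (intro sum.cong refl)
    fix k i assume i: "i \<in> {..<r}"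
    have "of_nat t + c k = of_nat (4 * (t + k) + 1) / 4" by (simp add: c_def field_simps)
    hence "1 / (of_nat t + c k) ^ (r - i + s) = 4 ^ (r - i + s) * inv_pow (r - i + s) (t + k)"
      unfolding inv_pow_def by (simp only: power_divide) simp
    moreover have "(inverse (lin (of_nat t + c k)) ^ (r - i)) $ s = (- 1) ^ s * of_nat ((r - i + s - 1) choose s) * (1 / (of_nat t + c k) ^ (r - i + s))"
      using inverse_lin_power_nth[OF c0[of k], of "r - i" s] i by simp
    ultimately show "local_coeffs n r s k $ i * (inverse (lin (of_nat t + c k)) ^ (r - i)) $ s =
        weight r s i * local_coeffs n r s k $ i * inv_pow (r - i + s) (t + k)"
      by (simp only: weight_def mult_ac)
  qed
  finally show ?thesis .
qed

text \<open>R decays at least like t^(-2), so its residues add up to 0. For r = s + 2 this is the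
  coefficient belonging to the zeta value at s + 2.\<close>

lemma sum_local_coeffs_eq_0:
  assumes "s + 1 < r"
  shows "(\<Sum>k\<le>n. local_coeffs n r s k $ (r - 1)) = 0"
proof (rule sum_residues_eq_0)
  show "degree (numerator_poly n r s) + 1 < r * card {..n}"
    using degree_numerator_poly[of n r s] assms by simp
  show "local_coeffs n r s k * (\<Prod>k'\<in>{..n} - {k}. lin ((of_nat k' + 1 / 4) - (of_nat k + 1 / 4))) ^ r =
     shift_fps (- (of_nat k + 1 / 4)) (numerator_poly n r s)" for k
    by (rule local_coeffs_poles)
qed (use assms in \<open>auto simp: inj_on_def\<close>)

text \<open>The right side is a coefficient of one fixed power, whatever i is, so the sum over i in
  the translation term becomes a Cauchy product with \<open>local_coeffs\<close>.\<close>

lemma weight_inv_pow_deriv: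
  assumes "i < s + 2"
  shows "weight (s + 2) s i * inv_pow_deriv (s + 2 - i + s) l =
    - of_nat (s + 1) * (inverse (lin (- (of_nat l + 1 / 4))) ^ (s + 2)) $ (s + 1 - i)"
proof -
  define y :: rat where "y = of_nat l + 1 / 4"
  define j where "j = s + 1 - i"
  have j: "s + 2 - i + s = s + 1 + j" "s + 1 + j - 1 = s + j" using assms by (auto simp: j_def)
  have y: "- y \<noteq> 0"
  proof -
    have "y > 0" unfolding y_def by (intro add_nonneg_pos) auto
    thus ?thesis by simp
  qed
  have y4: "of_nat (4 * l + 1) = 4 * y" by (simp add: y_def)
  have bin: "of_nat ((s + j) choose s) * of_nat (s + 1 + j) = (of_nat (s + 1) * of_nat ((s + 1 + j) choose j) :: rat)"
  proof -
    have "Suc s * (Suc (s + j) choose Suc s) = Suc (s + j) * ((s + j) choose s)" by (rule Suc_times_binomial)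
    moreover have "(Suc (s + j) choose Suc s) = (Suc (s + j) choose j)"
      using binomial_symmetric[of j "Suc (s + j)"] by simp
    ultimately show ?thesis by (simp only: of_nat_mult[symmetric] of_nat_eq_iff) (simp add: mult.commute)
  qed
  have "weight (s + 2) s i * inv_pow_deriv (s + 2 - i + s) l =
      - ((- 1) ^ s * (of_nat ((s + j) choose s) * of_nat (s + 1 + j)) * (4 ^ (s + 1 + j) * 4 / (4 * y) ^ (s + 1 + j + 1)))"
  proof -
    have "a * b * p * (- 4 * q / z) = - (a * (b * q) * (p * 4 / z))" for a b p q z :: rat by simp
    thus ?thesis unfolding weight_def inv_pow_deriv_def j y4 .
  qed
  also have "4 ^ (s + 1 + j) * 4 / (4 * y) ^ (s + 1 + j + 1) = 1 / y ^ (s + 2 + j)"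
    using y by (simp add: power_mult_distrib)
  also have "(- 1) ^ s * (of_nat (s + j choose s) * of_nat (s + 1 + j)) * (1 / y ^ (s + 2 + j)) =
      of_nat (s + 1) * ((- 1) ^ j * of_nat ((s + 2 + j - 1) choose j) / (- y) ^ (s + 2 + j))"
  proof -
    have "(- y) ^ (s + 2 + j) = (- 1) ^ s * (- 1) ^ j * y ^ (s + 2 + j)"
      by (subst power_minus) (simp add: power_add)
    hence "(- 1) ^ j / (- y) ^ (s + 2 + j) = (- 1) ^ s * (1 / y ^ (s + 2 + j))"
      by (cases "even s"; cases "even j") simp_all
    moreover have "a * (q * c) * z = q * (b * c / w)" if "b / w = a * z" for a b c q w z :: rat
    proof -
      have "q * (b * c / w) = q * c * (b / w)" by simp
      thus ?thesis unfolding that by (simp only: mult_ac)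
    qed
    moreover have "s + 2 + j - 1 = s + 1 + j" by simp
    ultimately show ?thesis unfolding bin by (simp only:)
  qed
  also have "\<dots> = of_nat (s + 1) * (inverse (lin (- y)) ^ (s + 2)) $ j"
    using inverse_lin_power_nth[OF y, of "s + 2" j] by simp
  finally show ?thesis unfolding y_def j_def by (simp only: mult_minus_left)
qed

section \<open>Cancellation in the rational term\<close>

abbreviation cancel_coeffs :: "nat \<Rightarrow> nat \<Rightarrow> nat \<Rightarrow> nat \<Rightarrow> rat fps" where
  "cancel_coeffs n s k l \<equiv> lin (- (of_nat k + 1 / 4)) ^ s * expansion_cancel n k (k - l) ^ (s + 2)"

definition const_term :: "nat \<Rightarrow> nat \<Rightarrow> rat" where
  "const_term n s = - of_nat (s + 1) * (\<Sum>k\<le>n. \<Sum>l<k. cancel_coeffs n s k l $ (s + 1))"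

text \<open>At the pole of index k the numerator factor with j = k - l is exactly
  \<open>lin (- (of_nat l + 1 / 4))\<close>, so the inverse deletes it instead of introducing a
  denominator 4 l + 1.\<close>

lemma expansion_cancel_eq:
  assumes "l < k" "k \<le> n"
  shows "expansion_cancel n k (k - l) = expansion n k * inverse (lin (- (of_nat l + 1 / 4)))"
proof -
  define z :: rat where "z = - (of_nat l + 1 / 4)"
  have "(\<Prod>j=1..n. lin (- (of_nat k + 1 / 4) + of_nat j)) =
      lin (- (of_nat k + 1 / 4) + of_nat (k - l)) * (\<Prod>j\<in>{1..n} - {k - l}. lin (- (of_nat k + 1 / 4) + of_nat j))"
    using assms by (intro prod.remove) auto
  moreover have "- (of_nat k + 1 / 4) + of_nat (k - l) = (- (of_nat l + 1 / 4) :: rat)"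
    using assms by (simp add: of_nat_diff)
  moreover have "(- (of_nat l + 1 / 4) :: rat) \<noteq> 0"
  proof -
    have "(of_nat l + 1 / 4 :: rat) > 0" by (intro add_nonneg_pos) auto
    thus ?thesis by simp
  qed
  ultimately have "lin z * inverse (lin z) = 1"
    "expansion n k = lin z * (\<Prod>j\<in>{1..n} - {k - l}. lin (- (of_nat k + 1 / 4) + of_nat j)) * pole_inverses n k"
    by (simp_all only: lin_mult_inverse expansion_def z_def not_False_eq_True)
  moreover have "x * y * w * x' = x * x' * (y * w)" for x y w x' :: "rat fps" by (simp only: mult_ac)
  ultimately show ?thesis unfolding z_def[symmetric] expansion_cancel_def by (simp only: mult_1)
qed

lemma const_term_eq:
  "(\<Sum>k\<le>n. \<Sum>i<s + 2. weight (s + 2) s i * local_coeffs n (s + 2) s k $ i * (\<Sum>l<k. inv_pow_deriv (s + 2 - i + s) l)) = const_term n s"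
proof -
  define I where "I = (\<lambda>l. inverse (lin (- (of_nat l + 1 / 4))) ^ (s + 2))"
  have "(\<Sum>i<s + 2. weight (s + 2) s i * local_coeffs n (s + 2) s k $ i * (\<Sum>l<k. inv_pow_deriv (s + 2 - i + s) l)) =
      - of_nat (s + 1) * (\<Sum>l<k. cancel_coeffs n s k l $ (s + 1))" if k: "k \<in> {..n}" for k
  proof -
    have "(\<Sum>i<s + 2. weight (s + 2) s i * local_coeffs n (s + 2) s k $ i * (\<Sum>l<k. inv_pow_deriv (s + 2 - i + s) l)) =
        (\<Sum>i<s + 2. \<Sum>l<k. local_coeffs n (s + 2) s k $ i * (weight (s + 2) s i * inv_pow_deriv (s + 2 - i + s) l))"
      by (simp only: sum_distrib_left mult_ac)
    also have "\<dots> = (\<Sum>l<k. \<Sum>i<s + 2. local_coeffs n (s + 2) s k $ i * (weight (s + 2) s i * inv_pow_deriv (s + 2 - i + s) l))"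
      by (rule sum.swap)
    also have "\<dots> = (\<Sum>l<k. - of_nat (s + 1) * (local_coeffs n (s + 2) s k * I l) $ (s + 1))"
    proof (intro sum.cong refl)
      fix l
      have "(\<Sum>i<s + 2. local_coeffs n (s + 2) s k $ i * (weight (s + 2) s i * inv_pow_deriv (s + 2 - i + s) l)) =
          (\<Sum>i=0..s + 1. - of_nat (s + 1) * (local_coeffs n (s + 2) s k $ i * I l $ (s + 1 - i)))"
      proof (rule sum.cong)
        show "{..<s + 2} = {0..s + 1}" by auto
        fix i assume "i \<in> {0..s + 1}"
        hence "i < s + 2" by simp
        from weight_inv_pow_deriv[OF this, of l]
        show "local_coeffs n (s + 2) s k $ i * (weight (s + 2) s i * inv_pow_deriv (s + 2 - i + s) l) =
            - of_nat (s + 1) * (local_coeffs n (s + 2) s k $ i * I l $ (s + 1 - i))"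
          by (simp only: I_def mult_ac)
      qed
      thus "(\<Sum>i<s + 2. local_coeffs n (s + 2) s k $ i * (weight (s + 2) s i * inv_pow_deriv (s + 2 - i + s) l)) =
          - of_nat (s + 1) * (local_coeffs n (s + 2) s k * I l) $ (s + 1)"
        unfolding fps_mult_nth sum_distrib_left .
    qed
    also have "\<dots> = - of_nat (s + 1) * (\<Sum>l<k. (local_coeffs n (s + 2) s k * I l) $ (s + 1))"
      by (simp only: sum_distrib_left)
    also have "(\<Sum>l<k. (local_coeffs n (s + 2) s k * I l) $ (s + 1)) =
        (\<Sum>l<k. cancel_coeffs n s k l $ (s + 1))"
    proof (rule sum.cong[OF refl])
      fix l assume "l \<in> {..<k}"
      hence "expansion_cancel n k (k - l) ^ (s + 2) = expansion n k ^ (s + 2) * I l"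
        using k unfolding I_def by (subst expansion_cancel_eq) (simp_all only: power_mult_distrib atMost_iff lessThan_iff)
      thus "(local_coeffs n (s + 2) s k * I l) $ (s + 1) =
          cancel_coeffs n s k l $ (s + 1)"
        by (simp only: local_coeffs_def mult.assoc)
    qed
    finally show ?thesis .
  qed
  thus ?thesis unfolding const_term_def sum_distrib_left[of _ _ "{..n}"] by (intro sum.cong refl)
qed

definition zeta_coeff :: "nat \<Rightarrow> nat \<Rightarrow> nat \<Rightarrow> rat" where
  "zeta_coeff n s i = weight (s + 2) s i * (\<Sum>k\<le>n. local_coeffs n (s + 2) s k $ i)"

text \<open>For i \<le> s the exponents s + 2 - i + s run through s + 2, ..., 2 s + 2; an exponent q
  belongs to the zeta value at q + 1.\<close>

theorem linear_form:
  "(\<lambda>N. of_rat (vol2 (rat_coeff n (s + 2) s) N)) \<longlonglongrightarrow>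
    of_rat (const_term n s) + (\<Sum>i\<le>s. of_rat (zeta_coeff n s i) * volkenborn2 (inv_pow (s + 2 - i + s)))"
proof -
  define e where "e = (\<lambda>k i. weight (s + 2) s i * local_coeffs n (s + 2) s k $ i)"
  define q where "q = (\<lambda>i. s + 2 - i + s)"
  have "vol2 (rat_coeff n (s + 2) s) N = (\<Sum>k\<le>n. \<Sum>i<s + 2. e k i * vol2 (\<lambda>t. inv_pow (q i) (t + k)) N)" for N
  proof -
    have "(\<Sum>t<2 ^ N. rat_coeff n (s + 2) s t) = (\<Sum>t<2 ^ N. \<Sum>k\<le>n. \<Sum>i<s + 2. e k i * inv_pow (q i) (t + k))"
      unfolding e_def q_def by (intro sum.cong refl rat_coeff_eq) simp
    also have "\<dots> = (\<Sum>k\<le>n. \<Sum>t<2 ^ N. \<Sum>i<s + 2. e k i * inv_pow (q i) (t + k))" by (rule sum.swap)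
    also have "\<dots> = (\<Sum>k\<le>n. \<Sum>i<s + 2. \<Sum>t<2 ^ N. e k i * inv_pow (q i) (t + k))"
      by (intro sum.cong[OF refl] sum.swap)
    finally show ?thesis
      by (simp add: vol2_def sum_divide_distrib sum_distrib_left del: sum.lessThan_Suc add_2_eq_Suc')
  qed
  hence v: "of_rat (vol2 (rat_coeff n (s + 2) s) N) =
      (\<Sum>k\<le>n. \<Sum>i<s + 2. of_rat (e k i) * of_rat (vol2 (\<lambda>t. inv_pow (q i) (t + k)) N) :: q2)" for N
    by (simp add: of_rat_sum of_rat_mult del: sum.lessThan_Suc add_2_eq_Suc')
  have "(\<lambda>N. of_rat (vol2 (rat_coeff n (s + 2) s) N)) \<longlonglongrightarrow>
      (\<Sum>k\<le>n. \<Sum>i<s + 2. of_rat (e k i) * volkenborn2 (\<lambda>t. inv_pow (q i) (t + k)))"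
    unfolding v
    by (intro q2_tendsto_sum q2_tendsto_mult_left tendsto_volkenborn2[OF differentiable2_shift[OF differentiable2_inv_pow]])
  also have "(\<Sum>k\<le>n. \<Sum>i<s + 2. of_rat (e k i) * volkenborn2 (\<lambda>t. inv_pow (q i) (t + k))) =
      (\<Sum>k\<le>n. \<Sum>i<s + 2. of_rat (e k i) * volkenborn2 (inv_pow (q i))) + of_rat (\<Sum>k\<le>n. \<Sum>i<s + 2. e k i * (\<Sum>l<k. inv_pow_deriv (q i) l))"
    by (simp add: volkenborn2_shift[OF differentiable2_inv_pow] distrib_left sum.distrib of_rat_sum of_rat_mult del: sum.lessThan_Suc add_2_eq_Suc')
  also have "(\<Sum>k\<le>n. \<Sum>i<s + 2. e k i * (\<Sum>l<k. inv_pow_deriv (q i) l)) = const_term n s"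
    unfolding e_def q_def by (rule const_term_eq)
  also have "(\<Sum>k\<le>n. \<Sum>i<s + 2. of_rat (e k i) * volkenborn2 (inv_pow (q i))) =
      (\<Sum>i<s + 2. \<Sum>k\<le>n. of_rat (e k i) * volkenborn2 (inv_pow (q i)))" by (rule sum.swap)
  also have "\<dots> = (\<Sum>i<s + 2. of_rat (zeta_coeff n s i) * volkenborn2 (inv_pow (q i)))"
    by (simp add: zeta_coeff_def e_def sum_distrib_left sum_distrib_right of_rat_sum del: sum.lessThan_Suc add_2_eq_Suc')
  \<comment> \<open>The index s + 1 carries the sum of the residues, which is 0.\<close>
  also have "{..<s + 2} = insert (s + 1) {..s}" by auto
  also have "(\<Sum>i\<in>insert (s + 1) {..s}. of_rat (zeta_coeff n s i) * volkenborn2 (inv_pow (q i))) =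
      (\<Sum>i\<le>s. of_rat (zeta_coeff n s i) * volkenborn2 (inv_pow (q i)))"
    using sum_local_coeffs_eq_0[of s "s + 2" n] by (simp add: zeta_coeff_def)
  finally show ?thesis unfolding q_def by (simp only: add.commute)
qed

subsection \<open>Denominators and size of the coefficients\<close>

lemma dyadic_quarter: "dyadic (- (of_nat k + 1 / 4))"
proof -
  have "- (of_nat k + 1 / 4) = (of_int (- (4 * int k + 1)) / 4 :: rat)" by (simp add: field_simps)
  thus ?thesis by (simp only: dyadic_divide_4 dyadic_of_int)
qed

lemma graded_dyadic_nth:
  assumes "graded_dyadic d w f" "w + j \<le> m"
  shows "dyadic (of_nat d ^ m * f $ j)"
proof -
  have "(of_nat d :: rat) ^ m = of_nat d ^ (m - (w + j)) * of_nat d ^ (w + j)"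
    using assms(2) by (simp flip: power_add)
  moreover have "dyadic (of_nat d ^ (m - (w + j)) * (of_nat d ^ (w + j) * f $ j))"
    using assms(1) by (rule_tac dyadic_mult[OF dyadic_power[OF dyadic_of_nat]]) (simp add: graded_dyadic_def)
  ultimately show ?thesis by (simp only: mult.assoc)
qed

lemma dyadic_zeta_coeff:
  assumes d: "\<And>j. 1 \<le> j \<Longrightarrow> j \<le> n \<Longrightarrow> j dvd d" and i: "i \<le> 2 * s + 3"
  shows "dyadic (of_nat d ^ (2 * s + 3) * zeta_coeff n s i)"
proof -
  have "graded_dyadic d (0 * s + 0 * (s + 2)) (local_coeffs n (s + 2) s k)" if "k \<le> n" for k
    unfolding local_coeffs_def
    by (intro graded_dyadic_mult graded_dyadic_power graded_dyadic_lin dyadic_quarter graded_dyadic_expansion d that)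
  hence A: "dyadic (of_nat d ^ (2 * s + 3) * local_coeffs n (s + 2) s k $ i)" if "k \<le> n" for k
    using i that by (intro graded_dyadic_nth[of d 0]) auto
  have W: "dyadic (weight (s + 2) s i)"
    unfolding weight_def by (intro dyadic_mult dyadic_power) (use dyadic_of_int[of "- 1"] dyadic_of_nat[of 4] in auto)
  have "dyadic (weight (s + 2) s i * (\<Sum>k\<le>n. of_nat d ^ (2 * s + 3) * local_coeffs n (s + 2) s k $ i))"
    by (rule dyadic_mult[OF W dyadic_sum]) (rule A, simp)
  thus ?thesis by (simp only: zeta_coeff_def sum_distrib_left[symmetric] mult.left_commute)
qed

text \<open>The exponent is s + 2 for the deleted zeros plus s + 1 for the order of the
  coefficient.\<close>

lemma dyadic_const_term:
  assumes d: "\<And>j. 1 \<le> j \<Longrightarrow> j \<le> n \<Longrightarrow> j dvd d"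
  shows "dyadic (of_nat d ^ (2 * s + 3) * const_term n s)"
proof -
  have g: "graded_dyadic d (0 * s + 1 * (s + 2)) (cancel_coeffs n s k l)"
    if "l < k" "k \<le> n" for k l
    using that
    by (intro graded_dyadic_mult graded_dyadic_power graded_dyadic_lin dyadic_quarter graded_dyadic_expansion_cancel d) auto
  have A: "dyadic (of_nat d ^ (2 * s + 3) * cancel_coeffs n s k l $ (s + 1))"
    if "l < k" "k \<le> n" for k l
    by (rule graded_dyadic_nth[OF g[OF that]]) simp
  have "dyadic (- of_nat (s + 1) * (\<Sum>k\<le>n. \<Sum>l<k. of_nat d ^ (2 * s + 3) * cancel_coeffs n s k l $ (s + 1)))"
    by (intro dyadic_mult[OF dyadic_minus[OF dyadic_of_nat] dyadic_sum] dyadic_sum A) simp_all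
  thus ?thesis by (simp only: const_term_def sum_distrib_left[symmetric] mult.left_commute)
qed

lemma fps_bound_lin_quarter:
  assumes "k \<le> n"
  shows "fps_bound (of_nat (n + 1)) 1 (lin (- (of_nat k + 1 / 4)))"
proof -
  have "(of_nat k :: rat) \<le> of_nat n" using assms by simp
  thus ?thesis by (auto simp: fps_bound_def lin_nth)
qed

lemma fps_bound_nth_le:
  assumes "fps_bound C M f" "M \<le> L" "1 \<le> L" "j \<le> m"
  shows "\<bar>f $ j\<bar> \<le> C * L ^ m"
proof -
  have "\<bar>f $ j\<bar> \<le> C * M ^ j" using assms(1) by (simp add: fps_bound_def)
  also have "\<dots> \<le> C * L ^ j" using assms(1,2) by (intro mult_left_mono power_mono) (auto simp: fps_bound_def)
  also have "\<dots> \<le> C * L ^ m" using assms by (intro mult_left_mono power_increasing) (auto simp: fps_bound_def)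
  finally show ?thesis .
qed

lemma fps_bound_expansion_cancel:
  assumes "l < k" "k \<le> n"
  shows "fps_bound 4 (8 * of_nat n + 4) (expansion_cancel n k (k - l))"
proof -
  define y :: rat where "y = - (of_nat l + 1 / 4)"
  have y: "\<bar>y\<bar> \<ge> 1 / 4" unfolding y_def by simp
  hence y0: "y \<noteq> 0" "\<bar>1 / y\<bar> \<le> 4" by (auto simp: abs_divide divide_le_eq)
  have "fps_const (1 / y) * fps_const y = (1 :: rat fps)" using y0 by simp
  hence e: "fps_const (1 / y) * (fps_const y * inverse (lin y)) = inverse (lin y)"
    by (simp only: mult.assoc[symmetric] mult_1)
  have "fps_bound (4 * 1) (0 + 4) (fps_const (1 / y) * (fps_const y * inverse (lin y)))"
    by (intro fps_bound_mult fps_bound_const fps_bound_inverse_linear y y0)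
  hence "fps_bound 4 4 (inverse (lin y))" unfolding e by simp
  from fps_bound_mult[OF fps_bound_expansion[OF assms(2)] this]
  show ?thesis unfolding expansion_cancel_eq[OF assms] y_def by simp
qed

lemma abs_zeta_coeff_le:
  assumes i: "i \<le> s + 1"
  shows "\<bar>zeta_coeff n s i\<bar> \<le> \<bar>weight (s + 2) s i\<bar> * (of_nat (n + 1) ^ (s + 1) * (of_nat (13 * (s + 2)) * of_nat (n + 1)) ^ (s + 1))"
proof -
  have "\<bar>local_coeffs n (s + 2) s k $ i\<bar> \<le> of_nat (n + 1) ^ s * 1 ^ (s + 2) * (of_nat (13 * (s + 2)) * of_nat (n + 1)) ^ (s + 1)" if k: "k \<le> n" for k
  proof (rule fps_bound_nth_le)
    show "fps_bound (of_nat (n + 1) ^ s * 1 ^ (s + 2)) (of_nat s * 1 + of_nat (s + 2) * (8 * of_nat n)) (local_coeffs n (s + 2) s k)"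
      unfolding local_coeffs_def by (intro fps_bound_mult fps_bound_power fps_bound_lin_quarter fps_bound_expansion k)
    \<comment> \<open>A generous constant: 13 also covers the larger rate s + (s + 2) (8 n + 4) of
      the rational term, so one K can serve both.\<close>
    have "s * 1 + (s + 2) * (8 * n) \<le> 13 * (s + 2) * (n + 1)" by (simp add: algebra_simps)
    hence "(of_nat (s * 1 + (s + 2) * (8 * n)) :: rat) \<le> of_nat (13 * (s + 2) * (n + 1))" by (simp only: of_nat_le_iff)
    thus "of_nat s * 1 + of_nat (s + 2) * (8 * of_nat n) \<le> (of_nat (13 * (s + 2)) * of_nat (n + 1) :: rat)" by (simp only: of_nat_add of_nat_mult of_nat_numeral of_nat_1)
    have "1 \<le> 13 * (s + 2) * (n + 1)" by simp
    hence "of_nat 1 \<le> (of_nat (13 * (s + 2) * (n + 1)) :: rat)" by (simp only: of_nat_le_iff)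
    thus "1 \<le> (of_nat (13 * (s + 2)) * of_nat (n + 1) :: rat)" by (simp only: of_nat_mult of_nat_1)
  qed (use i in auto)
  hence "\<bar>\<Sum>k\<le>n. local_coeffs n (s + 2) s k $ i\<bar> \<le> (\<Sum>k\<le>n. of_nat (n + 1) ^ s * (of_nat (13 * (s + 2)) * of_nat (n + 1)) ^ (s + 1))"
    by (intro order.trans[OF sum_abs] sum_mono) (simp only: power_one mult_1_right atMost_iff)
  also have "\<dots> = of_nat (n + 1) ^ (s + 1) * (of_nat (13 * (s + 2)) * of_nat (n + 1)) ^ (s + 1)"
    by (simp only: sum_constant card_atMost power_add power_one_right Suc_eq_plus1 mult_ac)
  finally show ?thesis unfolding zeta_coeff_def abs_mult by (intro mult_left_mono) auto
qed

lemma abs_const_term_le: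
  "\<bar>const_term n s\<bar> \<le> of_nat (s + 1) * (4 ^ (s + 2) * (of_nat (n + 1) ^ (s + 2) * (of_nat (13 * (s + 2)) * of_nat (n + 1)) ^ (s + 1)))"
proof -
  define B :: rat where "B = of_nat (n + 1) ^ s * 4 ^ (s + 2) * (of_nat (13 * (s + 2)) * of_nat (n + 1)) ^ (s + 1)"
  have B: "B \<ge> 0" by (simp add: B_def)
  have b: "\<bar>cancel_coeffs n s k l $ (s + 1)\<bar> \<le> B"
    if k: "l < k" "k \<le> n" for k l
    unfolding B_def
  proof (rule fps_bound_nth_le)
    show "fps_bound (of_nat (n + 1) ^ s * 4 ^ (s + 2)) (of_nat s * 1 + of_nat (s + 2) * (8 * of_nat n + 4)) (cancel_coeffs n s k l)"
      by (intro fps_bound_mult fps_bound_power fps_bound_lin_quarter fps_bound_expansion_cancel k)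
    have "s * 1 + (s + 2) * (8 * n + 4) \<le> 13 * (s + 2) * (n + 1)" by (simp add: algebra_simps)
    hence "(of_nat (s * 1 + (s + 2) * (8 * n + 4)) :: rat) \<le> of_nat (13 * (s + 2) * (n + 1))" by (simp only: of_nat_le_iff)
    thus "of_nat s * 1 + of_nat (s + 2) * (8 * of_nat n + 4) \<le> (of_nat (13 * (s + 2)) * of_nat (n + 1) :: rat)" by (simp only: of_nat_add of_nat_mult of_nat_numeral of_nat_1)
    have "1 \<le> 13 * (s + 2) * (n + 1)" by simp
    hence "of_nat 1 \<le> (of_nat (13 * (s + 2) * (n + 1)) :: rat)" by (simp only: of_nat_le_iff)
    thus "1 \<le> (of_nat (13 * (s + 2)) * of_nat (n + 1) :: rat)" by (simp only: of_nat_mult of_nat_1)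
  qed simp
  have "\<bar>\<Sum>k\<le>n. \<Sum>l<k. cancel_coeffs n s k l $ (s + 1)\<bar> \<le> (\<Sum>k\<le>n. \<Sum>l<k. B)"
    by (intro order.trans[OF sum_abs] sum_mono b) auto
  also have "\<dots> \<le> (\<Sum>k\<le>n. of_nat (n + 1) * B)"
    using B by (intro sum_mono) (auto intro!: mult_right_mono)
  also have "\<dots> = 4 ^ (s + 2) * (of_nat (n + 1) ^ (s + 2) * (of_nat (13 * (s + 2)) * of_nat (n + 1)) ^ (s + 1))"
    by (simp only: B_def sum_constant card_atMost power_add power_one_right power2_eq_square Suc_eq_plus1 mult_ac)
  finally show ?thesis unfolding const_term_def abs_mult by (intro mult_mono) auto
qed

subsection \<open>Conclusion\<close>

text \<open>For x = z / 2^e the powers of 2 cancel, and the product of the two absolute values is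
  the odd part of |z|.\<close>

lemma dyadic_product_formula:
  assumes "dyadic x" "x \<noteq> 0"
  shows "1 \<le> abs2_rat x * real_of_rat \<bar>x\<bar>"
proof -
  obtain e where "2 ^ e * x \<in> \<int>" using assms(1) by (auto simp: dyadic_def)
  then obtain z where z: "2 ^ e * x = of_int z" by (elim Ints_cases)
  hence x: "x = of_int z / 2 ^ e" by (simp add: field_simps)
  have z0: "z \<noteq> 0" using assms(2) x by auto
  define m where "m = multiplicity 2 z"
  have "2 ^ m dvd \<bar>z\<bar>" unfolding m_def by (simp add: multiplicity_dvd)
  hence "2 ^ m \<le> \<bar>z\<bar>" using z0 by (intro zdvd_imp_le) auto
  hence "real_of_int (2 ^ m) \<le> real_of_int \<bar>z\<bar>" by (simp only: of_int_le_iff)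
  hence "1 \<le> (1 / 2 ^ m) * \<bar>real_of_int z\<bar>" by (simp add: field_simps)
  also have "\<dots> = (1 / 2 ^ m * 2 ^ e) * (\<bar>real_of_int z\<bar> / 2 ^ e)" by simp
  also have "1 / 2 ^ m * 2 ^ e = abs2_rat x"
    using z0 by (simp add: x abs2_rat_divide abs2_rat_of_int m_def)
  also have "\<bar>real_of_int z\<bar> / 2 ^ e = real_of_rat \<bar>x\<bar>"
    by (simp add: x abs_divide of_rat_divide of_rat_power flip: of_int_abs)
  finally show ?thesis .
qed

section \<open>The least common multiple of 1, ..., n\<close>

text \<open>Each prime enters once for every power of it up to n, that is, with its exponent in the
  least common multiple. In this form the logarithm is a sum of Mangoldt values.\<close>

definition lcm_upto :: "nat \<Rightarrow> nat" where
  "lcm_upto n = (\<Prod>k | k \<in> {1..n} \<and> primepow k. aprimedivisor k)"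

lemma lcm_upto_pos: "lcm_upto n > 0"
  unfolding lcm_upto_def by (intro prod_pos) (auto intro!: aprimedivisor_pos_nat primepow_gt_Suc_0)

lemma ln_lcm_upto: "ln (real (lcm_upto n)) = psi n"
proof -
  have "ln (real (lcm_upto n)) = (\<Sum>k | k \<in> {1..n} \<and> primepow k. ln (real (aprimedivisor k)))"
    unfolding lcm_upto_def of_nat_prod by (subst ln_prod) (auto intro!: aprimedivisor_pos_nat primepow_gt_Suc_0)
  also have "\<dots> = psi n" unfolding psi_def
    by (intro sum.mono_neutral_cong_left) (auto simp: mangoldt_def)
  finally show ?thesis .
qed

text \<open>The Mangoldt values of the divisors of m add up to ln m, so m is the product of the
  primes of its prime power divisors, a partial product of \<open>lcm_upto n\<close>.\<close>

lemma dvd_lcm_upto: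
  assumes "1 \<le> m" "m \<le> n"
  shows "m dvd lcm_upto n"
proof -
  have m: "m \<noteq> 0" using assms by simp
  have pos: "(\<Prod>k\<in>primepow_factors m. aprimedivisor k) > 0"
    by (intro prod_pos) (auto simp: primepow_factors_def intro!: aprimedivisor_pos_nat primepow_gt_Suc_0)
  have "ln (real (\<Prod>k\<in>primepow_factors m. aprimedivisor k)) = (\<Sum>k\<in>primepow_factors m. ln (real (aprimedivisor k)))"
    unfolding of_nat_prod
    using finite_primepow_factors[of m] m by (subst ln_prod) (auto simp: primepow_factors_def intro!: aprimedivisor_pos_nat primepow_gt_Suc_0)
  also have "\<dots> = (\<Sum>k | k dvd m. mangoldt k)"
    using m by (intro sum.mono_neutral_cong_left) (auto simp: primepow_factors_def mangoldt_def)
  also have "\<dots> = ln (real m)" using mangoldt_sum[OF m, where ?'a = real] by simp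
  finally have "real (\<Prod>k\<in>primepow_factors m. aprimedivisor k) = real m"
    using pos m by (subst ln_inj_iff[symmetric]) (simp_all only: of_nat_0_less_iff neq0_conv)
  hence "m = (\<Prod>k\<in>primepow_factors m. aprimedivisor k)" by (simp only: of_nat_eq_iff)
  also have "\<dots> dvd lcm_upto n" unfolding lcm_upto_def
    using assms by (intro prod_dvd_prod_subset) (auto simp: primepow_factors_def dest!: dvd_imp_le intro: primepow_gt_Suc_0 Suc_leI
      dest: primepow_gt_Suc_0)
  finally show ?thesis .
qed

lemma abs2_tendsto_const:
  assumes "X \<longlonglongrightarrow> (L :: q2)" "\<And>n. abs2 (X (n + m)) = c"
  shows "abs2 L = c"
proof -
  have "(\<lambda>n. dist (X (n + m)) 0) \<longlonglongrightarrow> dist L 0"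
    by (rule tendsto_dist[OF LIMSEQ_ignore_initial_segment[OF assms(1)] tendsto_const])
  hence "(\<lambda>n. c) \<longlonglongrightarrow> abs2 L" by (simp add: dist_q2_def assms(2))
  thus ?thesis by (simp add: LIMSEQ_const_iff)
qed

lemma common_denominator:
  fixes \<beta> :: "nat \<Rightarrow> rat"
  shows "\<exists>D > 0. \<forall>i\<le>s. \<exists>z. of_nat D * \<beta> i = of_int z"
proof (induction s)
  case 0
  obtain a b where "quotient_of (\<beta> 0) = (a, b)" by fastforce
  hence "b > 0" "\<beta> 0 = of_int a / of_int b" by (auto intro: quotient_of_denom_pos quotient_of_div)
  hence "of_nat (nat b) * \<beta> 0 = of_int a" "nat b > 0" by simp_all
  thus ?case by blast
next
  case (Suc s)
  then obtain D where D: "D > 0" "\<And>i. i \<le> s \<Longrightarrow> \<exists>z. of_nat D * \<beta> i = of_int z" by blast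
  obtain a b where "quotient_of (\<beta> (Suc s)) = (a, b)" by fastforce
  hence b: "b > 0" "\<beta> (Suc s) = of_int a / of_int b" by (auto intro: quotient_of_denom_pos quotient_of_div)
  have "\<exists>z. of_nat (D * nat b) * \<beta> i = of_int z" if "i \<le> Suc s" for i
  proof (cases "i = Suc s")
    case True
    have "of_nat (D * nat b) * \<beta> i = of_int (int D * a)" using b by (simp add: True)
    thus ?thesis by blast
  next
    case False
    hence "i \<le> s" using that by simp
    then obtain z where "of_nat D * \<beta> i = of_int z" using D(2) by blast
    hence "of_nat (D * nat b) * \<beta> i = of_int (b * z)" using b by (simp add: mult_ac)
    thus ?thesis by blast
  qed
  moreover have "D * nat b > 0" using D b by simp
  ultimately show ?case by blast
qed

theorem theorem1p3:
  fixes s :: nat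
  shows "\<exists>z \<in> {hurwitz_zeta2 j (1/4) | j. j \<in> {int s + 3 .. 2 * int s + 3}}. z \<notin> \<rat>"
proof (rule ccontr)
  assume "\<not> ?thesis"
  hence rat: "hurwitz_zeta2 j (1 / 4) \<in> \<rat>" if "int s + 3 \<le> j" "j \<le> 2 * int s + 3" for j
    using that by auto
  have "volkenborn2 (inv_pow (s + 2 - i + s)) \<in> \<rat>" if i: "i \<le> s" for i
  proof -
    define q where "q = s + 2 - i + s"
    have "volkenborn2 (inv_pow q) = of_nat q * hurwitz_zeta2 (int q + 1) (1 / 4)"
    proof -
      have "q \<ge> 1" using i by (simp add: q_def)
      thus ?thesis using hurwitz_zeta2_quarter[of q] by simp
    qed
    moreover have "hurwitz_zeta2 (int q + 1) (1 / 4) \<in> \<rat>" using i by (intro rat) (auto simp: q_def)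
    ultimately show ?thesis unfolding q_def[symmetric] by simp
  qed
  hence "\<forall>i. \<exists>b. i \<le> s \<longrightarrow> volkenborn2 (inv_pow (s + 2 - i + s)) = of_rat b" by (metis Rats_cases)
  then obtain \<beta> where \<beta>: "\<And>i. i \<le> s \<Longrightarrow> volkenborn2 (inv_pow (s + 2 - i + s)) = of_rat (\<beta> i)" by metis
  obtain D where D: "D > 0" "\<And>i. i \<le> s \<Longrightarrow> \<exists>z. of_nat D * \<beta> i = of_int z"
    using common_denominator[of s \<beta>] by blast
  define S where "S = (\<lambda>n. const_term n s + (\<Sum>i\<le>s. zeta_coeff n s i * \<beta> i))"
  have S2: "abs2_rat (S n) = abs2_rat (fact n * 4 ^ (n + 1)) ^ (s + 2) * 2 ^ a" if n: "n + 1 = 2 ^ a" "a \<ge> 1" for n a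
  proof -
    have "(\<Sum>i\<le>s. of_rat (zeta_coeff n s i) * volkenborn2 (inv_pow (s + 2 - i + s))) = (\<Sum>i\<le>s. of_rat (zeta_coeff n s i) * of_rat (\<beta> i))"
      by (intro sum.cong refl) (simp only: \<beta> atMost_iff)
    hence "of_rat (const_term n s) + (\<Sum>i\<le>s. of_rat (zeta_coeff n s i) * volkenborn2 (inv_pow (s + 2 - i + s))) = of_rat (S n)"
      by (simp only: S_def of_rat_add of_rat_sum of_rat_mult)
    hence "(\<lambda>N. of_rat (vol2 (rat_coeff n (s + 2) s) N)) \<longlonglongrightarrow> (of_rat (S n) :: q2)"
      using linear_form[of n s] by (simp only:)
    from abs2_tendsto_const[OF this, of a] show ?thesis
      using abs2_vol2_rat_coeff[OF n] by (simp only: abs2_of_rat)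
  qed
  have dyadic: "dyadic (of_nat D * of_nat (lcm_upto n) ^ (2 * s + 3) * S n)" for n
  proof -
    define d where "d = lcm_upto n"
    have d: "j dvd d" if "1 \<le> j" "j \<le> n" for j unfolding d_def by (rule dvd_lcm_upto[OF that])
    have "dyadic (of_nat D * \<beta> i)" if "i \<le> s" for i using D(2)[OF that] by auto
    moreover have "dyadic (of_nat d ^ (2 * s + 3) * zeta_coeff n s i)" if "i \<le> s" for i
      using that by (intro dyadic_zeta_coeff d) auto
    ultimately have "dyadic (\<Sum>i\<le>s. (of_nat d ^ (2 * s + 3) * zeta_coeff n s i) * (of_nat D * \<beta> i))"
      by (intro dyadic_sum) (metis atMost_iff dyadic_mult)
    moreover have "dyadic (of_nat d ^ (2 * s + 3) * const_term n s)" by (rule dyadic_const_term[OF d])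
    ultimately have "dyadic (of_nat D * (of_nat d ^ (2 * s + 3) * const_term n s) + (\<Sum>i\<le>s. (of_nat d ^ (2 * s + 3) * zeta_coeff n s i) * (of_nat D * \<beta> i)))"
      by (rule_tac dyadic_add[OF dyadic_mult[OF dyadic_of_nat]])
    also have "of_nat D * (of_nat d ^ (2 * s + 3) * const_term n s) + (\<Sum>i\<le>s. (of_nat d ^ (2 * s + 3) * zeta_coeff n s i) * (of_nat D * \<beta> i)) =
        of_nat D * of_nat d ^ (2 * s + 3) * S n"
      unfolding S_def distrib_left sum_distrib_left by (simp only: mult_ac)
    finally show ?thesis unfolding d_def .
  qed
  define K :: rat where "K = of_nat (13 * (s + 2)) ^ (s + 1) * (of_nat (s + 1) * 4 ^ (s + 2) + (\<Sum>i\<le>s. \<bar>weight (s + 2) s i\<bar> * \<bar>\<beta> i\<bar>))"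
  have bound: "\<bar>S n\<bar> \<le> K * of_nat (n + 1) ^ (2 * s + 3)" for n
  proof -
    define m where "m = (of_nat (n + 1) :: rat)"
    define B where "B = (of_nat (13 * (s + 2)) :: rat) ^ (s + 1)"
    have m: "m \<ge> 1" by (simp add: m_def)
    have "\<bar>S n\<bar> \<le> \<bar>const_term n s\<bar> + (\<Sum>i\<le>s. \<bar>zeta_coeff n s i\<bar> * \<bar>\<beta> i\<bar>)"
      unfolding S_def abs_mult[symmetric] by (rule order.trans[OF abs_triangle_ineq add_left_mono[OF sum_abs]])
    also have "\<dots> \<le> of_nat (s + 1) * 4 ^ (s + 2) * B * m ^ (2 * s + 3) + (\<Sum>i\<le>s. \<bar>weight (s + 2) s i\<bar> * B * m ^ (2 * s + 3) * \<bar>\<beta> i\<bar>)"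
    proof (intro add_mono sum_mono mult_right_mono)
      have "m ^ (s + 2) * m ^ (s + 1) = m ^ (2 * s + 3)" unfolding power_add[symmetric] by (rule arg_cong[of _ _ "(^) m"]) simp
      thus "\<bar>const_term n s\<bar> \<le> of_nat (s + 1) * 4 ^ (s + 2) * B * m ^ (2 * s + 3)"
        using abs_const_term_le[of n s] unfolding m_def[symmetric] power_mult_distrib B_def[symmetric] by (simp only: mult_ac)
      fix i assume i: "i \<in> {..s}"
      have "m ^ (s + 1) * m ^ (s + 1) \<le> m ^ (2 * s + 3)" unfolding power_add[symmetric] using m by (intro power_increasing) auto
      hence "(\<bar>weight (s + 2) s i\<bar> * B) * (m ^ (s + 1) * m ^ (s + 1)) \<le> (\<bar>weight (s + 2) s i\<bar> * B) * m ^ (2 * s + 3)"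
        by (intro mult_left_mono) (auto simp: B_def)
      moreover have "\<bar>zeta_coeff n s i\<bar> \<le> (\<bar>weight (s + 2) s i\<bar> * B) * (m ^ (s + 1) * m ^ (s + 1))"
        using abs_zeta_coeff_le[of i s n] i unfolding m_def[symmetric] power_mult_distrib B_def[symmetric] by (simp add: mult_ac)
      ultimately show "\<bar>zeta_coeff n s i\<bar> \<le> \<bar>weight (s + 2) s i\<bar> * B * m ^ (2 * s + 3)" by (rule order.trans[rotated])
    qed auto
    also have "\<dots> = K * m ^ (2 * s + 3)"
      unfolding K_def B_def[symmetric] unfolding distrib_left distrib_right sum_distrib_left sum_distrib_right by (simp only: mult_ac)
    finally show ?thesis by (simp only: m_def)
  qed
  define K' where "K' = max 1 (real_of_rat K)"
  \<comment> \<open>The power of n + 1 is (s + 3) + (2 s + 3): s + 2 factors 2^a from n!, one from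
    the mean over the classes, the rest from the coefficients. The exponent of 2 is -3 (s + 2) n +
    3/2 (2 s + 3) n = -3/2 n.\<close>
  have "((\<lambda>n. real D * K' * real (n + 1) ^ (3 * s + 6) * 2 powr (- (3 / 2) * real n)) \<longlongrightarrow> 0) sequentially"
    by real_asymp
  hence "\<forall>\<^sub>F n in sequentially. real D * K' * real (n + 1) ^ (3 * s + 6) * 2 powr (- (3 / 2) * real n) < 1"
    by (rule order_tendstoD) simp
  with psi_upper_bound have "\<forall>\<^sub>F n in sequentially. psi n \<le> 3 / 2 * ln 2 * real n \<and>
      real D * K' * real (n + 1) ^ (3 * s + 6) * 2 powr (- (3 / 2) * real n) < 1"
    by (rule eventually_conj)
  then obtain n0 where n0: "\<And>n. n \<ge> n0 \<Longrightarrow> psi n \<le> 3 / 2 * ln 2 * real n"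
      "\<And>n. n \<ge> n0 \<Longrightarrow> real D * K' * real (n + 1) ^ (3 * s + 6) * 2 powr (- (3 / 2) * real n) < 1"
    unfolding eventually_sequentially by blast
  define a where "a = n0 + 1"
  define n :: nat where "n = 2 ^ a - 1"
  have n: "n + 1 = 2 ^ a" and a: "a \<ge> 1" by (simp_all add: n_def a_def)
  have "n0 < 2 ^ n0" by (rule less_exp)
  also have "\<dots> \<le> 2 ^ n0 * 2 - 1" by simp
  finally have "n \<ge> n0" by (simp add: n_def a_def)
  define d where "d = lcm_upto n"
  define x where "x = of_nat D * of_nat d ^ (2 * s + 3) * S n"
  have "real d = exp (psi n)" unfolding d_def ln_lcm_upto[symmetric] using lcm_upto_pos[of n] by simp
  also have "\<dots> \<le> exp (3 / 2 * ln 2 * real n)" using n0(1)[OF \<open>n \<ge> n0\<close>] by simp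
  also have "\<dots> = 2 powr (3 / 2 * real n)" by (simp add: powr_def mult_ac)
  finally have d: "real d \<le> 2 powr (3 / 2 * real n)" .
  have rn: "2 ^ a = real (n + 1)" unfolding n by simp
  have "S n \<noteq> 0"
  proof
    assume "S n = 0"
    with S2[OF n a] have "abs2_rat (fact n * 4 ^ (n + 1)) ^ (s + 2) * 2 ^ a = 0" by simp
    thus False by simp
  qed
  hence "x \<noteq> 0" using D(1) lcm_upto_pos[of n] by (simp add: x_def d_def)
  have "1 \<le> abs2_rat x * real_of_rat \<bar>x\<bar>"
    by (rule dyadic_product_formula[OF _ \<open>x \<noteq> 0\<close>]) (simp only: x_def d_def dyadic)
  also have "\<dots> \<le> (real (n + 1) ^ (s + 3) * 2 powr (- 3 * real (s + 2) * real n)) *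
      (real D * 2 powr (3 / 2 * real (2 * s + 3) * real n) * (K' * real (n + 1) ^ (2 * s + 3)))"
  proof (rule mult_mono)
    \<comment> \<open>D and d are integers, so multiplying by them cannot increase the 2-adic
      size.\<close>
    have "abs2_rat x \<le> 1 * 1 * abs2_rat (S n)"
      unfolding x_def using abs2_rat_of_nat_le_1[of "d ^ (2 * s + 3)"]
      by (intro abs2_rat_mult_le abs2_rat_of_nat_le_1) auto
    also have "\<dots> = (abs2_rat (fact n) * abs2_rat (4 ^ (n + 1))) ^ (s + 2) * 2 ^ a"
      unfolding S2[OF n a] abs2_rat_mult by simp
    also have "\<dots> \<le> (2 ^ a / 2 ^ n * (1 / 4 ^ n)) ^ (s + 2) * 2 ^ a"
    proof -
      have "abs2_rat (4 ^ (n + 1)) = (1 / 4) ^ (n + 1)" by (simp only: abs2_rat_power abs2_rat_four)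
      also have "\<dots> \<le> (1 / 4) ^ n" by (intro power_decreasing) auto
      finally have "abs2_rat (4 ^ (n + 1)) \<le> 1 / 4 ^ n" by (simp only: power_one_over)
      thus ?thesis by (intro mult_right_mono power_mono mult_mono abs2_fact_le n) auto
    qed
    also have "2 ^ a / 2 ^ n * (1 / 4 ^ n) = real (n + 1) * 2 powr (- 3 * real n)"
    proof -
      have "2 powr real (3 * n) = (2 :: real) ^ (3 * n)" by (rule powr_realpow) simp
      also have "\<dots> = 2 ^ n * 4 ^ n" unfolding power_mult power_mult_distrib[symmetric] by simp
      finally have "2 powr (- real (3 * n)) = 1 / (2 ^ n * 4 ^ n)" by (simp only: powr_minus_divide)
      moreover have "- real (3 * n) = - 3 * real n" by simp
      ultimately show ?thesis unfolding rn by simp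
    qed
    also have "(real (n + 1) * 2 powr (- 3 * real n)) ^ (s + 2) * 2 ^ a = real (n + 1) ^ (s + 3) * 2 powr (- 3 * real (s + 2) * real n)"
    proof -
      have "(2 powr (- 3 * real n)) ^ (s + 2) = 2 powr (real (s + 2) * (- 3 * real n))"
        by (rule powr_power) simp
      also have "real (s + 2) * (- 3 * real n) = - 3 * real (s + 2) * real n" by (simp only: mult_ac)
      finally have p: "(2 powr (- 3 * real n)) ^ (s + 2) = 2 powr (- 3 * real (s + 2) * real n)" .
      have e: "real (n + 1) ^ (s + 3) = real (n + 1) ^ (s + 2) * real (n + 1)" by (simp add: numeral_3_eq_3)
      show ?thesis unfolding power_mult_distrib p rn e by (simp only: mult_ac)
    qed
    finally show "abs2_rat x \<le> real (n + 1) ^ (s + 3) * 2 powr (- 3 * real (s + 2) * real n)" .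
    have "real_of_rat \<bar>x\<bar> = real D * real d ^ (2 * s + 3) * real_of_rat \<bar>S n\<bar>"
      by (simp add: x_def abs_mult of_rat_mult of_rat_power)
    also have "\<dots> \<le> real D * (2 powr (3 / 2 * real n)) ^ (2 * s + 3) * (K' * real (n + 1) ^ (2 * s + 3))"
    proof (intro mult_mono mult_left_mono power_mono d)
      have "real_of_rat \<bar>S n\<bar> \<le> real_of_rat (K * of_nat (n + 1) ^ (2 * s + 3))" using bound[of n] by (simp only: of_rat_less_eq)
      also have "\<dots> = real_of_rat K * real (n + 1) ^ (2 * s + 3)" by (simp only: of_rat_mult of_rat_power of_rat_of_nat_eq)
      also have "\<dots> \<le> K' * real (n + 1) ^ (2 * s + 3)" by (intro mult_right_mono) (auto simp: K'_def)
      finally show "real_of_rat \<bar>S n\<bar> \<le> K' * real (n + 1) ^ (2 * s + 3)" .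
    qed auto
    also have "(2 powr (3 / 2 * real n)) ^ (2 * s + 3) = 2 powr (3 / 2 * real (2 * s + 3) * real n)"
      by (subst powr_power) (simp_all add: mult_ac)
    finally show "real_of_rat \<bar>x\<bar> \<le> real D * 2 powr (3 / 2 * real (2 * s + 3) * real n) * (K' * real (n + 1) ^ (2 * s + 3))" .
  qed auto
  also have "\<dots> = real D * K' * (real (n + 1) ^ (s + 3) * real (n + 1) ^ (2 * s + 3)) *
      (2 powr (- 3 * real (s + 2) * real n) * 2 powr (3 / 2 * real (2 * s + 3) * real n))"
    by (simp only: mult_ac)
  also have "real (n + 1) ^ (s + 3) * real (n + 1) ^ (2 * s + 3) = real (n + 1) ^ (3 * s + 6)"
    unfolding power_add[symmetric] by (rule arg_cong[of _ _ "(^) (real (n + 1))"]) simp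
  also have "2 powr (- 3 * real (s + 2) * real n) * 2 powr (3 / 2 * real (2 * s + 3) * real n) = 2 powr (- (3 / 2) * real n)"
    unfolding powr_add[symmetric] by (rule arg_cong[of _ _ "(powr) 2"]) (simp add: algebra_simps)
  also have "real D * K' * real (n + 1) ^ (3 * s + 6) * 2 powr (- (3 / 2) * real n) < 1"
    by (rule n0(2)[OF \<open>n \<ge> n0\<close>])
  finally show False by simp
qed

end
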